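(* Let $S_0=0$ and $S_j=\sum_{\ell=1}^jX_\ell$ for $1\le j\le n$, where $X_1,\ldots,X_n$ are exchangeable real random variables. Let $S^{[0,n]}=\{(j,S_j):0\le j\le n\}$ and let $\bar C^{[0,n]}$ be the concave majorant of $S^{[0,n]}$. Suppose $\bar c^{[0,n]}\in\mathrm{Supp}(\bar C^{[0,n]})$. Let $q(\cdot)$ be the probability density (mass) function on the set $\mathcal{N}_n$ of compositions of $n$ that is the regular conditional distribution of $\Xi^K_{[0,n]}$ conditionally given $\bar C_\rho^{[0,n]}=\bar c^{[0,n]}$. Let $(N_{n,1},N_{n,2},\ldots,N_{n,K_n})$ be a composition of $n$ chosen according to $q(\cdot)$, independently of $\{X_j:1\le j\le n\}$. Conditionally given $\{K_n=k\}$ and $\{N_{n,i}=n_i:1\le i\le k\}$, let $Y_1,\ldots,Y_n$ be random variables, independent of all previously introduced random variables, whose joint law is the regular conditional joint distribution of $X_1,\ldots,X_n$ conditionally given $\{S_j=\bar c^{[0,n]}(j),\ j=\sum_{i=1}^mn_i,\ 1\le m\le k\}$. Conditionally given $Y_1,\ldots,Y_n$, let $B$ be the random set of $(n_1,\ldots,n_k)$-cyclic permutations $\sigma$ of $[n]$ such that $\sigma\in B$ if and only if $$\sum_{\ell=1}^jY_{\sigma(\ell)}\le\bar c^{[0,n]}(j)\quad\text{for }1\le j\le n.$$ Let $\hat\rho$ be an independently chosen uniform random element of $B$, and let $S_j^{\hat\rho}=\sum_{\ell=1}^jY_{\hat\rho(\ell)}$ for $1\le j\le n$, $S_0^{\hat\rho}=0$.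 Then $S_{\hat\rho}^{[0,n]}:=\{(j,S_j^{\hat\rho}):0\le j\le n\}$ has the regular conditional distribution of $S^{[0,n]}$ conditionally given $\bar C^{[0,n]}=\bar c^{[0,n]}$.
   Context: The concave majorant of a walk $(j,s_j)_{0\le j\le n}$ is the least concave function $C$ on $[0,n]$ with $C(j)\ge s_j$ for $0\le j\le n$. $\mathrm{Supp}(\bar C^{[0,n]})$ is the support of the law of $\bar C^{[0,n]}$, a measure on concave functions on $[0,n]$. $[n]=\{1,\ldots,n\}$. A composition of $n$ is a finite sequence of positive integers with sum $n$. For a composition $(n_1,\ldots,n_k)$ of $n$, a permutation $\sigma$ of $[n]$ is $(n_1,\ldots,n_k)$-cyclic if its only action is to cyclically permute (rotate) the first $n_1$ elements of $[n]$, cyclically permute the next $n_2$ elements of $[n]$, and so on; e.g. $234175689$ is a $(4,3,2)$-cyclic permutation of $[9]$. Construction of $S_\rho^{[0,n]}$ and $\Xi^K_{[0,n]}$. Independently of $X_1,\ldots,X_n$, let $(n_1,\ldots,n_k)$ be the cycle lengths, in non-increasing order, of a uniform random permutation of $[n]$. Split $X_1,\ldots,X_n$ into $k$ consecutive blocks of lengths $n_1,\ldots,n_k$. Consider all choices of an ordering $\tau$ (a permutation of $[k]$, block $\tau(i)$ being placed in position $i$) and of a cyclic shift of the increments in each block (one of $n_i$ shifts for block $i$) such that, after the rearrangement, the arithmetic means of the successive blocks are non-increasing and, in each block, the average of the first $m$ increments is at most the mean of the block for every $m$ up to the block length. Choose one of these admissible choices uniformly at random. $S_\rho^{[0,n]}$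 is the walk started from $0$ with the rearranged increments, $\bar C_\rho^{[0,n]}$ is its concave majorant, and $\Xi^K_{[0,n]}=(n_{\tau(1)},\ldots,n_{\tau(k)})$ is the composition of $n$ given by the block lengths in their order after rearrangement. *)

theory Defs
  imports
    "HOL-Probability.Probability"
    "HOL-Combinatorics.Combinatorics"
begin

subsection \<open>Increments, walks and concave majorants\<close>

abbreviation incr_space :: "nat \<Rightarrow> (nat \<Rightarrow> real) measure" where
  "incr_space n \<equiv> (\<Pi>\<^sub>M i\<in>{1..n}. borel)"

definition increments :: "nat \<Rightarrow> (nat \<Rightarrow> 'a \<Rightarrow> real) \<Rightarrow> 'a \<Rightarrow> nat \<Rightarrow> real" where
  "increments n X \<omega> = (\<lambda>i\<in>{1..n}. X i \<omega>)"

definition exchangeable :: "'a measure \<Rightarrow> nat \<Rightarrow> (nat \<Rightarrow> 'a \<Rightarrow> real) \<Rightarrow> bool" where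
  "exchangeable M n X \<longleftrightarrow>
     (\<forall>p. p permutes {1..n} \<longrightarrow>
        distr M (incr_space n) (increments n (\<lambda>i. X (p i))) = distr M (incr_space n) (increments n X))"

text \<open>A walk \<open>{(j, s j) | 0 \<le> j \<le> n}\<close> is represented by the function \<open>j \<mapsto> s j\<close> on \<open>{0..n}\<close>.\<close>

abbreviation walk_space :: "nat \<Rightarrow> (nat \<Rightarrow> real) measure" where
  "walk_space n \<equiv> (\<Pi>\<^sub>M j\<in>{0..n}. borel)"

definition walk :: "nat \<Rightarrow> (nat \<Rightarrow> real) \<Rightarrow> nat \<Rightarrow> real" where
  "walk n x = (\<lambda>j\<in>{0..n}. \<Sum>l=1..j. x l)"

text \<open>
  Functions on \<open>[0,n]\<close> are extensional, so that the pointwise order of the type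
  \<open>real \<Rightarrow> real\<close> is the pointwise order on \<open>[0,n]\<close>.
\<close>

definition concave_majorant :: "nat \<Rightarrow> (nat \<Rightarrow> real) \<Rightarrow> real \<Rightarrow> real" where
  "concave_majorant n s =
     (LEAST c. c \<in> extensional {0..real n} \<and> concave_on {0..real n} c \<and> (\<forall>j\<le>n. s j \<le> c (real j)))"

definition concave_space :: "nat \<Rightarrow> (real \<Rightarrow> real) measure" where
  "concave_space n = restrict_space (\<Pi>\<^sub>M t\<in>{0..real n}. borel) {c. concave_on {0..real n} c}"

text \<open>Topological support with respect to the uniform distance on \<open>[0,n]\<close>.\<close>

definition Supp :: "nat \<Rightarrow> (real \<Rightarrow> real) measure \<Rightarrow> (real \<Rightarrow> real) set" where
  "Supp n L =
     {c \<in> space L. \<forall>\<epsilon>>0. emeasure L {g \<in> space L. \<forall>t\<in>{0..real n}. \<bar>g t - c t\<bar> \<le> \<epsilon>} > 0}"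

subsection \<open>Regular conditional distributions\<close>

text \<open>
  \<open>\<kappa>\<close>, defined on the set \<open>D\<close> of values of \<open>W\<close>, is a regular conditional distribution of \<open>Z\<close> given \<open>W\<close>.
  The case \<open>A = space N\<close>, \<open>B = space T\<close> shows that \<open>W\<close> lies in \<open>D\<close> almost surely.
\<close>

definition regular_cond_distr ::
  "'a measure \<Rightarrow> ('a \<Rightarrow> 'b) \<Rightarrow> 'b measure \<Rightarrow> ('a \<Rightarrow> 'c) \<Rightarrow> 'c measure \<Rightarrow> 'c set \<Rightarrow> ('c \<Rightarrow> 'b measure) \<Rightarrow> bool"
where
  "regular_cond_distr M Z N W T D \<kappa> \<longleftrightarrow>
     Z \<in> M \<rightarrow>\<^sub>M N \<and> W \<in> M \<rightarrow>\<^sub>M T \<and> D \<in> sets T \<and>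
     \<kappa> \<in> restrict_space T D \<rightarrow>\<^sub>M prob_algebra N \<and>
     (\<forall>A\<in>sets N. \<forall>B\<in>sets T.
        emeasure M {\<omega>\<in>space M. Z \<omega> \<in> A \<and> W \<omega> \<in> B} =
        (\<integral>\<^sup>+ w\<in>B \<inter> D. emeasure (\<kappa> w) A \<partial>distr M T W))"

subsection \<open>Compositions and blocks\<close>

definition compositions :: "nat \<Rightarrow> nat list set" where
  "compositions n = {ns. (\<forall>m\<in>set ns. 0 < m) \<and> sum_list ns = n}"

primrec split_blocks :: "nat list \<Rightarrow> 'b list \<Rightarrow> 'b list list" where
  "split_blocks [] xs = []"
| "split_blocks (m # ms) xs = take m xs # split_blocks ms (drop m xs)"

text \<open>The values of \<open>s\<close> at the partial sums of the composition \<open>ns\<close>.\<close>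

abbreviation ends_space :: "nat list \<Rightarrow> (nat \<Rightarrow> real) measure" where
  "ends_space ns \<equiv> (\<Pi>\<^sub>M m\<in>{1..length ns}. borel)"

definition block_ends :: "nat list \<Rightarrow> (nat \<Rightarrow> real) \<Rightarrow> nat \<Rightarrow> real" where
  "block_ends ns s = (\<lambda>m\<in>{1..length ns}. s (sum_list (take m ns)))"

subsection \<open>The rearranged walk and its composition\<close>

definition cycle_lengths :: "nat \<Rightarrow> (nat \<Rightarrow> nat) \<Rightarrow> nat list" where
  "cycle_lengths n p =
     rev (sorted_list_of_multiset (image_mset card (mset_set (orbit p ` {1..n}))))"

definition mean :: "real list \<Rightarrow> real" where
  "mean b = sum_list b / real (length b)"

text \<open>
  A choice \<open>(\<tau>, r)\<close> puts block \<open>\<tau> ! i\<close>, cyclically shifted by \<open>r ! (\<tau> ! i)\<close>, into position \<open>i\<close>;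
  positions and blocks are numbered from \<open>0\<close>.
\<close>

definition rearranged_blocks ::
  "nat \<Rightarrow> (nat \<Rightarrow> real) \<Rightarrow> (nat \<Rightarrow> nat) \<Rightarrow> nat list \<times> nat list \<Rightarrow> real list list"
where
  "rearranged_blocks n x p =
     (\<lambda>(\<tau>, r). let bs = split_blocks (cycle_lengths n p) (map x [1..<Suc n])
                in map (\<lambda>i. rotate (r ! i) (bs ! i)) \<tau>)"

definition choices :: "nat list \<Rightarrow> (nat list \<times> nat list) set" where
  "choices ns = {(\<tau>, r). \<tau> \<in> permutations_of_set {..<length ns} \<and>
                          length r = length ns \<and> (\<forall>i<length ns. r ! i < ns ! i)}"

definition admissible_choices ::
  "nat \<Rightarrow> (nat \<Rightarrow> real) \<Rightarrow> (nat \<Rightarrow> nat) \<Rightarrow> (nat list \<times> nat list) set"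
where
  "admissible_choices n x p =
     {ch \<in> choices (cycle_lengths n p).
        sorted_wrt (\<ge>) (map mean (rearranged_blocks n x p ch)) \<and>
        (\<forall>b\<in>set (rearranged_blocks n x p ch). \<forall>m\<in>{1..length b}. mean (take m b) \<le> mean b)}"

definition rho_walk ::
  "nat \<Rightarrow> (nat \<Rightarrow> real) \<Rightarrow> (nat \<Rightarrow> nat) \<Rightarrow> nat list \<times> nat list \<Rightarrow> nat \<Rightarrow> real"
where
  "rho_walk n x p ch = (\<lambda>j\<in>{0..n}. sum_list (take j (concat (rearranged_blocks n x p ch))))"

definition rho_composition ::
  "nat \<Rightarrow> (nat \<Rightarrow> real) \<Rightarrow> (nat \<Rightarrow> nat) \<Rightarrow> nat list \<times> nat list \<Rightarrow> nat list"
where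
  "rho_composition n x p ch = map length (rearranged_blocks n x p ch)"

text \<open>
  \<open>P\<close> is a uniform random permutation of \<open>{1..n}\<close> independent of the increments, and \<open>R\<close> is,
  given the increments and \<open>P\<close>, a uniform random admissible choice. Admissibility is required for
  every \<open>\<omega>\<close>, not only almost surely, so that the resulting composition is always one of \<open>n\<close>.
\<close>

definition rho_construction ::
  "'a measure \<Rightarrow> nat \<Rightarrow> (nat \<Rightarrow> 'a \<Rightarrow> real) \<Rightarrow> ('a \<Rightarrow> nat \<Rightarrow> nat) \<Rightarrow> ('a \<Rightarrow> nat list \<times> nat list) \<Rightarrow> bool"
where
  "rho_construction M n X P R \<longleftrightarrow>
     P \<in> M \<rightarrow>\<^sub>M count_space {p. p permutes {1..n}} \<and>
     distr M (count_space {p. p permutes {1..n}}) P = uniform_count_measure {p. p permutes {1..n}} \<and>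
     prob_space.indep_set M
       (sets (vimage_algebra (space M) (increments n X) (incr_space n)))
       (sets (vimage_algebra (space M) P (count_space {p. p permutes {1..n}}))) \<and>
     (\<forall>\<omega>\<in>space M. R \<omega> \<in> admissible_choices n (increments n X \<omega>) (P \<omega>)) \<and>
     regular_cond_distr M R (count_space UNIV)
       (\<lambda>\<omega>. (increments n X \<omega>, P \<omega>)) (incr_space n \<Otimes>\<^sub>M count_space {p. p permutes {1..n}})
       (space (incr_space n \<Otimes>\<^sub>M count_space {p. p permutes {1..n}}))
       (\<lambda>(x, p). measure_pmf (pmf_of_set (admissible_choices n x p)))"

subsection \<open>The walk obtained by a uniform cyclic rearrangement below a concave function\<close>

text \<open>\<open>\<sigma>\<close> is described by its one-line notation \<open>\<sigma> 1, \<dots>, \<sigma> n\<close>.\<close>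

definition cyclic_permutations :: "nat \<Rightarrow> nat list \<Rightarrow> (nat \<Rightarrow> nat) set" where
  "cyclic_permutations n ns =
     {\<sigma>. \<sigma> permutes {1..n} \<and>
          (\<exists>r. length r = length ns \<and>
               map \<sigma> [1..<Suc n] = concat (map2 rotate r (split_blocks ns [1..<Suc n])))}"

definition dominated_permutations ::
  "nat \<Rightarrow> (real \<Rightarrow> real) \<Rightarrow> nat list \<Rightarrow> (nat \<Rightarrow> real) \<Rightarrow> (nat \<Rightarrow> nat) set"
where
  "dominated_permutations n c ns y =
     {\<sigma> \<in> cyclic_permutations n ns. \<forall>j\<in>{1..n}. (\<Sum>l=1..j. y (\<sigma> l)) \<le> c (real j)}"

text \<open>
  The law of the rearranged walk for a given concave function \<open>c\<close>: a composition \<open>ns\<close> is drawn from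
  \<open>q c\<close>, increments \<open>y\<close> from the conditional law \<open>\<nu> ns\<close> given that the walk agrees with \<open>c\<close> at the
  block ends, and \<open>\<sigma>\<close> uniformly from \<open>dominated_permutations n c ns y\<close>. If that set is empty, which
  has to be shown to be a null event, \<open>pmf_of_set\<close> is an unspecified distribution.
\<close>

definition rho_hat_law ::
  "nat \<Rightarrow> ((real \<Rightarrow> real) \<Rightarrow> nat list measure) \<Rightarrow> (nat list \<Rightarrow> (nat \<Rightarrow> real) \<Rightarrow> (nat \<Rightarrow> real) measure) \<Rightarrow>
   (real \<Rightarrow> real) \<Rightarrow> (nat \<Rightarrow> real) measure"
where
  "rho_hat_law n q \<nu> c =
     do {
       ns \<leftarrow> q c;
       y \<leftarrow> \<nu> ns (block_ends ns (\<lambda>j. c (real j)));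
       distr (measure_pmf (pmf_of_set (dominated_permutations n c ns y))) (walk_space n)
         (\<lambda>\<sigma>. walk n (y \<circ> \<sigma>))
     }"

end

theory Submission
  imports Defs
begin

text \<open>
  Call a division of the increments into consecutive blocks good if the means of the blocks are
  non-increasing and the walk of each block stays below its chord. The polygon through the block
  ends is then concave, lies above the walk and meets it at the block ends, so it is the concave
  majorant (\<open>concave_majorant_walk\<close>). A choice is admissible exactly if it makes the blocks good,
  and the number of such choices depends on the blocks only up to order and rotation
  (\<open>card_good_choices\<close>, \<open>good_arrangements_rearr\<close>).

  Consider the law of the rearranged increments on the event that their composition is \<open>ns\<close>. It is
  a sum over permutations and choices of integrals of functions of the rearranged increments. These
  are a permutation of the increments, so by exchangeability each term may be evaluated at the
  original increments. What remains is to count the pairs of a permutation and a choice that produce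
  the composition \<open>ns\<close>. There are \<open>n!\<close> of them, because cycles that are ordered and marked are
  words cut into blocks (\<open>count_choices_with_composition\<close>). Hence the law has the density
  \<open>composition_weight ns\<close> with respect to the law of the increments: the inverse number of good
  arrangements if the blocks cut out by \<open>ns\<close> are good, and \<open>0\<close> otherwise (\<open>rho_law\<close>). For fixed
  increments the weights of all compositions add up to \<open>1\<close> (\<open>sum_good_compositions\<close>), so the
  rearranged increments have the law of the original ones (\<open>rho_incr_law\<close>), and so have their
  concave majorants.

  It remains to condition on composition and majorant. On the event that the composition is \<open>ns\<close>,
  the majorant is a function of the values of the walk at the block ends, which do not change if
  increments are rotated within their blocks. Averaging over all these rotations replaces the
  increments by a uniform random cyclic rearrangement among those below the majorant, and leaves a
  factor \<open>end_weight\<close> that depends on the block ends only (\<open>composition_weight_average\<close>). The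
  increments may therefore be drawn from their conditional law given the block ends
  (\<open>rho_comp_kernel_law\<close>). This is the claim for a fixed composition (\<open>conditional_average\<close>), and
  mixing with the conditional law of the composition given the majorant gives the theorem.
\<close>

section \<open>Blocks and their rearrangements\<close>

text \<open>
  The rearrangement of \<open>rearranged_blocks\<close> for entries of any type. Applied to blocks of indices, it
  shows which permutation of the increments takes place.
\<close>

definition rearr :: "'b list list \<Rightarrow> nat list \<times> nat list \<Rightarrow> 'b list list" where
  "rearr bs = (\<lambda>(\<tau>, r). map (\<lambda>i. rotate (r ! i) (bs ! i)) \<tau>)"

lemma length_split_blocks [simp]: "length (split_blocks ms xs) = length ms"
  by (induction ms arbitrary: xs) auto

lemma map_length_split_blocks:
  "sum_list ms \<le> length xs \<Longrightarrow> map length (split_blocks ms xs) = ms"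
  by (induction ms arbitrary: xs) auto

lemma concat_split_blocks:
  "sum_list ms = length xs \<Longrightarrow> concat (split_blocks ms xs) = xs"
  by (induction ms arbitrary: xs) auto

lemma split_blocks_concat: "split_blocks (map length bs) (concat bs) = bs"
  by (induction bs) auto

lemma split_blocks_map: "split_blocks ms (map f xs) = map (map f) (split_blocks ms xs)"
  by (induction ms arbitrary: xs) (auto simp: take_map drop_map)

lemma compositions_sum: "ns \<in> compositions n \<Longrightarrow> sum_list ns = n"
  by (simp add: compositions_def)

lemma finite_compositions: "finite (compositions n)"
proof (rule finite_subset)
  show "compositions n \<subseteq> {ns. set ns \<subseteq> {..n} \<and> length ns \<le> n}"
  proof safe
    fix ns x assume ns: "ns \<in> compositions n"
    then have s: "sum_list ns = n" and p: "\<forall>m\<in>set ns. 0 < m" by (auto simp: compositions_def)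
    show "x \<le> n" if "x \<in> set ns" using member_le_sum_list[OF that] s by simp
    have "length ns \<le> sum_list ns" using p
    proof (induction ns)
      case (Cons a ns)
      have "length ns \<le> sum_list ns" "0 < a" using Cons.IH Cons.prems by simp_all
      then show ?case by simp
    qed auto
    then show "length ns \<le> n" using s by simp
  qed
  show "finite {ns. set ns \<subseteq> {..n} \<and> length ns \<le> n}" by (intro finite_lists_length_le) auto
qed

lemma compositions_Cons:
  "m # ns \<in> compositions n \<longleftrightarrow> 0 < m \<and> m \<le> n \<and> ns \<in> compositions (n - m)"
  by (auto simp: compositions_def)

lemma compositions_0 [simp]: "compositions 0 = {[]}"
proof -
  have "ns = []" if "ns \<in> compositions 0" for ns
    using that by (cases ns) (simp_all add: compositions_def)
  then show ?thesis by (auto simp: compositions_def)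
qed

lemma map_length_in_compositions:
  "[] \<notin> set bs \<Longrightarrow> map length bs \<in> compositions (length (concat bs))"
  by (auto simp: compositions_def length_concat)

lemma split_blocks_nonempty:
  assumes "ns \<in> compositions n" "length xs = n"
  shows "[] \<notin> set (split_blocks ns xs)"
proof
  assume "[] \<in> set (split_blocks ns xs)"
  then have "0 \<in> set (map length (split_blocks ns xs))" by force
  moreover have "map length (split_blocks ns xs) = ns"
    using assms by (intro map_length_split_blocks) (simp add: compositions_def)
  ultimately show False using assms by (simp only: compositions_def) auto
qed

lemma rearr_map: "rearr (map (map f) bs) ch = map (map f) (rearr bs ch)" if "set (fst ch) \<subseteq> {..<length bs}"
  using that by (cases ch) (auto simp: rearr_def rotate_map)

lemma choicesD:
  assumes "ch \<in> choices ns"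
  shows "distinct (fst ch)" "set (fst ch) = {..<length ns}" "length (snd ch) = length ns"
    "\<And>i. i < length ns \<Longrightarrow> snd ch ! i < ns ! i" "length (fst ch) = length ns"
proof -
  obtain \<tau> r where ch: "ch = (\<tau>, r)" by (cases ch)
  show "distinct (fst ch)" "set (fst ch) = {..<length ns}" "length (snd ch) = length ns"
    "\<And>i. i < length ns \<Longrightarrow> snd ch ! i < ns ! i"
    using assms by (simp_all add: ch choices_def permutations_of_set_def)
  then show "length (fst ch) = length ns" by (metis card_lessThan distinct_card)
qed

lemma choicesI:
  assumes "distinct \<tau>" "set \<tau> = {..<length ns}" "length r = length ns" "\<And>i. i < length ns \<Longrightarrow> r ! i < ns ! i"
  shows "(\<tau>, r) \<in> choices ns"
  using assms by (auto simp: choices_def permutations_of_set_def)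

lemma mset_map_nth_perm:
  assumes "distinct \<tau>" "set \<tau> = {..<length xs}"
  shows "mset (map ((!) xs) \<tau>) = mset xs"
proof -
  have "mset \<tau> = mset [0..<length xs]"
  proof (rule set_eq_iff_mset_eq_distinct[THEN iffD1])
    show "set \<tau> = set [0..<length xs]" unfolding assms(2) set_upt atLeast0LessThan ..
  qed (simp_all add: assms(1))
  then have "mset (map ((!) xs) \<tau>) = mset (map ((!) xs) [0..<length xs])"
    unfolding mset_map by (rule arg_cong)
  then show ?thesis unfolding map_nth .
qed

lemma mset_rotate: "mset (rotate k xs) = mset xs"
proof -
  have "mset (rotate1 ys) = mset ys" for ys :: "'a list" by (cases ys) simp_all
  then show ?thesis by (induction k) (simp_all add: rotate_def)
qed

lemma prod_list_map_nth: "(\<Prod>i<length l. f (l ! i)) = prod_list (map f l)"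
  by (induction l rule: rev_induct) (auto simp: nth_append lessThan_Suc mult.commute)

lemma card_lists_nth:
  fixes A :: "nat \<Rightarrow> 'b set"
  assumes "\<And>i. i < k \<Longrightarrow> finite (A i)"
  shows "card {r. length r = k \<and> (\<forall>i<k. r ! i \<in> A i)} = (\<Prod>i<k. card (A i)) \<and>
         finite {r. length r = k \<and> (\<forall>i<k. r ! i \<in> A i)}"
  using assms
proof (induction k)
  case (Suc k)
  let ?L = "{r. length r = k \<and> (\<forall>i<k. r ! i \<in> A i)}"
  have eq: "{r. length r = Suc k \<and> (\<forall>i<Suc k. r ! i \<in> A i)} = (\<lambda>(r,a). r @ [a]) ` (?L \<times> A k)"
  proof (safe)
    fix r assume r: "length r = Suc k" "\<forall>i<Suc k. r ! i \<in> A i"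
    then have "r = butlast r @ [last r]" by (metis append_butlast_last_id length_0_conv nat.simps(3))
    moreover have "last r = r ! k" using r by (metis diff_Suc_1 last_conv_nth length_0_conv nat.simps(3))
    moreover have "butlast r \<in> ?L" using r by (auto simp: nth_butlast)
    ultimately show "r \<in> (\<lambda>(r,a). r @ [a]) ` (?L \<times> A k)"
      using r by (intro image_eqI[of _ _ "(butlast r, last r)"]) simp_all
  qed (auto simp: nth_append less_Suc_eq)
  have inj: "inj_on (\<lambda>(r,a). r @ [a]) (?L \<times> A k)" by (auto simp: inj_on_def)
  show ?case using Suc unfolding eq by (simp add: card_image[OF inj] card_cartesian_product mult.commute)
qed auto

lemma card_choices: "card (choices ns) = fact (length ns) * prod_list ns" "finite (choices ns)"
proof -
  let ?L = "{r. length r = length ns \<and> (\<forall>i<length ns. r ! i \<in> {..<ns ! i})}"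
  have eq: "choices ns = permutations_of_set {..<length ns} \<times> ?L" by (auto simp: choices_def)
  have p: "(\<Prod>i<length ns. ns ! i) = prod_list ns"
    using prod_list_map_nth[of "\<lambda>m. m" ns] by simp
  show "card (choices ns) = fact (length ns) * prod_list ns" unfolding eq
    using card_lists_nth[of "length ns" "\<lambda>i. {..<ns ! i}"] p by (simp add: card_cartesian_product)
  show "finite (choices ns)" unfolding eq using card_lists_nth[of "length ns" "\<lambda>i. {..<ns ! i}"] by simp
qed

lemma rearr_eq: "rearr bs ch = map (\<lambda>i. rotate (snd ch ! i) (bs ! i)) (fst ch)"
  by (cases ch) (simp add: rearr_def)

lemma in_set_rearr:
  assumes "ch \<in> choices (map length bs)"
  shows "b \<in> set (rearr bs ch) \<longleftrightarrow> (\<exists>i<length bs. b = rotate (snd ch ! i) (bs ! i))"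
proof -
  have "set (fst ch) = {..<length bs}" using choicesD(2)[OF assms] by simp
  then show ?thesis unfolding rearr_eq by auto
qed

lemma map_length_rearr:
  assumes "ch \<in> choices (map length bs)"
  shows "map length (rearr bs ch) = map ((!) (map length bs)) (fst ch)"
proof -
  have "set (fst ch) = {..<length bs}" using choicesD(2)[OF assms] by simp
  then show ?thesis unfolding rearr_eq by auto
qed

lemma mset_concat_rearr:
  assumes "ch \<in> choices (map length bs)"
  shows "mset (concat (rearr bs ch)) = mset (concat bs)"
proof -
  have "mset (rotate (snd ch ! i) (bs ! i)) = map mset bs ! i" if "i \<in> set (fst ch)" for i
  proof -
    have "i < length bs" using that choicesD(2)[OF assms] by simp
    then show ?thesis by (simp only: mset_rotate nth_map)
  qed
  then have "map mset (rearr bs ch) = map ((!) (map mset bs)) (fst ch)"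
    unfolding rearr_eq map_map o_def by (intro map_cong refl)
  moreover have "mset (map ((!) (map mset bs)) (fst ch)) = mset (map mset bs)"
    using choicesD[OF assms] by (intro mset_map_nth_perm) auto
  ultimately have "mset (map mset (rearr bs ch)) = mset (map mset bs)" by (rule ssubst)
  then have "sum_list (map mset (rearr bs ch)) = sum_list (map mset bs)"
    unfolding sum_mset_sum_list[symmetric] by (rule arg_cong)
  then show ?thesis unfolding mset_concat .
qed

lemma nonempty_rearr:
  assumes ch: "ch \<in> choices (map length bs)" and ne: "[] \<notin> set bs"
  shows "[] \<notin> set (rearr bs ch)"
proof (rule notI)
  assume c: "[] \<in> set (rearr bs ch)"
  have "\<exists>i<length bs. [] = rotate (snd ch ! i) (bs ! i)"
    by (rule iffD1[OF in_set_rearr[OF ch] c])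
  then obtain i where i: "i < length bs" "[] = rotate (snd ch ! i) (bs ! i)" by (elim exE conjE)
  have "length (bs ! i) = 0" using arg_cong[OF i(2), of length] by simp
  then show False using ne nth_mem[OF i(1)] by simp
qed

section \<open>Marked cycles of a permutation\<close>

text \<open>
  Words that list \<open>1, \<dots>, n\<close>, cut into non-empty blocks. Reading the blocks as cycles, these are the
  permutations with an order of the cycles and a starting point on each cycle. That \<open>p\<close> runs through the
  block \<open>b\<close> as a cycle is written \<open>map p b = rotate1 b\<close>.
\<close>

definition cycle_arrangements :: "nat \<Rightarrow> nat list list set" where
  "cycle_arrangements n = {bs. [] \<notin> set bs \<and> distinct (concat bs) \<and> set (concat bs) = {1..n}}"

lemma cycles_rotate: "map p b = rotate1 b \<Longrightarrow> map p (rotate k b) = rotate1 (rotate k b)"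
  by (metis rotate1_rotate_swap rotate_map)

lemma cycles_funpow_nth:
  assumes "map p b = rotate1 b" "b \<noteq> []"
  shows "(p ^^ i) (hd b) = b ! (i mod length b)"
proof (induction i)
  case 0
  then show ?case using assms by (simp add: hd_conv_nth)
next
  case (Suc i)
  have l: "i mod length b < length b" using assms by simp
  have "p (b ! (i mod length b)) = (rotate1 b) ! (i mod length b)"
    unfolding assms(1)[symmetric] nth_map[OF l] ..
  also have "\<dots> = b ! (Suc (i mod length b) mod length b)" by (rule nth_rotate1[OF l])
  also have "Suc (i mod length b) mod length b = Suc i mod length b" by (rule mod_Suc_eq)
  finally show ?case using Suc by simp
qed

lemma cycles_unique:
  assumes "map p b = rotate1 b" "map p c = rotate1 c" "b \<noteq> []" "c \<noteq> []" "length b = length c" "hd b = hd c"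
  shows "b = c"
proof (rule nth_equalityI)
  fix i assume "i < length b"
  then show "b ! i = c ! i"
    using cycles_funpow_nth[OF assms(1,3), of i] cycles_funpow_nth[OF assms(2,4), of i] assms(5,6) by simp
qed (rule assms(5))

lemma cycles_orbit:
  assumes "map p b = rotate1 b" "x \<in> set b"
  shows "orbit p x = set b"
proof -
  obtain i where i: "i < length b" "b ! i = x" using assms(2) by (auto simp: in_set_conv_nth)
  define c where "c = rotate i b"
  have bne: "b \<noteq> []" using i(1) by auto
  have c: "map p c = rotate1 c" "c \<noteq> []" "set c = set b" "hd c = x"
    using cycles_rotate[OF assms(1)] i bne by (simp_all add: c_def hd_rotate_conv_nth)
  have "orbit p x = {(p ^^ m) x | m. m < length c}"
  proof (rule orbit_altdef_bounded)
    show "(p ^^ length c) x = x" using cycles_funpow_nth[OF c(1,2), of "length c"] c by (simp add: hd_conv_nth)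
  qed (use c(2) in simp)
  also have "\<dots> = {c ! m | m. m < length c}"
  proof -
    have "(p ^^ m) x = c ! m" if "m < length c" for m
      using cycles_funpow_nth[OF c(1,2), of m] c(4) that by simp
    then show ?thesis by (intro Collect_cong ex_cong1) auto
  qed
  also have "\<dots> = set c" by (simp only: set_conv_nth)
  also have "\<dots> = set b" by (rule c(3))
  finally show ?thesis .
qed

lemma orbit_as_cycle:
  assumes "permutation p"
  shows "\<exists>b. distinct b \<and> set b = orbit p x \<and> map p b = rotate1 b"
proof -
  let ?N = "funpow_dist1 p x x"
  define b where "b = map (\<lambda>i. (p ^^ i) x) [0..<?N]"
  have x: "x \<in> orbit p x" by (rule permutation_self_in_orbit[OF assms])
  have d: "distinct b" unfolding b_def distinct_map
    using inj_on_funpow_dist1[OF x] by (simp only: distinct_upt set_upt)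
  have s: "set b = orbit p x" unfolding b_def set_map set_upt by (rule orbit_conv_funpow_dist1[OF x, symmetric])
  have l: "length b = ?N" by (simp add: b_def del: upt_Suc)
  have nthb: "b ! i = (p ^^ i) x" if "i < ?N" for i
    unfolding b_def using that by (simp del: upt_Suc)
  have "map p b = rotate1 b"
  proof (rule nth_equalityI)
    fix i assume "i < length (map p b)"
    then have i: "i < ?N" by (simp add: l)
    have a: "map p b ! i = (p ^^ Suc i) x" using i l nthb[OF i] by simp
    have b: "rotate1 b ! i = b ! (Suc i mod ?N)" using nth_rotate1[of i b] i l by simp
    show "map p b ! i = rotate1 b ! i"
    proof (cases "Suc i = ?N")
      case True
      have "(p ^^ ?N) x = x" by (rule funpow_dist1_prop[OF x])
      moreover have "b ! 0 = x" using nthb[of 0] by simp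
      ultimately show ?thesis unfolding a b True by simp
    next
      case False
      then have "Suc i < ?N" using i by simp
      then show ?thesis unfolding a b by (simp only: mod_less nthb)
    qed
  qed simp
  then show ?thesis using d s by blast
qed

lemma rotate_inj:
  assumes "distinct b" "r < length b" "s < length b" "rotate r b = rotate s b"
  shows "r = s"
proof -
  have ne: "b \<noteq> []" using assms(2) by auto
  have "b ! r = b ! s" using hd_rotate_conv_nth[OF ne, of r] hd_rotate_conv_nth[OF ne, of s] assms by simp
  then show ?thesis using assms by (simp add: nth_eq_iff_index_eq)
qed

text \<open>
  Sorting the orbits by decreasing size matches \<open>cycle_lengths\<close>.
\<close>

lemma cycle_list_exists:
  assumes p: "p permutes {1..n}"
  shows "\<exists>cs\<in>cycle_arrangements n. map length cs = cycle_lengths n p \<and> (\<forall>c\<in>set cs. map p c = rotate1 c)"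
proof -
  have perm: "permutation p" using p by (auto simp: permutation_permutes)
  define Os where "Os = orbit p ` {1..n}"
  have finO: "finite Os" by (simp add: Os_def)
  then obtain ol where ol: "set ol = Os" "distinct ol" by (meson finite_distinct_list)
  have msol: "mset ol = mset_set Os" using ol mset_set_set[OF ol(2)] by simp
  obtain f where f: "\<And>o'. o' \<in> Os \<Longrightarrow> distinct (f o') \<and> set (f o') = o' \<and> map p (f o') = rotate1 (f o')"
  proof -
    have "\<forall>o'\<in>Os. \<exists>b. distinct b \<and> set b = o' \<and> map p b = rotate1 b"
      using orbit_as_cycle[OF perm] by (auto simp: Os_def)
    then show ?thesis using that by (metis bchoice)
  qed
  have disj: "o1 = o2" if "o1 \<in> Os" "o2 \<in> Os" "z \<in> o1" "z \<in> o2" for o1 o2 z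
  proof -
    have "orbit p z = o'" if "o' \<in> Os" "z \<in> o'" for o'
      using that orbit_cyclic_eq3[OF cyclic_on_orbit'[OF perm]] by (auto simp: Os_def)
    then show ?thesis using that by blast
  qed
  define xs where "xs = rev (sort_key card ol)"
  have xs: "set xs = Os" "distinct xs" using ol by (auto simp: xs_def)
  have ms: "map card (sort_key card ol) = sort (map card ol)"
    by (rule properties_for_sort[symmetric]) simp_all
  have "cycle_lengths n p = rev (sort (map card ol))"
    unfolding cycle_lengths_def Os_def[symmetric] msol[symmetric] mset_map[symmetric]
      sorted_list_of_multiset_mset ..
  also have "\<dots> = map card xs" unfolding xs_def rev_map[symmetric] ms ..
  finally have cl: "cycle_lengths n p = map card xs" .
  define cs where "cs = map f xs"
  have lens: "map length cs = cycle_lengths n p"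
    unfolding cl cs_def map_map
  proof (rule map_cong[OF refl])
    fix o' assume "o' \<in> set xs"
    then show "(length \<circ> f) o' = card o'" using f[of o'] xs distinct_card[of "f o'"] by auto
  qed
  have scs: "set cs = f ` Os" by (simp add: cs_def xs)
  have "cs \<in> cycle_arrangements n"
    unfolding cycle_arrangements_def
  proof (intro CollectI conjI)
    show "[] \<notin> set cs"
    proof
      assume "[] \<in> set cs"
      then obtain o' where "o' \<in> Os" "f o' = []" using scs by force
      then have "o' = {}" using f[of o'] by simp
      then show False using \<open>o' \<in> Os\<close> orbit_nonempty[of p] by (auto simp: Os_def)
    qed
    show "distinct (concat cs)"
    proof (rule distinct_concat)
      show "distinct cs" unfolding cs_def distinct_map using xs f by (metis inj_onI)
      show "distinct ys" if "ys \<in> set cs" for ys using that f scs by auto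
      show "set ys \<inter> set zs = {}" if "ys \<in> set cs" "zs \<in> set cs" "ys \<noteq> zs" for ys zs
      proof -
        obtain a b where ab: "a \<in> Os" "b \<in> Os" "ys = f a" "zs = f b"
          using \<open>ys \<in> set cs\<close> \<open>zs \<in> set cs\<close> unfolding scs by (elim imageE)
        then have "a \<noteq> b" using that by auto
        then show ?thesis using disj[OF ab(1,2)] f[OF ab(1)] f[OF ab(2)] ab by auto
      qed
    qed
    have "set (concat cs) = \<Union>Os" using f by (auto simp: scs)
    also have "\<dots> = {1..n}"
      using permutes_orbit_subset[OF p] permutation_self_in_orbit[OF perm] unfolding Os_def by blast
    finally show "set (concat cs) = {1..n}" .
  qed
  moreover have "\<forall>c\<in>set cs. map p c = rotate1 c" unfolding scs using f by blast
  ultimately show ?thesis using lens by blast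
qed

lemma distinct_concat_index:
  assumes "distinct (concat cs)" "[] \<notin> set cs" "i < length cs" "j < length cs"
    "x \<in> set (cs ! i)" "x \<in> set (cs ! j)"
  shows "i = j"
proof (rule ccontr)
  have "distinct cs" using assms(1,2) by (simp add: distinct_concat_iff removeAll_id)
  moreover assume "i \<noteq> j"
  ultimately have "cs ! i \<noteq> cs ! j" using assms by (simp add: nth_eq_iff_index_eq)
  then show False using assms by (auto simp: distinct_concat_iff) (metis disjoint_iff nth_mem)
qed

text \<open>
  A choice \<open>(\<tau>, r)\<close> orders the listed cycles of \<open>p\<close> and picks their starting points. Conversely the set
  of entries of a block determines the cycle, and its first entry the starting point.
\<close>

lemma rearr_cycles_bij:
  assumes cs: "cs \<in> cycle_arrangements n" "\<And>c. c \<in> set cs \<Longrightarrow> map p c = rotate1 c"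
  shows "bij_betw (rearr cs) (choices (map length cs))
           {bs \<in> cycle_arrangements n. \<forall>b\<in>set bs. map p b = rotate1 b}"
proof -
  have ne: "[] \<notin> set cs" and dc: "distinct (concat cs)" and sc: "set (concat cs) = {1..n}"
    using cs(1) by (auto simp: cycle_arrangements_def)
  have idx: "i = j" if "i < length cs" "j < length cs" "x \<in> set (cs ! i)" "x \<in> set (cs ! j)" for i j x
    using distinct_concat_index[OF dc ne] that by blast
  have nei: "cs ! i \<noteq> []" if "i < length cs" for i using ne that by (metis nth_mem)
  have dci: "distinct (cs ! i)" if "i < length cs" for i
    using dc that by (simp add: distinct_concat_iff)
  have cover: "\<exists>i<length cs. x \<in> set (cs ! i)" if "x \<in> {1..n}" for x
  proof -
    have "x \<in> set (concat cs)" using sc that by simp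
    then obtain c where "c \<in> set cs" "x \<in> set c" by auto
    then show ?thesis by (metis in_set_conv_nth)
  qed
  show ?thesis
  proof (rule bij_betw_imageI)
    show "inj_on (rearr cs) (choices (map length cs))"
    proof (rule inj_onI)
      fix ch ch' assume ch: "ch \<in> choices (map length cs)" and ch': "ch' \<in> choices (map length cs)"
        and eq: "rearr cs ch = rearr cs ch'"
      note c = choicesD[OF ch] and c' = choicesD[OF ch']
      have rot: "rotate (snd ch ! (fst ch ! j)) (cs ! (fst ch ! j)) = rotate (snd ch' ! (fst ch' ! j)) (cs ! (fst ch' ! j))"
        and bd: "fst ch ! j < length cs" "fst ch' ! j < length cs" if "j < length cs" for j
      proof -
        show "rotate (snd ch ! (fst ch ! j)) (cs ! (fst ch ! j)) = rotate (snd ch' ! (fst ch' ! j)) (cs ! (fst ch' ! j))"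
          using arg_cong[OF eq, of "\<lambda>l. l ! j"] that c(5) c'(5) by (simp add: rearr_eq)
        have "fst ch ! j \<in> set (fst ch)" "fst ch' ! j \<in> set (fst ch')" using that c(5) c'(5) by simp_all
        then show "fst ch ! j < length cs" "fst ch' ! j < length cs" using c(2) c'(2) by simp_all
      qed
      have t: "fst ch ! j = fst ch' ! j" if "j < length cs" for j
      proof -
        have "set (cs ! (fst ch ! j)) = set (cs ! (fst ch' ! j))"
          using arg_cong[OF rot[OF that], of set] by simp
        then show ?thesis using idx[OF bd[OF that]] nei[OF bd(1)[OF that]] by (metis hd_in_set)
      qed
      have f: "fst ch = fst ch'"
        using t c(5) c'(5) by (intro nth_equalityI) simp_all
      have s: "snd ch ! i = snd ch' ! i" if i: "i < length cs" for i
      proof -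
        have "i \<in> set (fst ch)" using c(2) i by simp
        then obtain j where "j < length cs" "fst ch ! j = i" using c(5) by (auto simp: in_set_conv_nth)
        then have "rotate (snd ch ! i) (cs ! i) = rotate (snd ch' ! i) (cs ! i)" using rot[of j] f by simp
        moreover have "snd ch ! i < length (cs ! i)" "snd ch' ! i < length (cs ! i)"
          using c(4)[of i] c'(4)[of i] i by simp_all
        ultimately show ?thesis using rotate_inj[OF dci[OF i]] by blast
      qed
      have "snd ch = snd ch'" using s c(3) c'(3) by (intro nth_equalityI) simp_all
      with f show "ch = ch'" by (rule prod_eqI)
    qed
    show "rearr cs ` choices (map length cs) = {bs \<in> cycle_arrangements n. \<forall>b\<in>set bs. map p b = rotate1 b}"
      (is "_ = ?R")
    proof (rule subset_antisym; rule subsetI)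
      fix bs assume "bs \<in> rearr cs ` choices (map length cs)"
      then obtain ch where ch: "ch \<in> choices (map length cs)" and bs: "bs = rearr cs ch" by auto
      have "map p b = rotate1 b" if "b \<in> set bs" for b
        using that cs(2) cycles_rotate unfolding bs in_set_rearr[OF ch] by (metis nth_mem)
      moreover have "mset (concat bs) = mset (concat cs)" unfolding bs by (rule mset_concat_rearr[OF ch])
      then have "distinct (concat bs)" "set (concat bs) = {1..n}"
        using dc sc mset_eq_imp_distinct_iff mset_eq_setD by metis+
      moreover have "[] \<notin> set bs" unfolding bs by (rule nonempty_rearr[OF ch ne])
      ultimately show "bs \<in> ?R" unfolding cycle_arrangements_def by blast
    next
      fix bs assume "bs \<in> ?R"
      then have bne: "[] \<notin> set bs" and bdc: "distinct (concat bs)" and bsc: "set (concat bs) = {1..n}"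
        and bcy: "\<And>b. b \<in> set bs \<Longrightarrow> map p b = rotate1 b" by (auto simp: cycle_arrangements_def)
      have bd: "distinct bs" using bdc bne by (simp add: distinct_concat_iff removeAll_id)
      have bdb: "distinct b" if "b \<in> set bs" for b using bdc that by (simp add: distinct_concat_iff)
      have "\<exists>i r. i < length cs \<and> r < length (cs ! i) \<and> b = rotate r (cs ! i)" if b: "b \<in> set bs" for b
      proof -
        have nb: "b \<noteq> []" using b bne by auto
        have "hd b \<in> {1..n}" using b nb bsc by (metis UN_I hd_in_set set_concat)
        then obtain i where i: "i < length cs" "hd b \<in> set (cs ! i)" using cover by blast
        have cyi: "map p (cs ! i) = rotate1 (cs ! i)" using cs(2) i by simp
        have "set b = set (cs ! i)"
          using cycles_orbit[OF bcy[OF b], of "hd b"] cycles_orbit[OF cyi i(2)] nb by simp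
        then have len: "length b = length (cs ! i)" using bdb[OF b] dci[OF i(1)] by (metis distinct_card)
        obtain r where r: "r < length (cs ! i)" "cs ! i ! r = hd b" using i(2) by (auto simp: in_set_conv_nth)
        have "b = rotate r (cs ! i)"
        proof (rule cycles_unique[OF bcy[OF b] cycles_rotate[OF cyi] nb])
          show "rotate r (cs ! i) \<noteq> []" using nei[OF i(1)] by simp
          show "length b = length (rotate r (cs ! i))" using len by simp
          show "hd b = hd (rotate r (cs ! i))" using r nei[OF i(1)] by (simp add: hd_rotate_conv_nth)
        qed
        then show ?thesis using i r by blast
      qed
      then obtain I r where Ir: "\<And>b. b \<in> set bs \<Longrightarrow> I b < length cs \<and> r b < length (cs ! I b) \<and> b = rotate (r b) (cs ! I b)"
        by metis
      have sI: "set b = set (cs ! I b)" if "b \<in> set bs" for b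
        using arg_cong[OF conjunct2[OF conjunct2[OF Ir[OF that]]], of set] by simp
      have injI: "inj_on I (set bs)"
      proof (rule inj_onI)
        fix b b' assume b: "b \<in> set bs" "b' \<in> set bs" "I b = I b'"
        then have "set b = set b'" using sI by metis
        moreover have "b \<noteq> []" using b bne by auto
        ultimately have "set b \<inter> set b' \<noteq> {}" by (metis Int_absorb set_empty)
        then show "b = b'" using bdc b unfolding distinct_concat_iff by metis
      qed
      have rng: "I ` set bs = {..<length cs}"
      proof (rule subset_antisym)
        show "I ` set bs \<subseteq> {..<length cs}" using Ir by (intro image_subsetI) (simp only: lessThan_iff)
        show "{..<length cs} \<subseteq> I ` set bs"
        proof (rule subsetI)
          fix i assume "i \<in> {..<length cs}"
          then have i: "i < length cs" by simp
          have h: "hd (cs ! i) \<in> set (cs ! i)" using nei[OF i] by simp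
          then have "hd (cs ! i) \<in> set (concat bs)" using sc i bsc by (metis UN_I nth_mem set_concat)
          then obtain b where b: "b \<in> set bs" "hd (cs ! i) \<in> set b" by auto
          have "I b = i" using idx[of "I b" i "hd (cs ! i)"] Ir[OF b(1)] b sI[OF b(1)] i h by simp
          then show "i \<in> I ` set bs" using b by auto
        qed
      qed
      define \<rho> where "\<rho> = map (\<lambda>i. r (inv_into (set bs) I i)) [0..<length cs]"
      have \<rho>: "\<rho> ! (I b) = r b" if "b \<in> set bs" for b
        using that Ir[OF that] injI by (simp add: \<rho>_def)
      have ch: "(map I bs, \<rho>) \<in> choices (map length cs)"
      proof (rule choicesI)
        show "distinct (map I bs)" using bd injI by (simp add: distinct_map)
        show "set (map I bs) = {..<length (map length cs)}" using rng by simp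
        show "length \<rho> = length (map length cs)" by (simp add: \<rho>_def)
        fix i assume i: "i < length (map length cs)"
        then have "i \<in> I ` set bs" using rng by simp
        then obtain b where b: "b \<in> set bs" "i = I b" by auto
        then show "\<rho> ! i < map length cs ! i" using \<rho>[OF b(1)] Ir[OF b(1)] by simp
      qed
      have "rearr cs (map I bs, \<rho>) = map (\<lambda>b. rotate (\<rho> ! I b) (cs ! I b)) bs"
        unfolding rearr_eq by simp
      also have "\<dots> = bs" using \<rho> Ir by (intro map_idI) simp
      finally show "bs \<in> rearr cs ` choices (map length cs)" using ch by (metis imageI)
    qed
  qed
qed

lemma permutation_of_blocks:
  assumes "distinct (concat bs)"
  shows "\<exists>p. p permutes set (concat bs) \<and> (\<forall>b\<in>set bs. map p b = rotate1 b)"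
  using assms
proof (induction bs)
  case Nil
  show ?case by (intro exI[of _ id]) (simp add: id_def)
next
  case (Cons b bs)
  then obtain p where p: "p permutes set (concat bs)" "\<forall>b\<in>set bs. map p b = rotate1 b" by auto
  have db: "distinct b" and dj: "set b \<inter> set (concat bs) = {}" using Cons.prems by auto
  let ?c = "cycle_of_list b"
  have c: "?c permutes set b" by (rule cycle_permutes)
  have perm: "?c \<circ> p permutes set (concat (b # bs))"
    using permutes_compose[OF permutes_subset[OF p(1)] permutes_subset[OF c], of "set (concat (b # bs))"] by auto
  have "map (?c \<circ> p) b = map ?c b"
    using permutes_not_in[OF p(1)] dj by (intro map_cong[OF refl]) (metis comp_apply disjoint_iff)
  also have "\<dots> = rotate1 b" using cyclic_rotation[OF db, of 1] by simp
  finally have 1: "map (?c \<circ> p) b = rotate1 b" .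
  have 2: "map (?c \<circ> p) b' = rotate1 b'" if b': "b' \<in> set bs" for b'
  proof -
    have "?c (p x) = p x" if "x \<in> set b'" for x
    proof -
      have "x \<in> set (concat bs)" using that b' by auto
      then have "p x \<in> set (concat bs)" using permutes_in_image[OF p(1)] by blast
      then show ?thesis using permutes_not_in[OF c] dj by blast
    qed
    then have "map (?c \<circ> p) b' = map p b'" by simp
    then show ?thesis using p(2) b' by simp
  qed
  have "\<forall>b'\<in>set (b # bs). map (?c \<circ> p) b' = rotate1 b'"
    unfolding list.set(2) using 1 2 by blast
  with perm show ?case by blast
qed

lemma cycles_perm_unique:
  assumes "p permutes S" "p' permutes S" "set (concat bs) = S"
    "\<And>b. b \<in> set bs \<Longrightarrow> map p b = rotate1 b" "\<And>b. b \<in> set bs \<Longrightarrow> map p' b = rotate1 b"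
  shows "p = p'"
proof (rule ext)
  fix x
  show "p x = p' x"
  proof (cases "x \<in> S")
    case True
    then obtain b where "b \<in> set bs" "x \<in> set b" using assms(3) by auto
    then show ?thesis using assms(4,5)[of b] by (metis map_eq_conv)
  next
    case False
    then show ?thesis using permutes_not_in[OF assms(1)] permutes_not_in[OF assms(2)] by simp
  qed
qed

text \<open>
  For fixed lengths of the blocks, only the word is free.
\<close>

lemma card_arrangements_with_lengths:
  assumes "ns \<in> compositions n"
  shows "card {bs \<in> cycle_arrangements n. map length bs = ns} = fact n"
proof -
  have sum: "sum_list ns = n" using assms by (rule compositions_sum)
  have "bij_betw (split_blocks ns) (permutations_of_set {1..n}) {bs \<in> cycle_arrangements n. map length bs = ns}"
  proof (rule bij_betwI[where g = concat])
    have len: "length w = n" if "w \<in> permutations_of_set {1..n}" for w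
      using length_finite_permutations_of_set[OF that] by simp
    show "split_blocks ns \<in> permutations_of_set {1..n} \<rightarrow> {bs \<in> cycle_arrangements n. map length bs = ns}"
    proof
      fix w assume w: "w \<in> permutations_of_set {1..n}"
      have "concat (split_blocks ns w) = w" using len[OF w] sum by (simp add: concat_split_blocks)
      moreover have "map length (split_blocks ns w) = ns" using len[OF w] sum by (simp add: map_length_split_blocks)
      moreover have "[] \<notin> set (split_blocks ns w)" using split_blocks_nonempty[OF assms] len[OF w] by blast
      ultimately show "split_blocks ns w \<in> {bs \<in> cycle_arrangements n. map length bs = ns}"
        using w permutations_of_setD[OF w] by (simp only: cycle_arrangements_def mem_Collect_eq) simp
    qed
    show "concat \<in> {bs \<in> cycle_arrangements n. map length bs = ns} \<rightarrow> permutations_of_set {1..n}"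
      by (auto simp: cycle_arrangements_def intro!: permutations_of_setI)
    show "concat (split_blocks ns w) = w" if "w \<in> permutations_of_set {1..n}" for w
      using len[OF that] sum by (simp add: concat_split_blocks)
    show "split_blocks ns (concat bs) = bs" if "bs \<in> {bs \<in> cycle_arrangements n. map length bs = ns}" for bs
      using that split_blocks_concat by blast
  qed
  from bij_betw_same_card[OF this] show ?thesis by simp
qed

text \<open>
  An arrangement of blocks with lengths \<open>ns\<close> is the set of marked and ordered cycles of exactly one
  permutation \<open>p\<close>, so summing over \<open>p\<close> counts the words of length \<open>n\<close>.
\<close>

theorem count_choices_with_composition:
  assumes "ns \<in> compositions n"
  shows "(\<Sum>p | p permutes {1..n}. card {ch \<in> choices (cycle_lengths n p). map ((!) (cycle_lengths n p)) (fst ch) = ns}) = fact n"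
proof -
  let ?A = "\<lambda>p. {bs \<in> cycle_arrangements n. (\<forall>b\<in>set bs. map p b = rotate1 b) \<and> map length bs = ns}"
  have finA: "finite {bs \<in> cycle_arrangements n. map length bs = ns}"
    using card_arrangements_with_lengths[OF assms] by (metis card.infinite fact_nonzero)
  have "card {ch \<in> choices (cycle_lengths n p). map ((!) (cycle_lengths n p)) (fst ch) = ns} = card (?A p)"
    if p: "p permutes {1..n}" for p
  proof -
    obtain cs where cs: "cs \<in> cycle_arrangements n" "map length cs = cycle_lengths n p"
      "\<And>c. c \<in> set cs \<Longrightarrow> map p c = rotate1 c" using cycle_list_exists[OF p] by blast
    let ?C = "{ch \<in> choices (map length cs). map ((!) (map length cs)) (fst ch) = ns}"
    have bij: "bij_betw (rearr cs) (choices (map length cs)) {bs \<in> cycle_arrangements n. \<forall>b\<in>set bs. map p b = rotate1 b}"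
      by (rule rearr_cycles_bij[OF cs(1,3)])
    have "bij_betw (rearr cs) ?C (rearr cs ` ?C)"
      by (rule bij_betw_imageI) (use bij in \<open>auto simp: bij_betw_def inj_on_def\<close>)
    moreover have "rearr cs ` ?C = ?A p"
    proof -
      have "rearr cs ` ?C = {bs \<in> rearr cs ` choices (map length cs). map length bs = ns}"
        using map_length_rearr by auto
      then show ?thesis using bij by (auto simp: bij_betw_def)
    qed
    ultimately show ?thesis unfolding cs(2) by (simp add: bij_betw_same_card)
  qed
  then have "(\<Sum>p | p permutes {1..n}. card {ch \<in> choices (cycle_lengths n p). map ((!) (cycle_lengths n p)) (fst ch) = ns})
      = (\<Sum>p | p permutes {1..n}. card (?A p))" by (intro sum.cong) auto
  also have "\<dots> = card (\<Union>p\<in>{p. p permutes {1..n}}. ?A p)"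
  proof (rule card_UN_disjoint[symmetric])
    show "finite {p. p permutes {1..n}}" by (simp add: finite_permutations)
    show "\<forall>p\<in>{p. p permutes {1..n}}. finite (?A p)"
      by (auto intro: finite_subset[OF _ finA])
    show "\<forall>p\<in>{p. p permutes {1..n}}. \<forall>p'\<in>{p. p permutes {1..n}}. p \<noteq> p' \<longrightarrow> ?A p \<inter> ?A p' = {}"
    proof (intro ballI impI, rule ccontr)
      fix p p' assume pp: "p \<in> {p. p permutes {1..n}}" "p' \<in> {p. p permutes {1..n}}" "p \<noteq> p'" "?A p \<inter> ?A p' \<noteq> {}"
      then obtain bs where "bs \<in> ?A p" "bs \<in> ?A p'" by blast
      then show False using cycles_perm_unique[of p "{1..n}" p' bs] pp
        by (auto simp: cycle_arrangements_def)
    qed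
  qed
  also have "(\<Union>p\<in>{p. p permutes {1..n}}. ?A p) = {bs \<in> cycle_arrangements n. map length bs = ns}"
  proof (rule subset_antisym; rule subsetI)
    fix bs assume bs: "bs \<in> {bs \<in> cycle_arrangements n. map length bs = ns}"
    then obtain p where "p permutes {1..n}" "\<forall>b\<in>set bs. map p b = rotate1 b"
      using permutation_of_blocks[of bs] unfolding cycle_arrangements_def by auto
    then show "bs \<in> (\<Union>p\<in>{p. p permutes {1..n}}. ?A p)" using bs by blast
  qed auto
  also have "card \<dots> = fact n" by (rule card_arrangements_with_lengths[OF assms])
  finally show ?thesis .
qed

lemma sum_list_cycle_lengths:
  assumes "p permutes {1..n}"
  shows "cycle_lengths n p \<in> compositions n"
proof -
  obtain cs where cs: "cs \<in> cycle_arrangements n" "map length cs = cycle_lengths n p"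
    using cycle_list_exists[OF assms] by blast
  have "length (concat cs) = n" using cs(1) distinct_card[of "concat cs"] by (simp add: cycle_arrangements_def)
  then show ?thesis using map_length_in_compositions[of cs] cs by (simp add: cycle_arrangements_def)
qed

text \<open>
  Cauchy's formula. A permutation whose \<open>k\<close> cycles have lengths \<open>n\<^sub>1, \<dots>, n\<^sub>k\<close> admits
  \<open>k! n\<^sub>1 \<dots> n\<^sub>k\<close> choices. If each choice has the inverse of this number as its weight, each permutation
  has weight \<open>1\<close>, and sorting the choices by composition gives the sum on the left.
\<close>

corollary sum_compositions_inverse:
  "(\<Sum>ns\<in>compositions n. 1 / (fact (length ns) * real (prod_list ns))) = 1"
proof -
  let ?h = "\<lambda>ns. 1 / (fact (length ns) * real (prod_list ns))"
  let ?P = "{p. p permutes {1..n}}"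
  have one: "(\<Sum>ch\<in>choices l. ?h (map ((!) l) (fst ch))) = 1" if l: "l \<in> compositions n" for l
  proof -
    have "?h (map ((!) l) (fst ch)) = ?h l" if ch: "ch \<in> choices l" for ch
    proof -
      have "mset (map ((!) l) (fst ch)) = mset l" using choicesD[OF ch] by (intro mset_map_nth_perm)
      then have "prod_list (map ((!) l) (fst ch)) = prod_list l" by (metis prod_mset_prod_list)
      then show ?thesis using choicesD(5)[OF ch] by simp
    qed
    then have "(\<Sum>ch\<in>choices l. ?h (map ((!) l) (fst ch))) = (\<Sum>ch\<in>choices l. ?h l)"
      by (rule sum.cong[OF refl])
    also have "\<dots> = real (card (choices l)) * ?h l" by (rule sum_constant)
    also have "\<dots> = 1"
    proof -
      have "prod_list l \<noteq> 0" using l by (auto simp: compositions_def prod_list_zero_iff)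
      then show ?thesis by (simp add: card_choices)
    qed
    finally show ?thesis .
  qed
  have "fact n * (\<Sum>ns\<in>compositions n. ?h ns) = (\<Sum>ns\<in>compositions n. fact n * ?h ns)" by (rule sum_distrib_left)
  also have "\<dots> = (\<Sum>ns\<in>compositions n. \<Sum>p\<in>?P. \<Sum>ch\<in>choices (cycle_lengths n p). if map ((!) (cycle_lengths n p)) (fst ch) = ns then ?h ns else 0)"
  proof (rule sum.cong[OF refl])
    fix ns assume ns: "ns \<in> compositions n"
    have "real (\<Sum>p\<in>?P. card {ch \<in> choices (cycle_lengths n p). map ((!) (cycle_lengths n p)) (fst ch) = ns}) = fact n"
      unfolding count_choices_with_composition[OF ns] by (rule of_nat_fact)
    then have "fact n * ?h ns = (\<Sum>p\<in>?P. real (card {ch \<in> choices (cycle_lengths n p). map ((!) (cycle_lengths n p)) (fst ch) = ns})) * ?h ns"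
      unfolding of_nat_sum by (rule arg_cong[symmetric])
    also have "\<dots> = (\<Sum>p\<in>?P. \<Sum>ch\<in>choices (cycle_lengths n p). if map ((!) (cycle_lengths n p)) (fst ch) = ns then ?h ns else 0)"
      unfolding sum_distrib_right sum.inter_filter[OF card_choices(2), symmetric] sum_constant ..
    finally show "fact n * ?h ns = (\<Sum>p\<in>?P. \<Sum>ch\<in>choices (cycle_lengths n p). if map ((!) (cycle_lengths n p)) (fst ch) = ns then ?h ns else 0)" .
  qed
  also have "\<dots> = (\<Sum>p\<in>?P. \<Sum>ns\<in>compositions n. \<Sum>ch\<in>choices (cycle_lengths n p). if map ((!) (cycle_lengths n p)) (fst ch) = ns then ?h ns else 0)"
    by (rule sum.swap)
  also have "\<dots> = (\<Sum>p\<in>?P. \<Sum>ch\<in>choices (cycle_lengths n p). \<Sum>ns\<in>compositions n. if map ((!) (cycle_lengths n p)) (fst ch) = ns then ?h ns else 0)"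
    by (intro sum.cong[OF refl] sum.swap)
  also have "\<dots> = (\<Sum>p\<in>?P. \<Sum>ch\<in>choices (cycle_lengths n p). ?h (map ((!) (cycle_lengths n p)) (fst ch)))"
  proof (intro sum.cong refl)
    fix p ch assume p: "p \<in> ?P" and ch: "ch \<in> choices (cycle_lengths n p)"
    let ?m = "map ((!) (cycle_lengths n p)) (fst ch)"
    have ms: "mset ?m = mset (cycle_lengths n p)" using choicesD[OF ch] by (intro mset_map_nth_perm)
    have "cycle_lengths n p \<in> compositions n" using p sum_list_cycle_lengths by simp
    then have "?m \<in> compositions n"
      using mset_eq_setD[OF ms] ms by (simp only: compositions_def mem_Collect_eq) (metis sum_mset_sum_list)
    then show "(\<Sum>ns\<in>compositions n. if ?m = ns then ?h ns else 0) = ?h ?m"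
      by (simp add: finite_compositions)
  qed
  also have "\<dots> = (\<Sum>p\<in>?P. 1)"
    using one sum_list_cycle_lengths by (intro sum.cong refl) blast
  also have "\<dots> = fact n" by (simp add: card_permutations)
  finally show ?thesis by simp
qed

section \<open>Good arrangements of blocks\<close>

definition good_block :: "real list \<Rightarrow> bool" where
  "good_block b \<longleftrightarrow> (\<forall>m\<in>{1..length b}. mean (take m b) \<le> mean b)"

definition good :: "real list list \<Rightarrow> bool" where
  "good bs \<longleftrightarrow> sorted_wrt (\<ge>) (map mean bs) \<and> (\<forall>b\<in>set bs. good_block b)"

definition shifts :: "real list \<Rightarrow> nat" where
  "shifts b = card {r. r < length b \<and> good_block (rotate r b)}"

text \<open>
  The number of non-increasing orders of objects whose values form the multiset \<open>A\<close>: only objects of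
  equal value can be interchanged.
\<close>

definition orders :: "'v multiset \<Rightarrow> nat" where
  "orders A = (\<Prod>v\<in>set_mset A. fact (count A v))"

text \<open>
  The number of choices that make \<open>bs\<close> good, see \<open>card_good_choices\<close>. The product form shows that it
  depends on \<open>bs\<close> only up to order and rotation of the blocks.
\<close>

definition good_arrangements :: "real list list \<Rightarrow> nat" where
  "good_arrangements bs = orders (mset (map mean bs)) * prod_list (map shifts bs)"

text \<open>
  The height of the walk of \<open>b\<close> above its chord.
\<close>

definition excess :: "real list \<Rightarrow> nat \<Rightarrow> real" where
  "excess b m = sum_list (take m b) - real m * mean b"

lemma sum_list_mean: "b \<noteq> [] \<Longrightarrow> sum_list b = real (length b) * mean b"
  by (simp add: mean_def)

lemma excess_0 [simp]: "excess b 0 = 0"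
  by (simp add: excess_def)

lemma excess_length [simp]: "excess b (length b) = 0"
  by (cases "b = []") (simp_all add: excess_def sum_list_mean)

lemma good_block_iff: "good_block b \<longleftrightarrow> (\<forall>m\<le>length b. excess b m \<le> 0)"
proof -
  have e: "mean (take m b) \<le> mean b \<longleftrightarrow> excess b m \<le> 0" if "1 \<le> m" "m \<le> length b" for m
  proof -
    have "mean (take m b) = sum_list (take m b) / real m" using that by (simp add: mean_def min_absorb2)
    then show ?thesis using that by (simp add: excess_def divide_le_eq mult.commute)
  qed
  show ?thesis
  proof
    assume g: "good_block b"
    show "\<forall>m\<le>length b. excess b m \<le> 0"
    proof (intro allI impI)
      fix m assume "m \<le> length b"
      then show "excess b m \<le> 0"
        using g e[of m] by (cases "m = 0") (simp_all add: good_block_def)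
    qed
  next
    assume "\<forall>m\<le>length b. excess b m \<le> 0"
    then show "good_block b" using e by (simp add: good_block_def)
  qed
qed

lemma mean_rotate [simp]: "mean (rotate r b) = mean b"
proof -
  have "sum_list (rotate r b) = sum_list b" by (metis mset_rotate sum_mset_sum_list)
  then show ?thesis by (simp add: mean_def)
qed

lemma excess_rotate:
  assumes "r \<le> length b" "m \<le> length b"
  shows "excess (rotate r b) m =
    (if m \<le> length b - r then excess b (r + m) - excess b r
     else excess b (m - (length b - r)) - excess b r)"
proof -
  have rot: "rotate r b = drop r b @ take r b"
    using assms by (cases "r = length b") (simp_all add: rotate_drop_take)
  show ?thesis
  proof (cases "m \<le> length b - r")
    case True
    have "take (r + m) b = take r b @ take m (drop r b)" by (rule take_add)
    then have "sum_list (take (r + m) b) = sum_list (take r b) + sum_list (take m (drop r b))" by simp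
    moreover have "take m (rotate r b) = take m (drop r b)" using True by (simp add: rot)
    ultimately show ?thesis using True by (simp add: excess_def algebra_simps)
  next
    case False
    have "take r b @ drop r b = b" by simp
    then have s: "sum_list (take r b) + sum_list (drop r b) = sum_list b" by (metis sum_list_append)
    have t: "take m (rotate r b) = drop r b @ take (m - (length b - r)) b"
      using False assms by (simp add: rot min_def)
    have "b \<noteq> []" using False assms by auto
    then have l: "sum_list b = real (length b) * mean b" by (rule sum_list_mean)
    show ?thesis using False assms s l unfolding excess_def t by (simp add: of_nat_diff algebra_simps)
  qed
qed

text \<open>
  The cycle lemma: rotating by \<open>r\<close> moves the origin of the closed path \<open>excess b\<close> to time \<open>r\<close>, so the
  rotated path stays below zero iff \<open>r\<close> is a time of the maximum.
\<close>

lemma good_rotate_iff: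
  assumes "r \<le> length b"
  shows "good_block (rotate r b) \<longleftrightarrow> (\<forall>m\<le>length b. excess b m \<le> excess b r)"
proof
  assume "good_block (rotate r b)"
  then have g: "excess (rotate r b) m \<le> 0" if "m \<le> length b" for m
    using that by (simp add: good_block_iff)
  show "\<forall>m\<le>length b. excess b m \<le> excess b r"
  proof (intro allI impI)
    fix m assume m: "m \<le> length b"
    consider "r \<le> m" | "m < r" "m \<noteq> 0" | "m = 0" by linarith
    then show "excess b m \<le> excess b r"
    proof cases
      case 1
      have a: "m - r \<le> length b" "m - r \<le> length b - r" using m by linarith+
      show ?thesis using g[OF a(1)] excess_rotate[OF assms a(1)] a(2) 1 by simp
    next
      case 2
      have a: "m + (length b - r) \<le> length b" "\<not> m + (length b - r) \<le> length b - r"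
        using 2 assms by linarith+
      show ?thesis using g[OF a(1)] excess_rotate[OF assms a(1)] a(2) by simp
    next
      case 3
      have a: "length b - r \<le> length b" by simp
      show ?thesis using g[OF a] excess_rotate[OF assms a] assms 3 by simp
    qed
  qed
next
  assume "\<forall>m\<le>length b. excess b m \<le> excess b r"
  then show "good_block (rotate r b)"
    using excess_rotate[OF assms] assms unfolding good_block_iff length_rotate by simp
qed

lemma shifts_pos:
  assumes "b \<noteq> []"
  shows "0 < shifts b"
proof -
  let ?M = "Max (excess b ` {..<length b})"
  have fin: "finite (excess b ` {..<length b})" "excess b ` {..<length b} \<noteq> {}" using assms by auto
  have "?M \<in> excess b ` {..<length b}" by (rule Max_in[OF fin])
  then obtain r where r: "r < length b" "?M = excess b r" by auto
  have lt: "excess b m \<le> excess b r" if "m < length b" for m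
    unfolding r(2)[symmetric] using fin(1) that by (intro Max_ge) simp_all
  have "excess b m \<le> excess b r" if "m \<le> length b" for m
    using lt[of m] lt[of 0] that assms by (cases "m = length b") simp_all
  then have "good_block (rotate r b)" using r(1) by (simp add: good_rotate_iff)
  then have "r \<in> {r. r < length b \<and> good_block (rotate r b)}" using r(1) by simp
  then have "{r. r < length b \<and> good_block (rotate r b)} \<noteq> {}" by blast
  then show ?thesis unfolding shifts_def by (simp add: card_gt_0_iff)
qed

lemma shifts_rotate [simp]: "shifts (rotate s b) = shifts b"
proof -
  have r1: "shifts (rotate1 c) = shifts c" for c :: "real list"
  proof -
    define f where "f r = (if good_block (rotate r c) then 1 else 0 :: nat)" for r
    have s: "card {r. r < length c \<and> good_block (rotate r d)} = (\<Sum>r<length c. if good_block (rotate r d) then 1 else 0)" for d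
      by (simp add: sum.If_cases) (rule arg_cong[of _ _ card], auto)
    have "shifts (rotate1 c) = (\<Sum>r<length c. f (Suc r))"
      unfolding shifts_def length_rotate1 s f_def rotate_Suc rotate1_rotate_swap ..
    moreover have "shifts c = (\<Sum>r<length c. f r)" unfolding shifts_def s f_def ..
    moreover have "f 0 + (\<Sum>r<length c. f (Suc r)) = (\<Sum>r<length c. f r) + f (length c)"
      by (metis sum.lessThan_Suc sum.lessThan_Suc_shift)
    moreover have "f 0 = f (length c)" by (simp add: f_def)
    ultimately show ?thesis by simp
  qed
  show ?thesis by (induction s) (simp_all add: rotate_def r1)
qed

text \<open>
  The objects of the largest value come first, in any order, followed by a sorted order of the rest.
\<close>

lemma card_sorted_orders:
  fixes f :: "'i \<Rightarrow> 'v :: linorder"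
  assumes "finite I"
  shows "card {\<tau> \<in> permutations_of_set I. sorted_wrt (\<ge>) (map f \<tau>)} = (\<Prod>v\<in>f ` I. fact (card {i \<in> I. f i = v}))"
  using assms
proof (induction "card I" arbitrary: I rule: less_induct)
  case less
  show ?case
  proof (cases "I = {}")
    case False
    define v where "v = Max (f ` I)"
    define A where "A = {i \<in> I. f i = v}"
    define B where "B = I - A"
    have fin: "finite A" "finite B" using less.prems by (auto simp: A_def B_def)
    have "v \<in> f ` I" unfolding v_def using less.prems False by simp
    then have A: "A \<noteq> {}" by (auto simp: A_def)
    have AB: "A \<inter> B = {}" "A \<union> B = I" by (auto simp: A_def B_def)
    have vB: "f i < v" if "i \<in> B" for i
    proof -
      have "f i \<le> v" unfolding v_def using that less.prems by (intro Max_ge) (auto simp: B_def)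
      then show ?thesis using that by (auto simp: B_def A_def order.order_iff_strict)
    qed
    have vA: "f i = v" if "i \<in> A" for i using that by (simp add: A_def)
    have cB: "card B < card I"
      using A AB less.prems by (intro psubset_card_mono) (auto simp: B_def A_def)
    let ?S = "\<lambda>J. {\<tau> \<in> permutations_of_set J. sorted_wrt (\<ge>) (map f \<tau>)}"
    have inj: "inj_on (\<lambda>(a, b). a @ b) (permutations_of_set A \<times> ?S B)"
    proof (rule inj_onI)
      fix x y :: "'i list \<times> 'i list"
      assume xy: "x \<in> permutations_of_set A \<times> ?S B" "y \<in> permutations_of_set A \<times> ?S B"
        and eq: "(case x of (a, b) \<Rightarrow> a @ b) = (case y of (a, b) \<Rightarrow> a @ b)"
      have "length (fst x) = length (fst y)"
        using xy[THEN mem_Times_iff[THEN iffD1], THEN conjunct1, THEN length_finite_permutations_of_set] by simp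
      then show "x = y" using eq by (simp add: case_prod_beta prod_eq_iff)
    qed
    have "?S I = (\<lambda>(a, b). a @ b) ` (permutations_of_set A \<times> ?S B)"
    proof (rule subset_antisym; rule subsetI)
      fix \<tau> assume "\<tau> \<in> ?S I"
      then have t: "set \<tau> = I" "distinct \<tau>" "sorted_wrt (\<ge>) (map f \<tau>)"
        by (auto dest: permutations_of_setD)
      define a where "a = takeWhile (\<lambda>i. f i = v) \<tau>"
      define b where "b = dropWhile (\<lambda>i. f i = v) \<tau>"
      have tab: "\<tau> = a @ b" by (simp add: a_def b_def)
      have d: "distinct a" "distinct b" "set a \<inter> set b = {}" "set a \<union> set b = I" using t(1,2) by (simp_all add: tab)
      have sb: "sorted_wrt (\<ge>) (map f b)" using t(3) by (simp add: tab sorted_wrt_append)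
      have a: "set a \<subseteq> A"
        using d(4) set_takeWhileD[of _ "\<lambda>i. f i = v" \<tau>] unfolding a_def A_def by fast
      have b: "f i \<noteq> v" if "i \<in> set b" for i
      proof (cases b)
        case (Cons h b')
        have "f h \<noteq> v" using hd_dropWhile[of "\<lambda>i. f i = v" \<tau>] Cons unfolding b_def by (metis list.distinct(1) list.sel(1))
        moreover have "h \<in> I" using d(4) Cons by auto
        ultimately have "f h < v" using vB vA AB by blast
        moreover have "f i \<le> f h" using that sb Cons by auto
        ultimately show ?thesis by simp
      qed (use that in simp)
      have "set b \<subseteq> B" using b d(4) by (auto simp: B_def A_def)
      then have "set a = A" "set b = B" using a d(3,4) AB by blast+
      then show "\<tau> \<in> (\<lambda>(a, b). a @ b) ` (permutations_of_set A \<times> ?S B)"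
        using d(1,2) sb tab by (intro image_eqI[of _ _ "(a, b)"]) (simp_all add: permutations_of_setI)
    next
      fix \<tau> assume "\<tau> \<in> (\<lambda>(a, b). a @ b) ` (permutations_of_set A \<times> ?S B)"
      then obtain a b where ab: "a \<in> permutations_of_set A" "b \<in> permutations_of_set B" "sorted_wrt (\<ge>) (map f b)" "\<tau> = a @ b"
        by auto
      have sa: "sorted_wrt (\<ge>) (map f a)"
      proof -
        have "map f a = replicate (length a) v"
          using permutations_of_setD(1)[OF ab(1)] vA by (intro replicate_eqI) auto
        then show ?thesis by (simp add: sorted_wrt_iff_nth_less)
      qed
      have "\<forall>x\<in>set a. \<forall>y\<in>set b. f y \<le> f x"
        using permutations_of_setD(1)[OF ab(1)] permutations_of_setD(1)[OF ab(2)] vA vB by (metis less_imp_le)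
      then have "sorted_wrt (\<ge>) (map f \<tau>)" using sa ab by (simp add: sorted_wrt_append)
      moreover have "\<tau> \<in> permutations_of_set I"
        using permutations_of_setD[OF ab(1)] permutations_of_setD[OF ab(2)] AB ab(4) by (intro permutations_of_setI) simp_all
      ultimately show "\<tau> \<in> ?S I" by simp
    qed
    then have "card (?S I) = card (permutations_of_set A) * card (?S B)"
      by (simp add: card_image[OF inj] card_cartesian_product)
    also have "\<dots> = fact (card A) * (\<Prod>w\<in>f ` B. fact (card {i \<in> B. f i = w}))"
      using less.hyps[OF cB fin(2)] fin by simp
    also have "(\<Prod>w\<in>f ` B. fact (card {i \<in> B. f i = w})) = (\<Prod>w\<in>f ` B. fact (card {i \<in> I. f i = w}))"
    proof (rule prod.cong[OF refl])
      fix w assume "w \<in> f ` B"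
      then have "w \<noteq> v" using vB by auto
      then have "{i \<in> B. f i = w} = {i \<in> I. f i = w}" by (auto simp: B_def A_def)
      then show "fact (card {i \<in> B. f i = w}) = fact (card {i \<in> I. f i = w})" by simp
    qed
    also have "fact (card A) * \<dots> = (\<Prod>w\<in>insert v (f ` B). fact (card {i \<in> I. f i = w}))"
    proof -
      have "v \<notin> f ` B" using vB by auto
      then show ?thesis using fin(2) by (simp add: A_def)
    qed
    also have "insert v (f ` B) = f ` I"
      unfolding AB(2)[symmetric] image_Un using A vA by auto
    finally show ?thesis .
  next
    case True
    then have "{\<tau> \<in> permutations_of_set I. sorted_wrt (\<ge>) (map f \<tau>)} = {[]}" by auto
    then show ?thesis using True by simp
  qed
qed

lemma orders_mset: "orders (mset xs) = (\<Prod>v\<in>(!) xs ` {..<length xs}. fact (card {i \<in> {..<length xs}. xs ! i = v}))"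
proof -
  have "set_mset (mset xs) = (!) xs ` {..<length xs}" by (auto simp: in_set_conv_nth)
  moreover have "count (mset xs) v = card {i \<in> {..<length xs}. xs ! i = v}" for v
    by (simp add: count_mset count_list_eq_length_filter length_filter_conv_card eq_commute)
  ultimately show ?thesis by (simp add: orders_def)
qed

lemma map_mean_rearr:
  assumes "ch \<in> choices (map length bs)"
  shows "map mean (rearr bs ch) = map ((!) (map mean bs)) (fst ch)"
proof -
  have "set (fst ch) = {..<length bs}" using choicesD(2)[OF assms] by simp
  then show ?thesis unfolding rearr_eq by simp
qed

theorem card_good_choices:
  "card {ch \<in> choices (map length bs). good (rearr bs ch)} = good_arrangements bs"
proof -
  let ?k = "length bs"
  let ?T = "{\<tau> \<in> permutations_of_set {..<?k}. sorted_wrt (\<ge>) (map ((!) (map mean bs)) \<tau>)}"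
  let ?A = "\<lambda>i. {r. r < length (bs ! i) \<and> good_block (rotate r (bs ! i))}"
  let ?R = "{r. length r = ?k \<and> (\<forall>i<?k. r ! i \<in> ?A i)}"
  have "{ch \<in> choices (map length bs). good (rearr bs ch)} = ?T \<times> ?R"
  proof (intro set_eqI)
    fix ch :: "nat list \<times> nat list"
    obtain \<tau> r where ch: "ch = (\<tau>, r)" by (cases ch)
    have c: "ch \<in> choices (map length bs) \<longleftrightarrow> \<tau> \<in> permutations_of_set {..<?k} \<and> length r = ?k \<and> (\<forall>i<?k. r ! i < length (bs ! i))"
      by (simp add: choices_def ch)
    have g: "good (rearr bs ch) \<longleftrightarrow> sorted_wrt (\<ge>) (map ((!) (map mean bs)) \<tau>) \<and> (\<forall>i<?k. good_block (rotate (r ! i) (bs ! i)))"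
      if cc: "ch \<in> choices (map length bs)"
    proof -
      have "(\<forall>b\<in>set (rearr bs ch). good_block b) \<longleftrightarrow> (\<forall>i<?k. good_block (rotate (r ! i) (bs ! i)))"
        unfolding Ball_def in_set_rearr[OF cc] by (auto simp: ch)
      then show ?thesis unfolding good_def map_mean_rearr[OF cc] by (simp add: ch)
    qed
    show "ch \<in> {ch \<in> choices (map length bs). good (rearr bs ch)} \<longleftrightarrow> ch \<in> ?T \<times> ?R"
      using c g by (auto simp: ch)
  qed
  moreover have "card ?R = prod_list (map shifts bs)"
  proof -
    have "card ?R = (\<Prod>i<?k. shifts (bs ! i))"
      using card_lists_nth[of ?k ?A] by (simp add: shifts_def)
    also have "\<dots> = prod_list (map shifts bs)" by (rule prod_list_map_nth)
    finally show ?thesis .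
  qed
  moreover have "card ?T = orders (mset (map mean bs))"
    unfolding orders_mset length_map by (rule card_sorted_orders[OF finite_lessThan])
  ultimately show ?thesis by (simp add: good_arrangements_def card_cartesian_product)
qed

lemma mset_map_mean_rearr:
  assumes "ch \<in> choices (map length bs)"
  shows "mset (map mean (rearr bs ch)) = mset (map mean bs)"
  unfolding map_mean_rearr[OF assms] using choicesD[OF assms] by (intro mset_map_nth_perm) simp_all

lemma good_arrangements_rearr:
  assumes "ch \<in> choices (map length bs)"
  shows "good_arrangements (rearr bs ch) = good_arrangements bs"
proof -
  have s: "set (fst ch) = {..<length bs}" using choicesD(2)[OF assms] by simp
  then have "map shifts (rearr bs ch) = map ((!) (map shifts bs)) (fst ch)" unfolding rearr_eq by simp
  moreover have "mset (map ((!) (map shifts bs)) (fst ch)) = mset (map shifts bs)"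
    using choicesD(1)[OF assms] s by (intro mset_map_nth_perm) simp_all
  ultimately have "mset (map shifts (rearr bs ch)) = mset (map shifts bs)" by (rule ssubst)
  then have "prod_list (map shifts (rearr bs ch)) = prod_list (map shifts bs)"
    unfolding prod_mset_prod_list[symmetric] by (rule arg_cong)
  then show ?thesis unfolding good_arrangements_def mset_map_mean_rearr[OF assms] by (rule arg_cong)
qed

lemma orders_pos: "0 < orders A"
  by (simp add: orders_def prod_pos)

lemma good_arrangements_pos:
  assumes "[] \<notin> set bs"
  shows "0 < good_arrangements bs"
proof -
  have "0 < prod_list (map shifts bs)" using assms
  proof (induction bs)
    case (Cons b bs)
    then show ?case using shifts_pos[of b] by (simp add: eq_commute)
  qed simp
  then show ?thesis using orders_pos by (simp add: good_arrangements_def)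
qed

section \<open>The polygon through the block ends\<close>

text \<open>
  The increments of the polygon through the block ends.
\<close>

definition levelled :: "real list list \<Rightarrow> real list" where
  "levelled bs = concat (map (\<lambda>b. replicate (length b) (mean b)) bs)"

lemma sum_list_block: "sum_list b = real (length b) * mean b"
  by (cases "b = []") (simp_all add: sum_list_mean)

lemma length_levelled [simp]: "length (levelled bs) = length (concat bs)"
  by (induction bs) (simp_all add: levelled_def)

lemma levelled_Cons: "levelled (b # bs) = replicate (length b) (mean b) @ levelled bs"
  by (simp add: levelled_def)

lemma take_levelled_Cons:
  "j \<le> length b \<Longrightarrow> sum_list (take j (levelled (b # bs))) = real j * mean b"
  "sum_list (take (length b + j) (levelled (b # bs))) = sum_list b + sum_list (take j (levelled bs))"
  by (simp_all add: levelled_Cons sum_list_block[of b] sum_list_replicate min_absorb1)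

lemma take_concat_Cons:
  "j \<le> length b \<Longrightarrow> sum_list (take j (concat (b # bs))) = sum_list (take j (b :: real list))"
  "sum_list (take (length b + j) (concat (b # bs))) = sum_list b + sum_list (take j (concat bs))"
  by simp_all

lemma all_le_append_split:
  "(\<forall>j\<le>a + (b::nat). Q j) \<longleftrightarrow> (\<forall>j\<le>a. Q j) \<and> (\<forall>j\<le>b. Q (a + j))"
proof (intro iffI conjI allI impI)
  fix j assume h: "(\<forall>j\<le>a. Q j) \<and> (\<forall>j\<le>b. Q (a + j))" and "j \<le> a + b"
  then show "Q j"
    by (cases "j \<le> a") (auto dest: spec[of _ "j - a"])
qed auto

lemma concat_below_levelled_iff:
  "(\<forall>j\<le>length (concat bs). sum_list (take j (concat bs)) \<le> sum_list (take j (levelled bs))) \<longleftrightarrow>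
   (\<forall>b\<in>set bs. good_block b)"
proof (induction bs)
  case (Cons b bs)
  have l: "length (concat (b # bs)) = length b + length (concat bs)" by simp
  have 1: "(\<forall>j\<le>length b. sum_list (take j (concat (b # bs))) \<le> sum_list (take j (levelled (b # bs)))) \<longleftrightarrow> good_block b"
    unfolding good_block_iff excess_def by (simp add: take_levelled_Cons)
  have 2: "sum_list (take (length b + j) (concat (b # bs))) \<le> sum_list (take (length b + j) (levelled (b # bs))) \<longleftrightarrow>
      sum_list (take j (concat bs)) \<le> sum_list (take j (levelled bs))" for j
    unfolding take_levelled_Cons take_concat_Cons by (rule add_le_cancel_left)
  show ?case unfolding l all_le_append_split 1 2 Cons.IH list.set(2) by blast
qed (simp add: levelled_def)

text \<open>
  A concave function above the walk is above the chord of each block. The induction over the blocks moves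
  the origin to \<open>(a, s0)\<close>.
\<close>

lemma concave_above_levelled:
  assumes "concave_on {a..a + real (length (concat bs))} c"
    and "\<And>j. j \<le> length (concat bs) \<Longrightarrow> s0 + sum_list (take j (concat bs)) \<le> c (a + real j)"
    and "j \<le> length (concat bs)"
  shows "s0 + sum_list (take j (levelled bs)) \<le> c (a + real j)"
  using assms
proof (induction bs arbitrary: a s0 j)
  case (Cons b bs)
  let ?L = "real (length b)"
  show ?case
  proof (cases "j \<le> length b")
    case True
    show ?thesis
    proof (cases "j = 0")
      case True
      then show ?thesis using Cons.prems(2)[of 0] by simp
    next
      case False
      then have L: "?L > 0" "real j \<le> ?L" using True by auto
      define t where "t = real j / ?L"
      have t: "0 \<le> t" "t \<le> 1" using L by (simp_all add: t_def)
      have e0: "s0 \<le> c a" using Cons.prems(2)[of 0] by simp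
      have e1: "s0 + sum_list b \<le> c (a + ?L)" using Cons.prems(2)[of "length b"] by simp
      have "(1 - t) * c a + t * c (a + ?L) \<le> c ((1 - t) *\<^sub>R a + t *\<^sub>R (a + ?L))"
        using Cons.prems(1) t by (intro concave_onD) auto
      also have "(1 - t) *\<^sub>R a + t *\<^sub>R (a + ?L) = a + real j"
        using L by (simp add: t_def field_simps)
      finally have "(1 - t) * s0 + t * (s0 + sum_list b) \<le> c (a + real j)"
        using mult_left_mono[OF e0, of "1 - t"] mult_left_mono[OF e1, of t] t by linarith
      moreover have "(1 - t) * s0 + t * (s0 + sum_list b) = s0 + real j * mean b"
        using L by (simp add: t_def mean_def field_simps)
      ultimately show ?thesis using True by (simp add: take_levelled_Cons)
    qed
  next
    case False
    then obtain i where i: "j = length b + i" using nat_le_iff_add[of "length b" j] by auto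
    have "s0 + sum_list b + sum_list (take i (levelled bs)) \<le> c ((a + ?L) + real i)"
    proof (rule Cons.IH)
      show "concave_on {a + ?L..a + ?L + real (length (concat bs))} c"
        using Cons.prems(1) unfolding concave_on_def by (rule convex_on_subset) auto
      fix i assume "i \<le> length (concat bs)"
      then show "s0 + sum_list b + sum_list (take i (concat bs)) \<le> c (a + ?L + real i)"
        using Cons.prems(2)[of "length b + i"] by (simp add: algebra_simps)
    next
      show "i \<le> length (concat bs)" using Cons.prems(3) i by simp
    qed
    then show ?thesis unfolding i take_levelled_Cons by (simp add: algebra_simps)
  qed
qed (simp add: levelled_def)

section \<open>Good compositions of a walk\<close>

definition max_slope :: "real list \<Rightarrow> real" where
  "max_slope xs = Max ((\<lambda>m. mean (take m xs)) ` {1..length xs})"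

text \<open>
  The times at which the walk meets the line of the largest slope from the origin. They lie on the first
  edge of its concave majorant.
\<close>

definition contacts :: "real list \<Rightarrow> nat set" where
  "contacts xs = {m \<in> {1..length xs}. mean (take m xs) = max_slope xs}"

lemma mean_take: "1 \<le> m \<Longrightarrow> m \<le> length xs \<Longrightarrow> mean (take m xs) = sum_list (take m xs) / real m"
  by (simp add: mean_def min_absorb2)

lemma mean_take_le_iff: "1 \<le> m \<Longrightarrow> m \<le> length xs \<Longrightarrow> mean (take m xs) \<le> v \<longleftrightarrow> sum_list (take m xs) \<le> real m * v"
  by (simp add: mean_take divide_le_eq mult.commute)

lemma mean_take_eq_iff: "1 \<le> m \<Longrightarrow> m \<le> length xs \<Longrightarrow> mean (take m xs) = v \<longleftrightarrow> sum_list (take m xs) = real m * v"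
  by (simp add: mean_take divide_eq_eq mult.commute)

lemma finite_contacts [simp]: "finite (contacts xs)"
  by (simp add: contacts_def)

lemma contacts_iff: "m \<in> contacts xs \<longleftrightarrow> 1 \<le> m \<and> m \<le> length xs \<and> sum_list (take m xs) = real m * max_slope xs"
  unfolding contacts_def using mean_take_eq_iff by auto

lemma sum_take_le_max_slope:
  assumes "m \<le> length xs"
  shows "sum_list (take m xs) \<le> real m * max_slope xs"
proof (cases "m = 0")
  case False
  then have "mean (take m xs) \<le> max_slope xs" unfolding max_slope_def using assms by (intro Max_ge) auto
  then show ?thesis using mean_take_le_iff False assms by simp
qed simp

lemma contacts_nonempty:
  assumes "xs \<noteq> []"
  shows "contacts xs \<noteq> {}"
proof -
  have "max_slope xs \<in> (\<lambda>m. mean (take m xs)) ` {1..length xs}"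
    unfolding max_slope_def using assms by (intro Max_in) (auto simp: Suc_le_eq)
  then show ?thesis by (auto simp: contacts_def)
qed

lemma max_slope_unique:
  assumes "\<And>m. m \<le> length xs \<Longrightarrow> sum_list (take m xs) \<le> real m * v"
    and "1 \<le> j" "j \<le> length xs" "sum_list (take j xs) = real j * v"
  shows "max_slope xs = v"
proof (rule antisym)
  have "xs \<noteq> []" using assms(2,3) by auto
  then obtain m where "m \<in> contacts xs" using contacts_nonempty by blast
  then have m: "1 \<le> m" "m \<le> length xs" "sum_list (take m xs) = real m * max_slope xs"
    by (simp_all add: contacts_iff)
  then have "real m * max_slope xs \<le> real m * v" using assms(1)[of m] by simp
  then show "max_slope xs \<le> v" using m(1) by simp
  have "real j * v \<le> real j * max_slope xs" using sum_take_le_max_slope[OF assms(3)] assms(4) by simp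
  then show "v \<le> max_slope xs" using assms(2) by simp
qed

lemma sum_take_drop: "sum_list (take i (drop j xs)) = sum_list (take (j + i) xs) - sum_list (take j (xs :: real list))"
  by (simp add: take_add)

lemma after_contact:
  assumes "j \<in> contacts xs"
  shows "i \<le> length xs - j \<Longrightarrow> sum_list (take i (drop j xs)) \<le> real i * max_slope xs"
    and "j < length xs \<Longrightarrow> max_slope (drop j xs) \<le> max_slope xs"
    and "1 \<le> i \<Longrightarrow> j + i \<in> contacts xs \<Longrightarrow> max_slope (drop j xs) = max_slope xs"
    and "max_slope (drop j xs) = max_slope xs \<Longrightarrow> i \<in> contacts (drop j xs) \<longleftrightarrow> 1 \<le> i \<and> j + i \<in> contacts xs"
proof -
  have j: "1 \<le> j" "j \<le> length xs" "sum_list (take j xs) = real j * max_slope xs"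
    using assms by (auto simp: contacts_iff)
  show le: "sum_list (take i (drop j xs)) \<le> real i * max_slope xs" if "i \<le> length xs - j" for i
    using sum_take_le_max_slope[of "j + i" xs] that j unfolding sum_take_drop by (simp add: algebra_simps)
  show "max_slope (drop j xs) \<le> max_slope xs" if "j < length xs"
  proof -
    have "drop j xs \<noteq> []" using that by simp
    then obtain m where m: "m \<in> contacts (drop j xs)" using contacts_nonempty by blast
    then have "real m * max_slope (drop j xs) \<le> real m * max_slope xs" "1 \<le> m"
      using le[of m] by (auto simp: contacts_iff)
    then show ?thesis by simp
  qed
  show "max_slope (drop j xs) = max_slope xs" if "1 \<le> i" "j + i \<in> contacts xs"
  proof (rule max_slope_unique)
    show "sum_list (take m (drop j xs)) \<le> real m * max_slope xs" if "m \<le> length (drop j xs)" for m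
      using le that by simp
    show "1 \<le> i" "i \<le> length (drop j xs)" using that j by (auto simp: contacts_iff)
    show "sum_list (take i (drop j xs)) = real i * max_slope xs"
      using that(2) j unfolding sum_take_drop contacts_iff by (simp add: algebra_simps)
  qed
  show "i \<in> contacts (drop j xs) \<longleftrightarrow> 1 \<le> i \<and> j + i \<in> contacts xs" if "max_slope (drop j xs) = max_slope xs"
    unfolding contacts_iff sum_take_drop that using j by (auto simp: algebra_simps)
qed

text \<open>
  The slopes of the concave majorant between consecutive times at which the walk meets it, one for each
  such gap.
\<close>

function slopes :: "real list \<Rightarrow> real list" where
  "slopes xs = (if xs = [] then [] else max_slope xs # slopes (drop (Min (contacts xs)) xs))"
  by auto
termination
proof (relation "Wellfounded.measure length")
  fix xs :: "real list" assume ne: "xs \<noteq> []"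
  have "Min (contacts xs) \<in> contacts xs" using contacts_nonempty[OF ne] by (intro Min_in) simp_all
  then show "(drop (Min (contacts xs)) xs, xs) \<in> Wellfounded.measure length" by (auto simp: contacts_iff)
qed simp

declare slopes.simps [simp del]

lemma slopes_Nil [simp]: "slopes [] = []"
  by (simp add: slopes.simps)

lemma slopes_eq: "xs \<noteq> [] \<Longrightarrow> slopes xs = max_slope xs # slopes (drop (Min (contacts xs)) xs)"
  by (simp add: slopes.simps)

lemma first_contact:
  assumes "xs \<noteq> []"
  shows "Min (contacts xs) \<in> contacts xs" "\<And>i. i \<in> contacts xs \<Longrightarrow> Min (contacts xs) \<le> i"
  using contacts_nonempty[OF assms] by simp_all

lemma card_first_contact:
  assumes "xs \<noteq> []"
  shows "card {i \<in> contacts xs. i \<le> Min (contacts xs)} = 1"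
proof -
  have "{i \<in> contacts xs. i \<le> Min (contacts xs)} = {Min (contacts xs)}"
    using first_contact[OF assms] by (auto intro: antisym)
  then show ?thesis by simp
qed

lemma card_contacts_shift:
  assumes ne: "xs \<noteq> []" and l: "l = Min (contacts xs)"
    and v: "max_slope (drop l xs) = max_slope xs"
  shows "card {i \<in> contacts xs. i \<le> l + j} = Suc (card {i \<in> contacts (drop l xs). i \<le> j})"
proof -
  note fc = first_contact[OF ne, folded l]
  have "{i \<in> contacts xs. i \<le> l + j} = insert l ((+) l ` {i \<in> contacts (drop l xs). i \<le> j})"
  proof (intro set_eqI iffI)
    fix i assume i: "i \<in> {i \<in> contacts xs. i \<le> l + j}"
    then have "l \<le> i" using fc(2) by simp
    then show "i \<in> insert l ((+) l ` {i \<in> contacts (drop l xs). i \<le> j})"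
      using i after_contact(4)[OF fc(1) v, of "i - l"] by (cases "i = l") (auto intro!: image_eqI[of _ _ "i - l"])
  qed (use fc(1) after_contact(4)[OF fc(1) v] in auto)
  moreover have "l \<notin> (+) l ` {i \<in> contacts (drop l xs). i \<le> j}" by (auto simp: contacts_iff)
  moreover have "card ((+) l ` {i \<in> contacts (drop l xs). i \<le> j}) = card {i \<in> contacts (drop l xs). i \<le> j}"
    by (rule card_image) simp
  ultimately show ?thesis by simp
qed

lemma slopes_at_contact:
  "j \<in> contacts xs \<Longrightarrow> slopes xs = replicate (card {i \<in> contacts xs. i \<le> j}) (max_slope xs) @ slopes (drop j xs)"
proof (induction "length xs" arbitrary: xs j rule: less_induct)
  case less
  have ne: "xs \<noteq> []" using less.prems by (auto simp: contacts_iff)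
  define l where "l = Min (contacts xs)"
  note fc = first_contact[OF ne, folded l_def]
  have l1: "1 \<le> l" "l \<le> length xs" using fc(1) by (auto simp: contacts_iff)
  have eq: "slopes xs = max_slope xs # slopes (drop l xs)" using slopes_eq[OF ne] by (simp add: l_def)
  show ?case
  proof (cases "j = l")
    case True
    then show ?thesis using eq card_first_contact[OF ne] by (simp add: l_def)
  next
    case False
    define i where "i = j - l"
    have i: "1 \<le> i" "j = l + i" using fc(2)[OF less.prems] False by (auto simp: i_def)
    have v: "max_slope (drop l xs) = max_slope xs" using after_contact(3)[OF fc(1) i(1)] less.prems i(2) by simp
    have "i \<in> contacts (drop l xs)" using after_contact(4)[OF fc(1) v] i less.prems by simp
    moreover have "length (drop l xs) < length xs" using l1 by simp
    ultimately have "slopes (drop l xs) = replicate (card {k \<in> contacts (drop l xs). k \<le> i}) (max_slope xs) @ slopes (drop i (drop l xs))"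
      using less.hyps v by metis
    then show ?thesis using eq card_contacts_shift[OF ne l_def v, of i] i(2) by (simp add: add.commute)
  qed
qed

text \<open>
  The initial entries of \<open>slopes xs\<close> that equal the largest slope belong to the contact points in
  increasing order, so a prefix of \<open>m\<close> of them ends at the \<open>m\<close>-th contact point.
\<close>

lemma contact_of_slopes_prefix:
  "slopes xs = replicate m (max_slope xs) @ rest \<Longrightarrow> 1 \<le> m \<Longrightarrow>
   \<exists>j\<in>contacts xs. card {i \<in> contacts xs. i \<le> j} = m \<and> rest = slopes (drop j xs)"
proof (induction m arbitrary: xs)
  case (Suc m)
  have ne: "xs \<noteq> []" using Suc.prems(1) by auto
  define l where "l = Min (contacts xs)"
  note fc = first_contact[OF ne, folded l_def]
  have eq: "slopes xs = max_slope xs # slopes (drop l xs)" using slopes_eq[OF ne] by (simp add: l_def)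
  then have eq': "slopes (drop l xs) = replicate m (max_slope xs) @ rest" using Suc.prems(1) by simp
  show ?case
  proof (cases "m = 0")
    case True
    then show ?thesis using fc(1) eq' card_first_contact[OF ne] by (intro bexI[of _ l]) (simp_all add: l_def)
  next
    case False
    then obtain m' where m': "m = Suc m'" by (cases m) auto
    have ne': "drop l xs \<noteq> []"
    proof
      assume "drop l xs = []"
      then show False using eq' m' by simp
    qed
    have v: "max_slope (drop l xs) = max_slope xs" using eq' slopes_eq[OF ne'] m' by simp
    have "slopes (drop l xs) = replicate m (max_slope (drop l xs)) @ rest" using eq' v by simp
    then obtain j where j: "j \<in> contacts (drop l xs)" "card {i \<in> contacts (drop l xs). i \<le> j} = m" "rest = slopes (drop j (drop l xs))"
      using Suc.IH[of "drop l xs"] False by auto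
    then show ?thesis
      using after_contact(4)[OF fc(1) v] card_contacts_shift[OF ne l_def v, of j]
      by (intro bexI[of _ "l + j"]) (simp_all add: add.commute)
  qed
qed simp

lemma sorted_slopes: "sorted_wrt (\<ge>) (slopes xs)"
proof (induction "length xs" arbitrary: xs rule: less_induct)
  case less
  show ?case
  proof (cases "xs = []")
    case False
    define l where "l = Min (contacts xs)"
    note fc = first_contact[OF False, folded l_def]
    have l1: "1 \<le> l" "l \<le> length xs" using fc(1) by (auto simp: contacts_iff)
    have s: "sorted_wrt (\<ge>) (slopes (drop l xs))" using less.hyps[of "drop l xs"] l1 by simp
    have eq: "slopes xs = max_slope xs # slopes (drop l xs)" using slopes_eq[OF False] by (simp add: l_def)
    show ?thesis
    proof (cases "drop l xs = []")
      case False
      have "max_slope (drop l xs) \<le> max_slope xs" using after_contact(2)[OF fc(1)] False by simp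
      then show ?thesis using s unfolding eq slopes_eq[OF False] by auto
    qed (simp add: eq)
  qed simp
qed

text \<open>
  The walk of the block \<open>take j xs\<close> attains its maximal excess, zero, exactly at the contact points, so
  the good rotations start at time \<open>0\<close> and at the contact points before \<open>j\<close>.
\<close>

lemma shifts_at_contact:
  assumes "j \<in> contacts xs"
  shows "mean (take j xs) = max_slope xs" "good_block (take j xs)"
    "shifts (take j xs) = card {i \<in> contacts xs. i \<le> j}"
proof -
  have j: "1 \<le> j" "j \<le> length xs" "sum_list (take j xs) = real j * max_slope xs"
    using assms by (auto simp: contacts_iff)
  then show m: "mean (take j xs) = max_slope xs" by (simp add: mean_take_eq_iff)
  have ex: "excess (take j xs) i = sum_list (take i xs) - real i * max_slope xs" if "i \<le> j" for i
    using that unfolding excess_def m by (simp add: min_absorb1)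
  have le: "excess (take j xs) i \<le> 0" if "i \<le> j" for i
    using ex[OF that] sum_take_le_max_slope[of i xs] that j by simp
  then show "good_block (take j xs)" using j by (simp add: good_block_iff)
  have "{r. r < length (take j xs) \<and> good_block (rotate r (take j xs))} = insert 0 ({i \<in> contacts xs. i \<le> j} - {j})"
  proof (intro set_eqI)
    fix r
    have "good_block (rotate r (take j xs)) \<longleftrightarrow> r = 0 \<or> r \<in> contacts xs" if "r < j"
    proof -
      have "good_block (rotate r (take j xs)) \<longleftrightarrow> (\<forall>m\<le>j. excess (take j xs) m \<le> excess (take j xs) r)"
        using good_rotate_iff[of r "take j xs"] that j by (simp add: min_absorb2)
      also have "\<dots> \<longleftrightarrow> excess (take j xs) r = 0"
      proof
        assume "\<forall>m\<le>j. excess (take j xs) m \<le> excess (take j xs) r"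
        then have "excess (take j xs) 0 \<le> excess (take j xs) r" by blast
        then show "excess (take j xs) r = 0" using le[of r] that by simp
      qed (use le in simp)
      also have "\<dots> \<longleftrightarrow> r = 0 \<or> r \<in> contacts xs" using ex[of r] that j by (auto simp: contacts_iff)
      finally show ?thesis .
    qed
    then show "r \<in> {r. r < length (take j xs) \<and> good_block (rotate r (take j xs))} \<longleftrightarrow> r \<in> insert 0 ({i \<in> contacts xs. i \<le> j} - {j})"
      using j by (auto simp: min_absorb2)
  qed
  then have "shifts (take j xs) = Suc (card ({i \<in> contacts xs. i \<le> j} - {j}))"
    unfolding shifts_def by (simp add: contacts_iff)
  also have "\<dots> = card {i \<in> contacts xs. i \<le> j}"
    by (rule card.remove[symmetric]) (use assms in auto)
  finally show "shifts (take j xs) = card {i \<in> contacts xs. i \<le> j}" .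
qed

lemma good_sum_take_le:
  assumes "\<And>b. b \<in> set bs \<Longrightarrow> good_block b \<and> mean b \<le> v" "j \<le> length (concat bs)"
  shows "sum_list (take j (concat bs)) \<le> real j * v"
  using assms
proof (induction bs arbitrary: j)
  case (Cons b bs)
  have g: "good_block b" "mean b \<le> v" using Cons.prems(1) by auto
  show ?case
  proof (cases "j \<le> length b")
    case True
    then have "sum_list (take j b) \<le> real j * mean b" using g(1) by (simp add: good_block_iff excess_def)
    also have "\<dots> \<le> real j * v" using g(2) by (simp add: mult_left_mono)
    finally show ?thesis using True by simp
  next
    case False
    then obtain i where i: "j = length b + i" using nat_le_iff_add[of "length b" j] by auto
    have "sum_list (take i (concat bs)) \<le> real i * v" using Cons.IH[of i] Cons.prems i by simp
    moreover have "sum_list b \<le> real (length b) * v" unfolding sum_list_block[of b] using g(2) by (simp add: mult_left_mono)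
    ultimately show ?thesis unfolding i take_concat_Cons by (simp add: algebra_simps)
  qed
qed simp

abbreviation good_compositions :: "real list \<Rightarrow> nat list set" where
  "good_compositions xs \<equiv> {ns \<in> compositions (length xs). good (split_blocks ns xs)}"

text \<open>
  The first block of a good division has the largest mean of all prefixes of the walk, so it ends at a
  contact point. Conversely, after a contact point no prefix has a larger mean.
\<close>

lemma good_compositions_Cons:
  "m # ns \<in> good_compositions xs \<longleftrightarrow> m \<in> contacts xs \<and> ns \<in> good_compositions (drop m xs)"
proof
  assume h: "m # ns \<in> good_compositions xs"
  then have c: "0 < m" "m \<le> length xs" "ns \<in> compositions (length xs - m)" and g: "good (take m xs # split_blocks ns (drop m xs))"
    by (simp_all add: compositions_Cons)
  let ?v = "mean (take m xs)"
  have "max_slope xs = ?v"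
  proof (rule max_slope_unique)
    fix i assume i: "i \<le> length xs"
    have "concat (take m xs # split_blocks ns (drop m xs)) = xs"
      using c compositions_sum[OF c(3)] by (simp add: concat_split_blocks)
    moreover have "good_block b \<and> mean b \<le> ?v" if "b \<in> set (take m xs # split_blocks ns (drop m xs))" for b
      using that g by (auto simp: good_def)
    ultimately show "sum_list (take i xs) \<le> real i * ?v" using good_sum_take_le[of "take m xs # split_blocks ns (drop m xs)" ?v i] i by metis
  next
    show "1 \<le> m" "m \<le> length xs" using c by simp_all
    then show "sum_list (take m xs) = real m * ?v" using mean_take_eq_iff[of m xs ?v] by simp
  qed
  then have "m \<in> contacts xs" using c by (simp add: contacts_def)
  moreover have "good (split_blocks ns (drop m xs))" using g by (simp add: good_def)
  ultimately show "m \<in> contacts xs \<and> ns \<in> good_compositions (drop m xs)" using c by simp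
next
  assume h: "m \<in> contacts xs \<and> ns \<in> good_compositions (drop m xs)"
  then have m: "m \<in> contacts xs" "1 \<le> m" "m \<le> length xs" and ns: "ns \<in> compositions (length xs - m)"
    and g: "good (split_blocks ns (drop m xs))" by (auto simp: contacts_iff)
  have "\<forall>b\<in>set (split_blocks ns (drop m xs)). mean b \<le> mean (take m xs)"
  proof (cases ns)
    case (Cons k ks)
    have k: "1 \<le> k" "k \<le> length xs - m" using ns Cons by (simp_all add: compositions_Cons)
    have "mean (take k (drop m xs)) \<le> max_slope xs"
      using after_contact(1)[OF m(1), of k] k by (simp add: mean_take_le_iff)
    then show ?thesis using g shifts_at_contact(1)[OF m(1)] Cons by (auto simp: good_def)
  qed simp
  then have "good (take m xs # split_blocks ns (drop m xs))"
    using g shifts_at_contact(2)[OF m(1)] by (auto simp: good_def)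
  then show "m # ns \<in> good_compositions xs" using m ns by (simp add: compositions_Cons)
qed

definition block_keys :: "nat list \<Rightarrow> real list \<Rightarrow> (real \<times> nat) list" where
  "block_keys ns xs = map (\<lambda>b. (mean b, shifts b)) (split_blocks ns xs)"

text \<open>
  The divisions of \<open>ss\<close> into consecutive constant non-empty runs, given by values and lengths.
\<close>

definition run_partitions :: "'v list \<Rightarrow> ('v \<times> nat) list set" where
  "run_partitions ss = {\<kappa>. (\<forall>k\<in>set \<kappa>. 0 < snd k) \<and> concat (map (\<lambda>k. replicate (snd k) (fst k)) \<kappa>) = ss}"

lemma run_partitions_Nil: "run_partitions [] = {[]}"
proof -
  have "\<kappa> = []" if "\<kappa> \<in> run_partitions []" for \<kappa> :: "('v \<times> nat) list"
    using that by (cases \<kappa>) (auto simp: run_partitions_def)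
  then show ?thesis by (auto simp: run_partitions_def)
qed

text \<open>
  A good composition puts together consecutive gaps of equal slope between the times at which the walk
  meets its majorant. The mean of a block is the slope of its gaps, and its number of good rotations is the
  number of its gaps. So for the weights one may forget how long the gaps are.
\<close>

lemma block_keys_bij: "bij_betw (\<lambda>ns. block_keys ns xs) (good_compositions xs) (run_partitions (slopes xs))"
proof (induction "length xs" arbitrary: xs rule: less_induct)
  case less
  show ?case
  proof (cases "xs = []")
    case True
    have "good_compositions xs = {[]}" using True by (auto simp: good_def)
    then show ?thesis using True by (simp add: bij_betw_def block_keys_def run_partitions_Nil)
  next
    case False
    let ?c = "\<lambda>j. card {i \<in> contacts xs. i \<le> j}"
    have IH: "bij_betw (\<lambda>ns. block_keys ns (drop m xs)) (good_compositions (drop m xs)) (run_partitions (slopes (drop m xs)))"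
      if "m \<in> contacts xs" for m
      using that False by (intro less.hyps) (auto simp: contacts_iff)
    have split: "\<exists>m ms. ns = m # ms \<and> m \<in> contacts xs \<and> ms \<in> good_compositions (drop m xs)"
      if "ns \<in> good_compositions xs" for ns
    proof (cases ns)
      case Nil
      then show ?thesis using that False by (simp add: compositions_def)
    next
      case (Cons m ms)
      then show ?thesis using that good_compositions_Cons by blast
    qed
    have key: "block_keys (m # ms) xs = (max_slope xs, ?c m) # block_keys ms (drop m xs)" if "m \<in> contacts xs" for m ms
      using shifts_at_contact(1,3)[OF that] by (simp add: block_keys_def)
    have cpos: "0 < ?c m" if "m \<in> contacts xs" for m
    proof -
      have "m \<in> {i \<in> contacts xs. i \<le> m}" using that by simp
      then show ?thesis by (metis card_gt_0_iff empty_iff finite_Collect_conjI finite_Collect_le_nat)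
    qed
    have cmono: "?c a < ?c b" if "b \<in> contacts xs" "a < b" for a b
    proof (rule psubset_card_mono)
      show "{i \<in> contacts xs. i \<le> a} \<subset> {i \<in> contacts xs. i \<le> b}" 
      proof (rule psubsetI)
        show "{i \<in> contacts xs. i \<le> a} \<subseteq> {i \<in> contacts xs. i \<le> b}" using that(2) by auto
        have "b \<in> {i \<in> contacts xs. i \<le> b}" "b \<notin> {i \<in> contacts xs. i \<le> a}" using that by auto
        then show "{i \<in> contacts xs. i \<le> a} \<noteq> {i \<in> contacts xs. i \<le> b}" by blast
      qed
    qed simp
    have cinj: "a = b" if "a \<in> contacts xs" "b \<in> contacts xs" "?c a = ?c b" for a b
      using cmono[of a b] cmono[of b a] that by (metis less_irrefl nat_neq_iff)
    show ?thesis
    proof (rule bij_betw_imageI)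
      show "inj_on (\<lambda>ns. block_keys ns xs) (good_compositions xs)"
      proof (rule inj_onI)
        fix ns ks assume ns: "ns \<in> good_compositions xs" and ks: "ks \<in> good_compositions xs" and eq: "block_keys ns xs = block_keys ks xs"
        obtain m ms where m: "ns = m # ms" "m \<in> contacts xs" "ms \<in> good_compositions (drop m xs)" using split[OF ns] by blast
        obtain l ls where l: "ks = l # ls" "l \<in> contacts xs" "ls \<in> good_compositions (drop l xs)" using split[OF ks] by blast
        have e: "?c m = ?c l" "block_keys ms (drop m xs) = block_keys ls (drop l xs)"
          using eq unfolding m(1) l(1) key[OF m(2)] key[OF l(2)] by simp_all
        have ml: "m = l" by (rule cinj[OF m(2) l(2) e(1)])
        have "ms = ls"
          using inj_onD[OF bij_betw_imp_inj_on[OF IH[OF m(2)]]] e(2) m(3) l(3) ml by blast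
        then show "ns = ks" using m(1) l(1) ml by simp
      qed
      show "(\<lambda>ns. block_keys ns xs) ` good_compositions xs = run_partitions (slopes xs)"
      proof (rule subset_antisym; rule subsetI)
        fix \<kappa> assume "\<kappa> \<in> (\<lambda>ns. block_keys ns xs) ` good_compositions xs"
        then obtain ns where ns: "ns \<in> good_compositions xs" "\<kappa> = block_keys ns xs" by blast
        obtain m ms where m: "ns = m # ms" "m \<in> contacts xs" "ms \<in> good_compositions (drop m xs)" using split[OF ns(1)] by blast
        have "block_keys ms (drop m xs) \<in> run_partitions (slopes (drop m xs))"
          using bij_betwE[OF IH[OF m(2)]] m(3) by blast
        then show "\<kappa> \<in> run_partitions (slopes xs)"
          unfolding ns(2) m(1) key[OF m(2)] slopes_at_contact[OF m(2)] run_partitions_def using cpos[OF m(2)] by simp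
      next
        fix \<kappa> assume \<kappa>: "\<kappa> \<in> run_partitions (slopes xs)"
        obtain k \<kappa>' where k: "\<kappa> = k # \<kappa>'" using \<kappa> slopes_eq[OF False] by (cases \<kappa>) (auto simp: run_partitions_def)
        have k0: "0 < snd k" and ke: "replicate (snd k) (fst k) @ concat (map (\<lambda>k. replicate (snd k) (fst k)) \<kappa>') = slopes xs"
          and k': "\<forall>k\<in>set \<kappa>'. 0 < snd k" using \<kappa> by (auto simp: run_partitions_def k)
        have "hd (replicate (snd k) (fst k) @ concat (map (\<lambda>k. replicate (snd k) (fst k)) \<kappa>')) = fst k" using k0 by (cases "snd k") simp_all
        then have v: "fst k = max_slope xs" using slopes_eq[OF False] unfolding ke by simp
        obtain j where j: "j \<in> contacts xs" "?c j = snd k" "concat (map (\<lambda>k. replicate (snd k) (fst k)) \<kappa>') = slopes (drop j xs)"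
          using contact_of_slopes_prefix[of xs "snd k" "concat (map (\<lambda>k. replicate (snd k) (fst k)) \<kappa>')"] ke v k0 by auto
        then have "\<kappa>' \<in> run_partitions (slopes (drop j xs))" using k' by (simp add: run_partitions_def)
        then have "\<kappa>' \<in> (\<lambda>ns. block_keys ns (drop j xs)) ` good_compositions (drop j xs)"
          unfolding bij_betw_imp_surj_on[OF IH[OF j(1)]] .
        then obtain ms where ms: "\<kappa>' = block_keys ms (drop j xs)" "ms \<in> good_compositions (drop j xs)"
          by (rule imageE)
        have "block_keys (j # ms) xs = \<kappa>" unfolding key[OF j(1)] k ms(1) using v j(2) by (simp add: prod_eq_iff)
        moreover have "j # ms \<in> good_compositions xs" using good_compositions_Cons j(1) ms(2) by blast
        ultimately show "\<kappa> \<in> (\<lambda>ns. block_keys ns xs) ` good_compositions xs" by blast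
      qed
    qed
  qed
qed

definition run_weight :: "('v \<times> nat) list \<Rightarrow> real" where
  "run_weight \<kappa> = 1 / (real (orders (mset (map fst \<kappa>))) * real (prod_list (map snd \<kappa>)))"

lemma orders_replicate:
  assumes "v \<notin># A"
  shows "orders (replicate_mset k v + A) = fact k * orders A"
proof (cases "k = 0")
  case False
  have c: "count A v = 0" using assms by (simp add: not_in_iff)
  have "orders (replicate_mset k v + A) = (\<Prod>w\<in>insert v (set_mset A). fact (count (replicate_mset k v + A) w))"
    unfolding orders_def using False by (simp add: set_mset_replicate_mset_subset)
  also have "\<dots> = fact k * (\<Prod>w\<in>set_mset A. fact (count (replicate_mset k v + A) w))"
    using assms c by simp
  also have "(\<Prod>w\<in>set_mset A. fact (count (replicate_mset k v + A) w)) = orders A"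
    unfolding orders_def using assms by (intro prod.cong) auto
  finally show ?thesis .
qed simp

text \<open>
  The runs of value \<open>v\<close> form a composition of the multiplicity of \<open>v\<close>.
\<close>

lemma run_partitions_split:
  fixes v :: 'v
  assumes m: "1 \<le> m" and v: "v \<notin> set ss"
  shows "bij_betw (\<lambda>(ms, \<kappa>). map (Pair v) ms @ \<kappa>) (compositions m \<times> run_partitions ss) (run_partitions (replicate m v @ ss))"
proof -
  let ?e = "\<lambda>\<kappa>. concat (map (\<lambda>k. replicate (snd k) (fst k)) \<kappa>) :: 'v list"
  have eP: "?e (map (Pair v) ms) = replicate (sum_list ms) v" for ms
    by (induction ms) (simp_all add: replicate_add)
  have nv: "fst k \<noteq> v" if "\<kappa> \<in> run_partitions ss" "k \<in> set \<kappa>" for k \<kappa>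
  proof -
    have "0 < snd k" using that by (simp add: run_partitions_def)
    then have "fst k \<in> set (replicate (snd k) (fst k))" by simp
    then have "fst k \<in> set (?e \<kappa>)" unfolding set_concat set_map using that(2) by blast
    moreover have "?e \<kappa> = ss" using that(1) unfolding run_partitions_def by blast
    ultimately have "fst k \<in> set ss" by (simp only:)
    then show ?thesis using v by metis
  qed
  have tw: "takeWhile (\<lambda>k. fst k = v) (map (Pair v) ms @ \<kappa>) = map (Pair v) ms" if "\<kappa> \<in> run_partitions ss" for ms \<kappa>
  proof -
    have "takeWhile (\<lambda>k. fst k = v) \<kappa> = []" using nv[OF that] by (cases \<kappa>) auto
    moreover have "takeWhile (\<lambda>k. fst k = v) (map (Pair v) ms @ \<kappa>) = map (Pair v) ms @ takeWhile (\<lambda>k. fst k = v) \<kappa>"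
      by (rule takeWhile_append2) auto
    ultimately show ?thesis by (simp only: append_Nil2)
  qed
  show ?thesis
  proof (rule bij_betw_imageI)
    show "inj_on (\<lambda>(ms, \<kappa>). map (Pair v) ms @ \<kappa>) (compositions m \<times> run_partitions ss)"
    proof (rule inj_onI, clarify)
      fix ms \<kappa> ms' \<kappa>' assume k: "\<kappa> \<in> run_partitions ss" "\<kappa>' \<in> run_partitions ss" and eq: "map (Pair v) ms @ \<kappa> = map (Pair v) ms' @ \<kappa>'"
      have e: "map (Pair v) ms = map (Pair v) ms'" using arg_cong[OF eq, of "takeWhile (\<lambda>k. fst k = v)"] unfolding tw[OF k(1)] tw[OF k(2)] .
      have "map snd (map (Pair v) ms) = map snd (map (Pair v) ms')" unfolding e ..
      then have "ms = ms'" by (simp add: comp_def)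
      then show "ms = ms' \<and> \<kappa> = \<kappa>'" using eq by simp
    qed
    show "(\<lambda>(ms, \<kappa>). map (Pair v) ms @ \<kappa>) ` (compositions m \<times> run_partitions ss) = run_partitions (replicate m v @ ss)"
    proof (rule subset_antisym; rule subsetI)
      fix \<kappa> assume "\<kappa> \<in> (\<lambda>(ms, \<kappa>). map (Pair v) ms @ \<kappa>) ` (compositions m \<times> run_partitions ss)"
      then obtain ms \<kappa>' where k: "ms \<in> compositions m" "\<kappa>' \<in> run_partitions ss" "\<kappa> = map (Pair v) ms @ \<kappa>'" by auto
      then show "\<kappa> \<in> run_partitions (replicate m v @ ss)"
        using eP[of ms] by (auto simp: run_partitions_def compositions_def)
    next
      fix \<kappa> assume \<kappa>: "\<kappa> \<in> run_partitions (replicate m v @ ss)"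
      define \<kappa>1 where "\<kappa>1 = takeWhile (\<lambda>k. fst k = v) \<kappa>"
      define \<kappa>2 where "\<kappa>2 = dropWhile (\<lambda>k. fst k = v) \<kappa>"
      have k12: "\<kappa> = \<kappa>1 @ \<kappa>2" by (simp add: \<kappa>1_def \<kappa>2_def)
      have pos: "\<forall>k\<in>set \<kappa>1. 0 < snd k" "\<forall>k\<in>set \<kappa>2. 0 < snd k" and ee: "?e \<kappa>1 @ ?e \<kappa>2 = replicate m v @ ss"
        using \<kappa> by (auto simp: run_partitions_def k12)
      have k1: "\<kappa>1 = map (Pair v) (map snd \<kappa>1)"
      proof -
        have "\<forall>k\<in>set \<kappa>1. fst k = v" using set_takeWhileD[of _ "\<lambda>k. fst k = v" \<kappa>] unfolding \<kappa>1_def by fast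
        then show ?thesis by (induction \<kappa>1) (auto simp: prod_eq_iff)
      qed
      have e1: "?e \<kappa>1 = replicate (sum_list (map snd \<kappa>1)) v" using eP[of "map snd \<kappa>1"] k1 by metis
      have t2: "takeWhile (\<lambda>x. x = v) (?e \<kappa>2) = []"
      proof (cases \<kappa>2)
        case (Cons k ks)
        have "fst k \<noteq> v" using hd_dropWhile[of "\<lambda>k. fst k = v" \<kappa>] Cons unfolding \<kappa>2_def by (metis list.distinct(1) list.sel(1))
        moreover have "0 < snd k" using pos(2) Cons by simp
        ultimately show ?thesis by (cases "snd k") (simp_all add: Cons)
      qed simp
      have t3: "takeWhile (\<lambda>x. x = v) ss = []" using v by (cases ss) auto
      have "takeWhile (\<lambda>x. x = v) (?e \<kappa>1 @ ?e \<kappa>2) = ?e \<kappa>1" unfolding e1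
        by (subst takeWhile_append2) (simp_all only: t2 append_Nil2 set_replicate_conv_if split: if_splits, auto)
      moreover have "takeWhile (\<lambda>x. x = v) (replicate m v @ ss) = replicate m v" 
        by (subst takeWhile_append2) (simp_all only: t3 append_Nil2 set_replicate_conv_if split: if_splits, auto)
      ultimately have a: "?e \<kappa>1 = replicate m v" using ee by simp
      then have b: "?e \<kappa>2 = ss" using ee by simp
      have "sum_list (map snd \<kappa>1) = m" using a e1 by (metis length_replicate)
      then have "map snd \<kappa>1 \<in> compositions m" using pos(1) by (auto simp: compositions_def)
      moreover have "\<kappa>2 \<in> run_partitions ss" using b pos(2) by (simp add: run_partitions_def)
      ultimately show "\<kappa> \<in> (\<lambda>(ms, \<kappa>). map (Pair v) ms @ \<kappa>) ` (compositions m \<times> run_partitions ss)"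
        using k12 k1 by (intro image_eqI[of _ _ "(map snd \<kappa>1, \<kappa>2)"]) simp_all
    qed
  qed
qed

text \<open>
  The weight is multiplicative over the values of \<open>ss\<close>, and for a single value of multiplicity \<open>m\<close> the
  sum is the one of \<open>sum_compositions_inverse\<close>.
\<close>

lemma sum_run_weight:
  fixes ss :: "'v :: linorder list"
  shows "sorted_wrt (\<ge>) ss \<Longrightarrow> (\<Sum>\<kappa>\<in>run_partitions ss. run_weight \<kappa>) = 1"
proof (induction "length ss" arbitrary: ss rule: less_induct)
  case less
  show ?case
  proof (cases ss)
    case Nil
    then show ?thesis by (simp add: run_partitions_Nil run_weight_def orders_def)
  next
    case (Cons v ss0)
    define m where "m = length (takeWhile (\<lambda>x. x = v) ss)"
    define ss' where "ss' = dropWhile (\<lambda>x. x = v) ss"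
    have tr: "takeWhile (\<lambda>x. x = v) ss = replicate m v"
      unfolding m_def by (rule replicate_eqI) (auto dest: set_takeWhileD)
    have ss: "ss = replicate m v @ ss'" using takeWhile_dropWhile_id[of "\<lambda>x. x = v" ss] unfolding tr ss'_def by simp
    have m: "1 \<le> m" by (simp add: m_def Cons)
    have sorted': "sorted_wrt (\<ge>) ss'" using less.prems ss by (simp add: sorted_wrt_append)
    have v: "v \<notin> set ss'"
    proof
      assume a: "v \<in> set ss'"
      then obtain h t where ht: "ss' = h # t" by (cases ss') auto
      have "h \<noteq> v" using hd_dropWhile[of "\<lambda>x. x = v" ss] ht unfolding ss'_def by (metis list.distinct(1) list.sel(1))
      moreover have "v \<le> h" using a sorted' ht by auto
      moreover have "h \<in> set ss" by (subst ss) (simp add: ht)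
      then have "h \<le> v" using less.prems Cons by auto
      ultimately show False by simp
    qed
    have IH: "(\<Sum>\<kappa>\<in>run_partitions ss'. run_weight \<kappa>) = 1"
      using less.hyps[of ss'] sorted' m by (simp add: ss)
    have wt: "run_weight (map (Pair v) ms @ \<kappa>) = 1 / (fact (length ms) * real (prod_list ms)) * run_weight \<kappa>"
      if "\<kappa> \<in> run_partitions ss'" for ms \<kappa>
    proof -
      have "v \<notin># mset (map fst \<kappa>)"
      proof
        assume "v \<in># mset (map fst \<kappa>)"
        then obtain k where k: "k \<in> set \<kappa>" "fst k = v" by auto
        have "0 < snd k" using that k(1) by (simp add: run_partitions_def)
        then have "v \<in> set (replicate (snd k) (fst k))" using k(2) by simp
        then have "v \<in> set (concat (map (\<lambda>k. replicate (snd k) (fst k)) \<kappa>))"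
          unfolding set_concat set_map using k(1) by blast
        moreover have "concat (map (\<lambda>k. replicate (snd k) (fst k)) \<kappa>) = ss'"
          using that unfolding run_partitions_def by blast
        ultimately have "v \<in> set ss'" by (simp only:)
        then show False using v by contradiction
      qed
      moreover have "mset (map fst (map (Pair v) ms @ \<kappa>)) = replicate_mset (length ms) v + mset (map fst \<kappa>)"
        by (simp add: comp_def map_replicate_const)
      ultimately have "orders (mset (map fst (map (Pair v) ms @ \<kappa>))) = fact (length ms) * orders (mset (map fst \<kappa>))"
        using orders_replicate by metis
      then show ?thesis by (simp add: run_weight_def comp_def)
    qed
    have "(\<Sum>\<kappa>\<in>run_partitions ss. run_weight \<kappa>) =
        (\<Sum>x\<in>compositions m \<times> run_partitions ss'. run_weight (case x of (ms, \<kappa>) \<Rightarrow> map (Pair v) ms @ \<kappa>))"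
      unfolding ss by (rule sum.reindex_bij_betw[OF run_partitions_split[OF m v], symmetric])
    also have "\<dots> = (\<Sum>x\<in>compositions m \<times> run_partitions ss'. (1 / (fact (length (fst x)) * real (prod_list (fst x)))) * run_weight (snd x))"
      using wt by (intro sum.cong refl) auto
    also have "\<dots> = (\<Sum>ms\<in>compositions m. 1 / (fact (length ms) * real (prod_list ms))) * (\<Sum>\<kappa>\<in>run_partitions ss'. run_weight \<kappa>)"
      by (simp add: sum_product sum.cartesian_product case_prod_beta)
    also have "\<dots> = 1" using IH sum_compositions_inverse[of m] by simp
    finally show ?thesis .
  qed
qed

theorem sum_good_compositions:
  "(\<Sum>ns\<in>good_compositions xs. 1 / real (good_arrangements (split_blocks ns xs))) = 1"
proof -
  have "1 / real (good_arrangements (split_blocks ns xs)) = run_weight (block_keys ns xs)" for ns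
    by (simp add: run_weight_def block_keys_def good_arrangements_def comp_def)
  then show ?thesis
    using sum.reindex_bij_betw[OF block_keys_bij, of run_weight xs] sum_run_weight[OF sorted_slopes, of xs] by simp
qed

section \<open>Concave majorants of polygons\<close>

declare upt_Suc [simp del]

definition edge_line :: "real list \<Rightarrow> nat \<Rightarrow> real \<Rightarrow> real" where
  "edge_line ys k t = sum_list (take k ys) + ys ! k * (t - real k)"

text \<open>
  The polygon with increments \<open>ys\<close>. If these are non-increasing, it is the minimum of the lines through
  its edges, and as such it is concave.
\<close>

definition polygon :: "real list \<Rightarrow> real \<Rightarrow> real" where
  "polygon ys = (\<lambda>t\<in>{0..real (length ys)}. Min ((\<lambda>k. edge_line ys k t) ` {..<length ys}))"

lemma sum_list_take_Suc: "k < length ys \<Longrightarrow> sum_list (take (Suc k) ys) = sum_list (take k ys) + (ys ! k :: real)"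
  by (simp add: take_Suc_conv_app_nth)

lemma sum_take_le_edge_line:
  assumes sorted: "sorted_wrt (\<ge>) ys" and k: "k < length ys" and j: "j \<le> length ys"
  shows "sum_list (take j ys) \<le> edge_line ys k (real j)"
proof -
  have mono: "ys ! b \<le> ys ! a" if "a \<le> b" "b < length ys" for a b
    using sorted that by (cases "a = b") (simp_all add: sorted_wrt_iff_nth_less)
  show ?thesis
  proof (cases "k \<le> j")
    case True
    then show ?thesis using j
    proof (induction rule: dec_induct)
      case base
      show ?case by (simp add: edge_line_def)
    next
      case (step i)
      have "sum_list (take (Suc i) ys) = sum_list (take i ys) + ys ! i" using step by (simp add: sum_list_take_Suc)
      also have "\<dots> \<le> edge_line ys k (real i) + ys ! k" using step mono[of k i] by simp
      also have "\<dots> = edge_line ys k (real (Suc i))" by (simp add: edge_line_def algebra_simps)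
      finally show ?case .
    qed
  next
    case False
    then have "j \<le> k" by simp
    then show ?thesis
    proof (induction rule: inc_induct)
      case base
      show ?case by (simp add: edge_line_def)
    next
      case (step i)
      have "sum_list (take i ys) = sum_list (take (Suc i) ys) - ys ! i" using step k by (simp add: sum_list_take_Suc)
      also have "\<dots> \<le> edge_line ys k (real (Suc i)) - ys ! k" using step mono[of i k] k by simp
      also have "\<dots> = edge_line ys k (real i)" by (simp add: edge_line_def algebra_simps)
      finally show ?case .
    qed
  qed
qed

lemma polygon_le: "t \<in> {0..real (length ys)} \<Longrightarrow> k < length ys \<Longrightarrow> polygon ys t \<le> edge_line ys k t"
  unfolding polygon_def by (simp add: Min_le)

lemma polygon_ge:
  "ys \<noteq> [] \<Longrightarrow> t \<in> {0..real (length ys)} \<Longrightarrow> (\<And>k. k < length ys \<Longrightarrow> a \<le> edge_line ys k t) \<Longrightarrow> a \<le> polygon ys t"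
  unfolding polygon_def by (simp add: lessThan_empty_iff)

lemma polygon_nat:
  assumes "sorted_wrt (\<ge>) ys" "ys \<noteq> []" "j \<le> length ys"
  shows "polygon ys (real j) = sum_list (take j ys)"
proof (rule antisym)
  have t: "real j \<in> {0..real (length ys)}" using assms(3) by simp
  show "sum_list (take j ys) \<le> polygon ys (real j)"
    using sum_take_le_edge_line[OF assms(1) _ assms(3)] by (intro polygon_ge[OF assms(2) t]) blast
  show "polygon ys (real j) \<le> sum_list (take j ys)"
  proof (cases "j < length ys")
    case True
    then show ?thesis using polygon_le[OF t True] by (simp add: edge_line_def)
  next
    case False
    then have j: "j = length ys" using assms(3) by simp
    define k where "k = length ys - 1"
    have k: "k < length ys" "length ys = Suc k" using assms(2) by (simp_all add: k_def)
    have "edge_line ys k (real j) = sum_list (take (Suc k) ys)"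
      unfolding sum_list_take_Suc[OF k(1)] edge_line_def j k(2) by simp
    then show ?thesis using polygon_le[OF t k(1)] j k(2) by simp
  qed
qed

lemma polygon_concave:
  assumes "ys \<noteq> []"
  shows "concave_on {0..real (length ys)} (polygon ys)"
  unfolding concave_on_iff
proof (intro conjI ballI allI impI)
  show "convex {0..real (length ys)}" by simp
  fix x y u v :: real
  assume x: "x \<in> {0..real (length ys)}" and y: "y \<in> {0..real (length ys)}" and uv: "0 \<le> u" "0 \<le> v" "u + v = 1"
  have c: "u *\<^sub>R x + v *\<^sub>R y \<in> {0..real (length ys)}"
    using convexD[OF convex_real_interval(5), OF x y uv] .
  show "u * polygon ys x + v * polygon ys y \<le> polygon ys (u *\<^sub>R x + v *\<^sub>R y)"
  proof (rule polygon_ge[OF assms c])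
    fix k assume k: "k < length ys"
    have "u * polygon ys x + v * polygon ys y \<le> u * edge_line ys k x + v * edge_line ys k y"
      using polygon_le[OF x k] polygon_le[OF y k] uv by (intro add_mono mult_left_mono)
    also have "\<dots> = (u + v) * (sum_list (take k ys) - ys ! k * real k) + ys ! k * (u * x + v * y)"
      by (simp add: edge_line_def algebra_simps)
    also have "\<dots> = edge_line ys k (u *\<^sub>R x + v *\<^sub>R y)"
      unfolding uv(3) by (simp add: edge_line_def algebra_simps)
    finally show "u * polygon ys x + v * polygon ys y \<le> edge_line ys k (u *\<^sub>R x + v *\<^sub>R y)" .
  qed
qed

lemma polygon_least:
  assumes "ys \<noteq> []" and c: "concave_on {0..real (length ys)} c"
    and above: "\<And>j. j \<le> length ys \<Longrightarrow> sum_list (take j ys) \<le> c (real j)"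
    and t: "t \<in> {0..real (length ys)}"
  shows "polygon ys t \<le> c t"
proof -
  obtain k where k: "k < length ys" "real k \<le> t" "t \<le> real k + 1"
  proof (cases "t = real (length ys)")
    case True
    then show ?thesis using that[of "length ys - 1"] assms(1) by (simp add: of_nat_diff Suc_le_eq)
  next
    case False
    have f: "0 \<le> \<lfloor>t\<rfloor>" "real_of_int \<lfloor>t\<rfloor> \<le> t" "t < real_of_int \<lfloor>t\<rfloor> + 1" using t by simp_all
    then have "real (nat \<lfloor>t\<rfloor>) = real_of_int \<lfloor>t\<rfloor>" by simp
    moreover from this have "nat \<lfloor>t\<rfloor> < length ys"
      using f t False by (metis atLeastAtMost_iff of_nat_less_iff order_le_less_trans order_less_le)
    ultimately show ?thesis using that[of "nat \<lfloor>t\<rfloor>"] f by simp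
  qed
  define l where "l = t - real k"
  have l: "0 \<le> l" "l \<le> 1" using k by (simp_all add: l_def)
  have "polygon ys t \<le> edge_line ys k t" by (rule polygon_le[OF t k(1)])
  also have "\<dots> = (1 - l) * sum_list (take k ys) + l * sum_list (take (Suc k) ys)"
    unfolding sum_list_take_Suc[OF k(1)] edge_line_def l_def by (simp add: algebra_simps)
  also have "\<dots> \<le> (1 - l) * c (real k) + l * c (real (Suc k))"
    using l above[of k] above[of "Suc k"] k(1) by (intro add_mono mult_left_mono) simp_all
  also have "\<dots> \<le> c ((1 - l) *\<^sub>R real k + l *\<^sub>R real (Suc k))"
    using l k(1) by (intro concave_onD[OF c]) simp_all
  also have "(1 - l) *\<^sub>R real k + l *\<^sub>R real (Suc k) = t" by (simp add: l_def algebra_simps)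
  finally show ?thesis .
qed

text \<open>
  It suffices that the walk lies below the vertices of the polygon, and that every concave function above
  the walk lies above these vertices.
\<close>

lemma concave_majorant_eq_polygon:
  assumes "sorted_wrt (\<ge>) ys" "ys \<noteq> []" "length ys = n"
    and below: "\<And>j. j \<le> n \<Longrightarrow> s j \<le> sum_list (take j ys)"
    and tight: "\<And>c j. concave_on {0..real n} c \<Longrightarrow> (\<And>j. j \<le> n \<Longrightarrow> s j \<le> c (real j)) \<Longrightarrow> j \<le> n \<Longrightarrow>
      sum_list (take j ys) \<le> c (real j)"
  shows "concave_majorant n s = polygon ys"
  unfolding concave_majorant_def
proof (rule Least_equality)
  have n: "real n = real (length ys)" using assms(3) by simp
  show "polygon ys \<in> extensional {0..real n} \<and> concave_on {0..real n} (polygon ys) \<and> (\<forall>j\<le>n. s j \<le> polygon ys (real j))"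
  proof (intro conjI allI impI)
    show "polygon ys \<in> extensional {0..real n}" unfolding n polygon_def by simp
    show "concave_on {0..real n} (polygon ys)" unfolding n by (rule polygon_concave[OF assms(2)])
    show "s j \<le> polygon ys (real j)" if "j \<le> n" for j
      using below[OF that] polygon_nat[OF assms(1,2), of j] that assms(3) by simp
  qed
  fix c assume c: "c \<in> extensional {0..real n} \<and> concave_on {0..real n} c \<and> (\<forall>j\<le>n. s j \<le> c (real j))"
  show "polygon ys \<le> c"
  proof (rule le_funI)
    fix t
    show "polygon ys t \<le> c t"
    proof (cases "t \<in> {0..real n}")
      case True
      then show ?thesis
        using c tight[of c] assms(3) by (intro polygon_least[OF assms(2)]) simp_all
    next
      case False
      then have "c t = undefined" "polygon ys t = undefined"
        using c unfolding polygon_def n by (auto simp: extensional_def)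
      then show ?thesis by simp
    qed
  qed
qed

lemma sorted_levelled:
  assumes "sorted_wrt (\<ge>) (map mean bs)"
  shows "sorted_wrt (\<ge>) (levelled bs)"
  using assms
proof (induction bs)
  case (Cons b bs)
  have "set (levelled bs) \<subseteq> set (map mean bs)" by (auto simp: levelled_def)
  then have "\<forall>y\<in>set (levelled bs). y \<le> mean b" using Cons.prems by auto
  moreover have "sorted_wrt (\<ge>) (replicate (length b) (mean b))" by (simp add: sorted_wrt_iff_nth_less)
  ultimately show ?case using Cons by (simp add: levelled_Cons sorted_wrt_append)
qed (simp add: levelled_def)

lemma concave_majorant_levelled:
  assumes "sorted_wrt (\<ge>) (map mean bs)" "length (concat bs) = n" "n \<ge> 1"
    and s: "\<And>j. j \<le> n \<Longrightarrow> s j = sum_list (take j (levelled bs))"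
  shows "concave_majorant n s = polygon (levelled bs)"
proof (rule concave_majorant_eq_polygon[OF sorted_levelled[OF assms(1)]])
  have "length (levelled bs) = n" using assms(2) by simp
  then show "length (levelled bs) = n" "levelled bs \<noteq> []" using assms(3) by (metis list.size(3) not_one_le_zero)+
  show "s j \<le> sum_list (take j (levelled bs))" if "j \<le> n" for j using s[OF that] by simp
  show "sum_list (take j (levelled bs)) \<le> c (real j)" if "\<And>j. j \<le> n \<Longrightarrow> s j \<le> c (real j)" "j \<le> n" for c j
    using that(1)[OF that(2)] s[OF that(2)] by simp
qed

lemma concave_majorant_good:
  assumes "good bs" "length (concat bs) = n" "n \<ge> 1"
    and s: "\<And>j. j \<le> n \<Longrightarrow> s j = sum_list (take j (concat bs))"
  shows "concave_majorant n s = polygon (levelled bs)"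
proof (rule concave_majorant_eq_polygon)
  have g: "sorted_wrt (\<ge>) (map mean bs)" "\<forall>b\<in>set bs. good_block b" using assms(1) by (auto simp: good_def)
  show "sorted_wrt (\<ge>) (levelled bs)" by (rule sorted_levelled[OF g(1)])
  have "length (levelled bs) = n" using assms(2) by simp
  then show "length (levelled bs) = n" "levelled bs \<noteq> []" using assms(3) by (metis list.size(3) not_one_le_zero)+
  show "s j \<le> sum_list (take j (levelled bs))" if "j \<le> n" for j
    using concat_below_levelled_iff[of bs] g(2) that s[OF that] assms(2) by simp
  show "sum_list (take j (levelled bs)) \<le> c (real j)"
    if "concave_on {0..real n} c" "\<And>j. j \<le> n \<Longrightarrow> s j \<le> c (real j)" "j \<le> n" for c j
    using concave_above_levelled[of 0 bs c 0 j] that s assms(2) by simp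
qed

section \<open>Walks and their values at block ends\<close>

abbreviation steps :: "nat \<Rightarrow> (nat \<Rightarrow> real) \<Rightarrow> real list" where
  "steps n x \<equiv> map x [1..<Suc n]"

abbreviation blocks :: "nat list \<Rightarrow> (nat \<Rightarrow> real) \<Rightarrow> real list list" where
  "blocks ns x \<equiv> split_blocks ns (steps (sum_list ns) x)"

lemma walk_steps: "j \<le> n \<Longrightarrow> walk n x j = sum_list (take j (steps n x))"
proof -
  assume j: "j \<le> n"
  have "take j (steps n x) = map x [1..<Suc j]" using j by (simp add: take_map)
  moreover have "sum_list (map x [1..<Suc j]) = sum x {1..j}"
    unfolding interv_sum_list_conv_sum_set_nat set_upt atLeastLessThanSuc_atLeastAtMost ..
  ultimately show ?thesis using j by (simp add: walk_def)
qed

lemma blocks_map: "blocks ns x = map (map x) (split_blocks ns [1..<Suc (sum_list ns)])"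
  by (rule split_blocks_map)

lemma concat_blocks: "concat (blocks ns x) = steps (sum_list ns) x"
  by (simp add: concat_split_blocks)

lemma length_blocks: "map length (blocks ns x) = ns"
  by (simp add: map_length_split_blocks)

lemma sum_take_prefix: "m \<le> length bs \<Longrightarrow>
  sum_list (take (sum_list (map length (take m bs))) (concat bs)) = sum_list (map sum_list (take m bs)) \<and>
  sum_list (take (sum_list (map length (take m bs))) (levelled bs)) = (sum_list (map sum_list (take m bs)) :: real)"
proof (induction bs arbitrary: m)
  case (Cons b bs)
  show ?case
  proof (cases m)
    case (Suc l)
    then show ?thesis using Cons.IH[of l] Cons.prems
      by (simp only: take_Suc_Cons list.map sum_list.Cons take_levelled_Cons take_concat_Cons length_Cons)
  qed simp
qed simp

text \<open>
  The means of the blocks, recovered from the values at the block ends. The walk starts at \<open>0\<close>, and this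
  value is not part of \<open>e\<close>.
\<close>

definition end_slopes :: "nat list \<Rightarrow> (nat \<Rightarrow> real) \<Rightarrow> real list" where
  "end_slopes ns e = map (\<lambda>i. (e (Suc i) - (if i = 0 then 0 else e i)) / real (ns ! i)) [0..<length ns]"

lemma block_ends_walk:
  assumes "m \<in> {1..length ns}"
  shows "block_ends ns (walk (sum_list ns) x) m = sum_list (map sum_list (take m (blocks ns x)))"
proof -
  have m: "m \<le> length (blocks ns x)" using assms by simp
  have l: "sum_list (map length (take m (blocks ns x))) = sum_list (take m ns)"
    unfolding take_map[symmetric] length_blocks ..
  have "sum_list (take m ns) + sum_list (drop m ns) = sum_list (take m ns @ drop m ns)" by (rule sum_list_append[symmetric])
  then have le: "sum_list (take m ns) \<le> sum_list ns" by simp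
  show ?thesis
    using sum_take_prefix[OF m] assms unfolding l concat_blocks
    by (simp add: block_ends_def walk_steps[OF le])
qed

lemma end_slopes_walk: "end_slopes ns (block_ends ns (walk (sum_list ns) x)) = map mean (blocks ns x)"
proof (rule nth_equalityI)
  fix i assume "i < length (end_slopes ns (block_ends ns (walk (sum_list ns) x)))"
  then have i: "i < length ns" by (simp add: end_slopes_def)
  let ?e = "block_ends ns (walk (sum_list ns) x)"
  have e: "?e (Suc i) - (if i = 0 then 0 else ?e i) = sum_list (blocks ns x ! i)"
    using block_ends_walk[of "Suc i" ns x] block_ends_walk[of i ns x] i
    by (simp add: take_Suc_conv_app_nth)
  have "length (blocks ns x ! i) = map length (blocks ns x) ! i" using i by simp
  also have "\<dots> = ns ! i" unfolding length_blocks ..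
  finally have "length (blocks ns x ! i) = ns ! i" .
  then show "end_slopes ns ?e ! i = map mean (blocks ns x) ! i"
  proof -
    have "end_slopes ns ?e ! i = (?e (Suc i) - (if i = 0 then 0 else ?e i)) / real (ns ! i)"
      using i by (simp add: end_slopes_def)
    then show ?thesis unfolding e using i \<open>length (blocks ns x ! i) = ns ! i\<close> by (simp add: mean_def)
  qed
qed (simp add: end_slopes_def)

definition levelled_steps :: "nat list \<Rightarrow> (nat \<Rightarrow> real) \<Rightarrow> real list" where
  "levelled_steps ns e = concat (map2 replicate ns (end_slopes ns e))"

lemma levelled_steps_walk: "levelled_steps ns (block_ends ns (walk (sum_list ns) x)) = levelled (blocks ns x)"
proof -
  have "concat (map2 replicate (map length bs) (map mean bs)) = levelled bs" for bs
    by (induction bs) (simp_all add: levelled_def)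
  from this[of "blocks ns x"] show ?thesis unfolding levelled_steps_def end_slopes_walk length_blocks .
qed

text \<open>
  The concave majorant as a function of the values at the block ends. It is the polygon through these
  values if the slopes are non-increasing; the detour over \<open>concave_majorant\<close> makes it a measurable
  function into the concave functions for all arguments.
\<close>

definition end_majorant :: "nat list \<Rightarrow> (nat \<Rightarrow> real) \<Rightarrow> real \<Rightarrow> real" where
  "end_majorant ns e = concave_majorant (sum_list ns) (walk (sum_list ns) (\<lambda>i\<in>{1..sum_list ns}. levelled_steps ns e ! (i - 1)))"

lemma steps_of_list: "length l = n \<Longrightarrow> steps n (\<lambda>i\<in>{1..n}. l ! (i - 1)) = l"
  by (rule nth_equalityI) (simp_all)

lemma end_majorant_walk:
  assumes "sorted_wrt (\<ge>) (map mean (blocks ns x))" "sum_list ns \<ge> 1"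
  shows "end_majorant ns (block_ends ns (walk (sum_list ns) x)) = polygon (levelled (blocks ns x))"
  unfolding end_majorant_def levelled_steps_walk
proof (rule concave_majorant_levelled[OF assms(1) _ assms(2)])
  show l: "length (concat (blocks ns x)) = sum_list ns" unfolding concat_blocks by simp
  fix j assume "j \<le> sum_list ns"
  moreover have "length (levelled (blocks ns x)) = sum_list ns" unfolding length_levelled by (rule l)
  ultimately show "walk (sum_list ns) (\<lambda>i\<in>{1..sum_list ns}. levelled (blocks ns x) ! (i - 1)) j = sum_list (take j (levelled (blocks ns x)))"
    by (simp only: walk_steps steps_of_list)
qed

lemma concave_majorant_walk:
  assumes "good (blocks ns x)" "sum_list ns \<ge> 1"
  shows "concave_majorant (sum_list ns) (walk (sum_list ns) x) = polygon (levelled (blocks ns x))"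
proof (rule concave_majorant_good[OF assms(1) _ assms(2)])
  show "length (concat (blocks ns x)) = sum_list ns" unfolding concat_blocks by simp
  show "walk (sum_list ns) x j = sum_list (take j (concat (blocks ns x)))" if "j \<le> sum_list ns" for j
    unfolding concat_blocks by (rule walk_steps[OF that])
qed

lemma polygon_levelled_nat:
  assumes "sorted_wrt (\<ge>) (map mean (blocks ns x))" "sum_list ns \<ge> 1" "j \<le> sum_list ns"
  shows "polygon (levelled (blocks ns x)) (real j) = sum_list (take j (levelled (blocks ns x)))"
proof (rule polygon_nat[OF sorted_levelled[OF assms(1)]])
  have l: "length (levelled (blocks ns x)) = sum_list ns" unfolding length_levelled concat_blocks by simp
  show "levelled (blocks ns x) \<noteq> []" using l assms(2) by (metis list.size(3) not_one_le_zero)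
  show "j \<le> length (levelled (blocks ns x))" using l assms(3) by simp
qed

lemma block_ends_polygon:
  assumes "sorted_wrt (\<ge>) (map mean (blocks ns x))" "sum_list ns \<ge> 1"
  shows "block_ends ns (\<lambda>j. polygon (levelled (blocks ns x)) (real j)) = block_ends ns (walk (sum_list ns) x)"
proof (rule ext)
  fix m
  show "block_ends ns (\<lambda>j. polygon (levelled (blocks ns x)) (real j)) m = block_ends ns (walk (sum_list ns) x) m"
  proof (cases "m \<in> {1..length ns}")
    case True
    have m: "m \<le> length (blocks ns x)" using True by simp
    have l: "sum_list (map length (take m (blocks ns x))) = sum_list (take m ns)"
      unfolding take_map[symmetric] length_blocks ..
    have "sum_list (take m ns) + sum_list (drop m ns) = sum_list (take m ns @ drop m ns)" by (rule sum_list_append[symmetric])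
    then have le: "sum_list (take m ns) \<le> sum_list ns" by simp
    have "block_ends ns (\<lambda>j. polygon (levelled (blocks ns x)) (real j)) m = polygon (levelled (blocks ns x)) (real (sum_list (take m ns)))"
      using True by (simp add: block_ends_def)
    also have "\<dots> = sum_list (map sum_list (take m (blocks ns x)))"
      unfolding polygon_levelled_nat[OF assms le] using sum_take_prefix[OF m] unfolding l by blast
    finally show ?thesis unfolding block_ends_walk[OF True] .
  next
    case False
    then show ?thesis by (auto simp: block_ends_def)
  qed
qed

section \<open>Integration along a regular conditional distribution\<close>

lemma regular_cond_distrD:
  assumes "regular_cond_distr M Z N W T D \<kappa>"
  shows "Z \<in> M \<rightarrow>\<^sub>M N" "W \<in> M \<rightarrow>\<^sub>M T" "D \<in> sets T" "\<kappa> \<in> restrict_space T D \<rightarrow>\<^sub>M prob_algebra N"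
  using assms by (simp_all add: regular_cond_distr_def)

text \<open>
  The conditional distribution has mass \<open>1\<close> at each point of \<open>D\<close>, so the defining equation for the
  whole spaces gives mass \<open>1\<close> to \<open>D\<close>.
\<close>

lemma regular_cond_distr_AE:
  assumes "prob_space M" "regular_cond_distr M Z N W T D \<kappa>"
  shows "AE w in distr M T W. w \<in> D"
proof -
  interpret prob_space M by fact
  have Z: "Z \<in> M \<rightarrow>\<^sub>M N" and W: "W \<in> M \<rightarrow>\<^sub>M T" and D: "D \<in> sets T"
    and k: "\<kappa> \<in> restrict_space T D \<rightarrow>\<^sub>M prob_algebra N"
    and r: "\<And>A B. A \<in> sets N \<Longrightarrow> B \<in> sets T \<Longrightarrow>
      emeasure M {\<omega>\<in>space M. Z \<omega> \<in> A \<and> W \<omega> \<in> B} = (\<integral>\<^sup>+ w\<in>B \<inter> D. emeasure (\<kappa> w) A \<partial>distr M T W)"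
    using assms(2) by (auto simp: regular_cond_distr_def)
  interpret PW: prob_space "distr M T W" by (rule prob_space_distr[OF W])
  have "emeasure (\<kappa> w) (space N) = 1" if "w \<in> D" for w
  proof -
    have "w \<in> space (restrict_space T D)" using that D sets.sets_into_space[OF D] by (auto simp: space_restrict_space)
    then have "\<kappa> w \<in> space (prob_algebra N)" by (rule measurable_space[OF k])
    then have "prob_space (\<kappa> w)" "sets (\<kappa> w) = sets N" by (auto simp: space_prob_algebra)
    then show ?thesis using prob_space.emeasure_space_1 sets_eq_imp_space_eq by metis
  qed
  then have "(\<integral>\<^sup>+ w\<in>space T \<inter> D. emeasure (\<kappa> w) (space N) \<partial>distr M T W) = (\<integral>\<^sup>+ w. indicator D w \<partial>distr M T W)"
    by (intro nn_integral_cong) (auto split: split_indicator)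
  also have "\<dots> = emeasure (distr M T W) D" using D by simp
  finally have "emeasure (distr M T W) D = emeasure M {\<omega>\<in>space M. Z \<omega> \<in> space N \<and> W \<omega> \<in> space T}"
    using r[of "space N" "space T"] by simp
  also have "{\<omega>\<in>space M. Z \<omega> \<in> space N \<and> W \<omega> \<in> space T} = space M"
    using measurable_space[OF Z] measurable_space[OF W] by blast
  finally have "emeasure (distr M T W) D = 1" by (simp add: emeasure_space_1)
  then show ?thesis
    using PW.AE_in_set_eq_1[of D] D by (simp add: PW.emeasure_eq_measure)
qed

text \<open>
  The defining equation determines the joint law of \<open>W\<close> and \<open>Z\<close> on rectangles, hence everywhere.
\<close>

lemma regular_cond_distr_nn_integral:
  assumes "prob_space M" and rcd: "regular_cond_distr M Z N W T D \<kappa>"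
    and F[measurable]: "F \<in> borel_measurable (T \<Otimes>\<^sub>M N)"
  shows "(\<integral>\<^sup>+ \<omega>. F (W \<omega>, Z \<omega>) \<partial>M) = (\<integral>\<^sup>+ w\<in>D. (\<integral>\<^sup>+ z. F (w, z) \<partial>\<kappa> w) \<partial>distr M T W)"
proof -
  interpret prob_space M by fact
  have Z[measurable]: "Z \<in> M \<rightarrow>\<^sub>M N" and W[measurable]: "W \<in> M \<rightarrow>\<^sub>M T" and D[measurable]: "D \<in> sets T"
    and k: "\<kappa> \<in> restrict_space T D \<rightarrow>\<^sub>M prob_algebra N"
    and r: "\<And>A B. A \<in> sets N \<Longrightarrow> B \<in> sets T \<Longrightarrow>
      emeasure M {\<omega>\<in>space M. Z \<omega> \<in> A \<and> W \<omega> \<in> B} = (\<integral>\<^sup>+ w\<in>B \<inter> D. emeasure (\<kappa> w) A \<partial>distr M T W)"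
    using rcd by (auto simp: regular_cond_distr_def)
  let ?L = "distr M T W"
  interpret PW: prob_space ?L by (rule prob_space_distr[OF W])
  have AED: "AE w in ?L. w \<in> D" by (rule regular_cond_distr_AE[OF assms(1) rcd])
  have "D \<noteq> {}"
  proof
    assume "D = {}"
    then have "AE w in ?L. False" using AED by simp
    then show False using PW.AE_False by simp
  qed
  then obtain d where d: "d \<in> D" by blast
  have inD: "w \<in> space (restrict_space T D)" if "w \<in> D" for w
    using that sets.sets_into_space[OF D] by (auto simp: space_restrict_space)
  \<comment> \<open>A kernel on all of \<open>T\<close>: constant outside \<open>D\<close>, which is a null set.\<close>
  define \<kappa>0 where "\<kappa>0 w = (if w \<in> D then \<kappa> w else \<kappa> d)" for w
  have k0[measurable]: "\<kappa>0 \<in> T \<rightarrow>\<^sub>M prob_algebra N"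
    unfolding \<kappa>0_def
  proof (subst measurable_If_restrict_space_iff)
    show "{x \<in> space T. x \<in> D} \<in> sets T" by simp
    have "{x. x \<in> D} = D" by simp
    then show "\<kappa> \<in> restrict_space T {x. x \<in> D} \<rightarrow>\<^sub>M prob_algebra N \<and>
        (\<lambda>w. \<kappa> d) \<in> restrict_space T {x. x \<notin> D} \<rightarrow>\<^sub>M prob_algebra N"
      using k measurable_space[OF k inD[OF d]] by simp
  qed
  define K where "K w = distr (\<kappa>0 w) (T \<Otimes>\<^sub>M N) (Pair w)" for w
  have K[measurable]: "K \<in> T \<rightarrow>\<^sub>M prob_algebra (T \<Otimes>\<^sub>M N)"
    unfolding K_def by measurable
  have K': "K \<in> ?L \<rightarrow>\<^sub>M prob_algebra (T \<Otimes>\<^sub>M N)" using K by simp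
  have K'': "K \<in> ?L \<rightarrow>\<^sub>M subprob_algebra (T \<Otimes>\<^sub>M N)" by (rule measurable_prob_algebraD[OF K'])
  have Lne: "space ?L \<noteq> {}" by (rule PW.not_empty)
  have sk: "sets (\<kappa>0 w) = sets N" if "w \<in> space T" for w
    using measurable_space[OF k0 that] by (simp add: space_prob_algebra)
  define B where "B = ?L \<bind> K"
  have setsB: "sets B = sets (T \<Otimes>\<^sub>M N)"
    unfolding B_def by (rule sets_bind[OF _ Lne]) (use measurable_space[OF K] in \<open>simp add: space_prob_algebra\<close>)
  have eq: "distr M (T \<Otimes>\<^sub>M N) (\<lambda>\<omega>. (W \<omega>, Z \<omega>)) = B"
  proof (rule measure_eqI_generator_eq[OF Int_stable_pair_measure_generator[of T N]])
    let ?E = "{a \<times> b |a b. a \<in> sets T \<and> b \<in> sets N}"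
    show "?E \<subseteq> Pow (space T \<times> space N)" by (rule pair_measure_closed)
    show "sets (distr M (T \<Otimes>\<^sub>M N) (\<lambda>\<omega>. (W \<omega>, Z \<omega>))) = sigma_sets (space T \<times> space N) ?E"
      by (simp add: sets_pair_measure)
    show "sets B = sigma_sets (space T \<times> space N) ?E" by (simp add: setsB sets_pair_measure)
    show "range (\<lambda>i::nat. space T \<times> space N) \<subseteq> ?E" by blast
    show "(\<Union>i::nat. space T \<times> space N) = space T \<times> space N" by simp
    have "emeasure (distr M (T \<Otimes>\<^sub>M N) (\<lambda>\<omega>. (W \<omega>, Z \<omega>))) (space T \<times> space N) \<le> 1"
      by (rule prob_space.emeasure_le_1) (simp add: prob_space_distr)
    then show "emeasure (distr M (T \<Otimes>\<^sub>M N) (\<lambda>\<omega>. (W \<omega>, Z \<omega>))) (space T \<times> space N) \<noteq> \<infinity>" for i :: nat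
      by (auto simp: top_unique)
    fix X assume "X \<in> ?E"
    then obtain b a where X: "X = b \<times> a" and b[measurable]: "b \<in> sets T" and a[measurable]: "a \<in> sets N" by blast
    have "emeasure (distr M (T \<Otimes>\<^sub>M N) (\<lambda>\<omega>. (W \<omega>, Z \<omega>))) X = emeasure M {\<omega>\<in>space M. Z \<omega> \<in> a \<and> W \<omega> \<in> b}"
      unfolding X by (subst emeasure_distr) (auto intro!: arg_cong[of _ _ "emeasure M"])
    also have "\<dots> = (\<integral>\<^sup>+ w\<in>b \<inter> D. emeasure (\<kappa> w) a \<partial>?L)" by (rule r[OF a b])
    also have "\<dots> = (\<integral>\<^sup>+ w. emeasure (K w) X \<partial>?L)"
    proof (rule nn_integral_cong_AE)
      have H: "emeasure (\<kappa> w) a * indicator (b \<inter> D) w = emeasure (K w) X" if "w \<in> D" "w \<in> space T" for w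
      proof -
        have "emeasure (K w) X = emeasure (\<kappa>0 w) (Pair w -` X \<inter> space (\<kappa>0 w))"
          unfolding K_def
        proof (rule emeasure_distr)
          show "Pair w \<in> \<kappa>0 w \<rightarrow>\<^sub>M T \<Otimes>\<^sub>M N"
            using measurable_Pair1'[OF that(2), of N] by (simp add: measurable_cong_sets[OF sk[OF that(2)] refl])
          show "X \<in> sets (T \<Otimes>\<^sub>M N)" unfolding X using a b by simp
        qed
        also have "Pair w -` X \<inter> space (\<kappa>0 w) = (if w \<in> b then a else {})"
          using sets.sets_into_space[OF a] sets_eq_imp_space_eq[OF sk[OF that(2)]] by (auto simp: X)
        finally show ?thesis using that by (simp add: \<kappa>0_def split: split_indicator)
      qed
      show "AE w in ?L. emeasure (\<kappa> w) a * indicator (b \<inter> D) w = emeasure (K w) X"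
        using AED AE_space[of ?L] by eventually_elim (simp add: H)
    qed
    also have "\<dots> = emeasure B X"
      unfolding B_def by (rule emeasure_bind[OF Lne K'', symmetric]) (simp add: X a b)
    finally show "emeasure (distr M (T \<Otimes>\<^sub>M N) (\<lambda>\<omega>. (W \<omega>, Z \<omega>))) X = emeasure B X" .
  qed
  have "(\<integral>\<^sup>+ \<omega>. F (W \<omega>, Z \<omega>) \<partial>M) = (\<integral>\<^sup>+ p. F p \<partial>distr M (T \<Otimes>\<^sub>M N) (\<lambda>\<omega>. (W \<omega>, Z \<omega>)))"
    by (simp add: nn_integral_distr)
  also have "\<dots> = (\<integral>\<^sup>+ w. (\<integral>\<^sup>+ p. F p \<partial>K w) \<partial>?L)"
    unfolding eq B_def by (rule nn_integral_bind[OF F K''])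
  also have "\<dots> = (\<integral>\<^sup>+ w\<in>D. (\<integral>\<^sup>+ z. F (w, z) \<partial>\<kappa> w) \<partial>?L)"
  proof (rule nn_integral_cong_AE)
    have H: "(\<integral>\<^sup>+ p. F p \<partial>K w) = (\<integral>\<^sup>+ z. F (w, z) \<partial>\<kappa> w) * indicator D w" if "w \<in> D" "w \<in> space T" for w
    proof -
      have "Pair w \<in> \<kappa>0 w \<rightarrow>\<^sub>M T \<Otimes>\<^sub>M N"
        using measurable_Pair1'[OF that(2), of N] by (simp add: measurable_cong_sets[OF sk[OF that(2)] refl])
      then show ?thesis unfolding K_def using that by (simp add: nn_integral_distr \<kappa>0_def)
    qed
    show "AE w in ?L. (\<integral>\<^sup>+ p. F p \<partial>K w) = (\<integral>\<^sup>+ z. F (w, z) \<partial>\<kappa> w) * indicator D w"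
      using AED AE_space[of ?L] by eventually_elim (simp add: H)
  qed
  finally show ?thesis .
qed

section \<open>Measurability of blocks and majorants\<close>

text \<open>
  Outside of \<open>{1..n}\<close> all elements of the product space have the same value \<open>undefined\<close>.
\<close>

lemma incr_component: "(\<lambda>x. x i) \<in> borel_measurable (incr_space n)"
proof (cases "i \<in> {1..n}")
  case False
  have "(\<lambda>x. x i) \<in> borel_measurable (incr_space n) \<longleftrightarrow> (\<lambda>x. undefined :: real) \<in> borel_measurable (incr_space n)"
    using False by (intro measurable_cong) (auto simp: space_PiM PiE_def extensional_def)
  then show ?thesis by simp
qed (rule measurable_component_singleton)

lemma sum_list_map_measurable [measurable]: "(\<lambda>x. sum_list (map x I)) \<in> borel_measurable (incr_space n)"
proof (induction I)
  case Nil
  show ?case by simp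
next
  case (Cons i I)
  show ?case unfolding list.map sum_list.Cons by (rule borel_measurable_add[OF incr_component Cons])
qed

lemma mean_map_measurable [measurable]: "(\<lambda>x. mean (map x I)) \<in> borel_measurable (incr_space n)"
  unfolding mean_def length_map by measurable

lemma good_map_iff:
  "good (map (map x) Is) \<longleftrightarrow>
    (\<forall>j\<in>{..<length Is}. \<forall>i\<in>{..<j}. mean (map x (Is ! j)) \<le> mean (map x (Is ! i))) \<and>
    (\<forall>i\<in>{..<length Is}. \<forall>m\<in>{1..length (Is ! i)}. mean (map x (take m (Is ! i))) \<le> mean (map x (Is ! i)))"
  by (auto simp: good_def good_block_def sorted_wrt_iff_nth_less all_set_conv_all_nth take_map)

lemma good_map_measurable [measurable]: "Measurable.pred (incr_space n) (\<lambda>x. good (map (map x) Is))"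
proof -
  have le: "Measurable.pred (incr_space n) (\<lambda>x. mean (map x I) \<le> mean (map x J))" for I J
    unfolding not_less[symmetric]
    by (rule pred_intros_logic(2)[OF borel_measurable_pred_less]) (rule mean_map_measurable)+
  show ?thesis
    unfolding good_map_iff by (intro pred_intros_logic(3) pred_intros_countable_bounded(3) le)
qed

text \<open>
  Counting choices expresses the number through finitely many measurable predicates.
\<close>

lemma good_arrangements_map_measurable [measurable]:
  "(\<lambda>x. real (good_arrangements (map (map x) Is))) \<in> borel_measurable (incr_space n)"
proof -
  let ?C = "choices (map length Is)"
  have fin: "finite ?C" by (rule card_choices(2))
  have "real (good_arrangements (map (map x) Is)) = (\<Sum>ch\<in>?C. if good (map (map x) (rearr Is ch)) then 1 else 0)" for x
  proof -
    have ch: "map length (map (map x) Is) = map length Is" by simp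
    have "good_arrangements (map (map x) Is) = card {c \<in> ?C. good (rearr (map (map x) Is) c)}"
      using card_good_choices[of "map (map x) Is"] unfolding ch by simp
    also have "{c \<in> ?C. good (rearr (map (map x) Is) c)} = {c \<in> ?C. good (map (map x) (rearr Is c))}"
    proof -
      have "rearr (map (map x) Is) c = map (map x) (rearr Is c)" if "c \<in> ?C" for c
        using choicesD(2)[OF that] by (intro rearr_map) simp
      then show ?thesis by auto
    qed
    finally show ?thesis unfolding sum.inter_filter[OF fin, symmetric] by simp
  qed
  moreover have "(\<lambda>x. \<Sum>ch\<in>?C. if good (map (map x) (rearr Is ch)) then 1 else 0 :: real) \<in> borel_measurable (incr_space n)"
    by measurable
  ultimately show ?thesis by (simp only:)
qed

lemma levelled_map_measurable [measurable]:
  "(\<lambda>x. levelled (map (map x) Is) ! k) \<in> borel_measurable (incr_space n)"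
proof (induction Is arbitrary: k)
  case (Cons I Is)
  have "levelled (map (map x) (I # Is)) ! k =
      (if k < length I then mean (map x I) else levelled (map (map x) Is) ! (k - length I))" for x
    by (simp add: levelled_Cons nth_append)
  then show ?case using Cons mean_map_measurable by (cases "k < length I") (simp_all only: if_True if_False)
qed (simp add: levelled_def)

lemma sum_list_take_measurable:
  fixes f :: "'x \<Rightarrow> real list"
  assumes "\<And>x. length (f x) = N" and [measurable]: "\<And>k. (\<lambda>x. f x ! k) \<in> borel_measurable M"
  shows "(\<lambda>x. sum_list (take j (f x))) \<in> borel_measurable M"
proof -
  have "sum_list (take j (f x)) = (\<Sum>k<min j N. f x ! k)" for x
    using assms(1)[of x] by (simp add: sum_list_sum_nth atLeast0LessThan min.commute)
  then show ?thesis by simp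
qed

lemma polygon_levelled_measurable:
  assumes t: "t \<in> {0..real n}" and l: "length (concat Is) = n" and n: "n \<ge> 1"
  shows "(\<lambda>x. polygon (levelled (map (map x) Is)) t) \<in> borel_measurable (incr_space n')"
proof -
  have len: "length (levelled (map (map x) Is)) = n" for x :: "nat \<Rightarrow> real"
    using l by (simp add: length_concat comp_def)
  have "polygon (levelled (map (map x) Is)) t = Min ((\<lambda>k. edge_line (levelled (map (map x) Is)) k t) ` {..<n})" for x
    unfolding polygon_def len using t by simp
  moreover have "(\<lambda>x. Min ((\<lambda>k. edge_line (levelled (map (map x) Is)) k t) ` {..<n})) \<in> borel_measurable (incr_space n')"
    unfolding edge_line_def
  proof (rule borel_measurable_Min[OF finite_lessThan])
    fix k
    have "(\<lambda>x. sum_list (take k (levelled (map (map x) Is)))) \<in> borel_measurable (incr_space n')"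
      by (rule sum_list_take_measurable[OF len levelled_map_measurable])
    then show "(\<lambda>x. sum_list (take k (levelled (map (map x) Is))) + levelled (map (map x) Is) ! k * (t - real k)) \<in> borel_measurable (incr_space n')"
      by (intro borel_measurable_add borel_measurable_times levelled_map_measurable borel_measurable_const)
  qed
  ultimately show ?thesis by simp
qed

text \<open>
  The density, on the event that the composition is \<open>ns\<close>, of the law of the rearranged increments with
  respect to the law of the increments, see \<open>rho_law\<close>.
\<close>

definition composition_weight :: "nat list \<Rightarrow> (nat \<Rightarrow> real) \<Rightarrow> real" where
  "composition_weight ns x = (if good (blocks ns x) then 1 / real (good_arrangements (blocks ns x)) else 0)"

lemma composition_weight_nonneg: "0 \<le> composition_weight ns x"
  by (simp add: composition_weight_def)

lemma composition_weight_measurable [measurable]: "composition_weight ns \<in> borel_measurable (incr_space n)"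
  unfolding composition_weight_def[abs_def] blocks_map by measurable

lemma sum_composition_weight: "(\<Sum>ns\<in>compositions n. composition_weight ns x) = 1"
proof -
  have len: "length (steps n x) = n" by simp
  have "(\<Sum>ns\<in>compositions n. composition_weight ns x) =
      (\<Sum>ns\<in>compositions n. if good (split_blocks ns (steps n x)) then 1 / real (good_arrangements (split_blocks ns (steps n x))) else 0)"
    by (intro sum.cong refl) (simp add: composition_weight_def compositions_sum)
  also have "\<dots> = (\<Sum>ns\<in>good_compositions (steps n x). 1 / real (good_arrangements (split_blocks ns (steps n x))))"
    unfolding len by (rule sum.inter_filter[OF finite_compositions, symmetric])
  also have "\<dots> = 1" by (rule sum_good_compositions)
  finally show ?thesis .
qed

text \<open>
  Every good composition describes the same majorant. This formula shows that the majorant is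
  measurable.
\<close>

lemma concave_majorant_mixture:
  assumes "n \<ge> 1"
  shows "concave_majorant n (walk n x) t = (\<Sum>ns\<in>compositions n. composition_weight ns x * polygon (levelled (blocks ns x)) t)"
proof -
  have "composition_weight ns x * polygon (levelled (blocks ns x)) t = composition_weight ns x * concave_majorant n (walk n x) t"
    if "ns \<in> compositions n" for ns
    using concave_majorant_walk[of ns x] assms compositions_sum[OF that] by (simp add: composition_weight_def)
  then have "(\<Sum>ns\<in>compositions n. composition_weight ns x * polygon (levelled (blocks ns x)) t) =
      (\<Sum>ns\<in>compositions n. composition_weight ns x * concave_majorant n (walk n x) t)" by (intro sum.cong refl)
  also have "\<dots> = concave_majorant n (walk n x) t"
    unfolding sum_distrib_right[symmetric] sum_composition_weight by simp
  finally show ?thesis ..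
qed

lemma concave_majorant_walk_polygon:
  assumes "n \<ge> 1"
  obtains ns where "ns \<in> compositions n" "good (blocks ns x)" "concave_majorant n (walk n x) = polygon (levelled (blocks ns x))"
proof -
  have "\<exists>ns\<in>compositions n. composition_weight ns x \<noteq> 0"
    using sum_composition_weight[of x n] sum.neutral[of "compositions n" "\<lambda>ns. composition_weight ns x"] by (metis zero_neq_one)
  then obtain ns where ns: "ns \<in> compositions n" "composition_weight ns x \<noteq> 0" by blast
  then have "good (blocks ns x)" by (auto simp: composition_weight_def split: if_splits)
  then show ?thesis using that ns(1) concave_majorant_walk[of ns x] assms compositions_sum[OF ns(1)] by simp
qed

lemma concave_majorant_walk_measurable:
  assumes n: "n \<ge> 1"
  shows "(\<lambda>x. concave_majorant n (walk n x)) \<in> incr_space n \<rightarrow>\<^sub>M concave_space n"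
  unfolding concave_space_def
proof (rule measurable_restrict_space2)
  have poly: "concave_majorant n (walk n x) \<in> extensional {0..real n} \<and> concave_on {0..real n} (concave_majorant n (walk n x))" for x
  proof -
    obtain ns where ns: "ns \<in> compositions n" "concave_majorant n (walk n x) = polygon (levelled (blocks ns x))"
      using concave_majorant_walk_polygon[OF n] by metis
    have l: "length (levelled (blocks ns x)) = n"
      unfolding length_levelled concat_blocks by (simp add: compositions_sum[OF ns(1)])
    then have "levelled (blocks ns x) \<noteq> []" using n by (metis list.size(3) not_one_le_zero)
    then show ?thesis using polygon_concave[of "levelled (blocks ns x)"] l
      unfolding ns(2) by (simp add: polygon_def)
  qed
  then show "(\<lambda>x. concave_majorant n (walk n x)) \<in> space (incr_space n) \<rightarrow> {c. concave_on {0..real n} c}" by blast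
  have coord: "(\<lambda>x. concave_majorant n (walk n x) t) \<in> borel_measurable (incr_space n)" if t: "t \<in> {0..real n}" for t
    unfolding concave_majorant_mixture[OF n]
  proof (intro borel_measurable_sum borel_measurable_times)
    fix ns assume ns: "ns \<in> compositions n"
    show "composition_weight ns \<in> borel_measurable (incr_space n)" by measurable
    show "(\<lambda>x. polygon (levelled (blocks ns x)) t) \<in> borel_measurable (incr_space n)"
    proof -
      have l: "length (concat (split_blocks ns [1..<Suc (sum_list ns)])) = n"
        by (subst concat_split_blocks) (simp_all add: compositions_sum[OF ns])
      show ?thesis unfolding blocks_map by (rule polygon_levelled_measurable[OF t l n])
    qed
  qed
  have "(\<lambda>x. \<lambda>t\<in>{0..real n}. concave_majorant n (walk n x) t) \<in> incr_space n \<rightarrow>\<^sub>M (\<Pi>\<^sub>M t\<in>{0..real n}. borel)"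
    using coord by (intro measurable_restrict)
  moreover have "(\<lambda>t\<in>{0..real n}. concave_majorant n (walk n x) t) = concave_majorant n (walk n x)" for x
    using poly[of x] extensional_restrict by blast
  ultimately show "(\<lambda>x. concave_majorant n (walk n x)) \<in> incr_space n \<rightarrow>\<^sub>M (\<Pi>\<^sub>M t\<in>{0..real n}. borel)" by simp
qed

lemma walk_measurable [measurable]: "walk n \<in> incr_space n \<rightarrow>\<^sub>M walk_space n"
  unfolding walk_def[abs_def] by (rule measurable_restrict, rule borel_measurable_sum, rule incr_component)

lemma concave_space_eval [measurable]: "(\<lambda>c. c t) \<in> borel_measurable (concave_space n)"
proof (cases "t \<in> {0..real n}")
  case True
  then show ?thesis unfolding concave_space_def
    by (intro measurable_restrict_space1 measurable_component_singleton)
next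
  case False
  have "(\<lambda>c. c t) \<in> borel_measurable (concave_space n) \<longleftrightarrow> (\<lambda>c. undefined :: real) \<in> borel_measurable (concave_space n)"
    using False by (intro measurable_cong) (auto simp: concave_space_def space_restrict_space space_PiM PiE_def extensional_def)
  then show ?thesis by simp
qed

section \<open>The law of the rearranged increments\<close>

definition permute_incr :: "nat \<Rightarrow> (nat \<Rightarrow> nat) \<Rightarrow> (nat \<Rightarrow> real) \<Rightarrow> nat \<Rightarrow> real" where
  "permute_incr n \<sigma> x = (\<lambda>i\<in>{1..n}. x (\<sigma> i))"

lemma permute_incr_measurable [measurable]: "permute_incr n \<sigma> \<in> incr_space n \<rightarrow>\<^sub>M incr_space n"
  unfolding permute_incr_def[abs_def] by (rule measurable_restrict, rule incr_component)

lemma increments_measurable: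
  "(\<And>i. i \<in> {1..n} \<Longrightarrow> X i \<in> borel_measurable M) \<Longrightarrow> increments n X \<in> M \<rightarrow>\<^sub>M incr_space n"
  unfolding increments_def[abs_def] by (rule measurable_restrict)

lemma steps_permute_incr: "steps n (permute_incr n \<sigma> x) = map x (map \<sigma> [1..<Suc n])"
  by (simp add: permute_incr_def)

lemma exchangeable_nn_integral:
  assumes X: "\<And>i. i \<in> {1..n} \<Longrightarrow> X i \<in> borel_measurable M" and ex: "exchangeable M n X"
    and \<sigma>: "\<sigma> permutes {1..n}" and f: "f \<in> borel_measurable (incr_space n)"
  shows "(\<integral>\<^sup>+ x. f (permute_incr n \<sigma> x) \<partial>distr M (incr_space n) (increments n X)) =
    (\<integral>\<^sup>+ x. f x \<partial>distr M (incr_space n) (increments n X))"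
proof -
  have iX: "increments n X \<in> M \<rightarrow>\<^sub>M incr_space n" by (rule increments_measurable[OF X])
  have fm: "f \<in> borel_measurable (distr M (incr_space n) g)"
    "(\<lambda>x. f (permute_incr n \<sigma> x)) \<in> borel_measurable (distr M (incr_space n) g)" for g
    unfolding measurable_distr_eq1 by (rule f, rule measurable_compose[OF permute_incr_measurable f])
  have eq: "permute_incr n \<sigma> (increments n X \<omega>) = increments n (\<lambda>i. X (\<sigma> i)) \<omega>" for \<omega>
    unfolding permute_incr_def increments_def
  proof (rule restrict_ext)
    fix i assume "i \<in> {1..n}"
    then have "\<sigma> i \<in> {1..n}" by (simp only: permutes_in_image[OF \<sigma>])
    then show "(\<lambda>i\<in>{1..n}. X i \<omega>) (\<sigma> i) = X (\<sigma> i) \<omega>" by (rule restrict_apply')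
  qed
  have iXs: "increments n (\<lambda>i. X (\<sigma> i)) \<in> M \<rightarrow>\<^sub>M incr_space n"
  proof (rule increments_measurable)
    fix i assume "i \<in> {1..n}"
    then have "\<sigma> i \<in> {1..n}" by (simp only: permutes_in_image[OF \<sigma>])
    then show "X (\<sigma> i) \<in> borel_measurable M" by (rule X)
  qed
  have "(\<integral>\<^sup>+ x. f (permute_incr n \<sigma> x) \<partial>distr M (incr_space n) (increments n X)) = (\<integral>\<^sup>+ \<omega>. f (permute_incr n \<sigma> (increments n X \<omega>)) \<partial>M)"
    by (rule nn_integral_distr[OF iX fm(2)])
  also have "\<dots> = (\<integral>\<^sup>+ x. f x \<partial>distr M (incr_space n) (increments n (\<lambda>i. X (\<sigma> i))))"
    unfolding eq by (rule nn_integral_distr[OF iXs fm(1), symmetric])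
  also have "distr M (incr_space n) (increments n (\<lambda>i. X (\<sigma> i))) = distr M (incr_space n) (increments n X)"
    using ex \<sigma> unfolding exchangeable_def by blast
  finally show ?thesis .
qed

lemma word_permutation:
  assumes "w \<in> permutations_of_set {1..n}"
  shows "\<exists>\<sigma>. \<sigma> permutes {1..n} \<and> map \<sigma> [1..<Suc n] = w"
proof -
  have w: "set w = {1..n}" "distinct w" "length w = n"
    using permutations_of_setD[OF assms] length_finite_permutations_of_set[OF assms] by simp_all
  define \<sigma> where "\<sigma> i = (if i \<in> {1..n} then w ! (i - 1) else i)" for i
  have inj: "inj_on \<sigma> {1..n}"
  proof (rule inj_onI)
    fix i j assume "i \<in> {1..n}" "j \<in> {1..n}" "\<sigma> i = \<sigma> j"
    then have "w ! (i - 1) = w ! (j - 1)" "i - 1 < length w" "j - 1 < length w" "1 \<le> i" "1 \<le> j" using w(3) by (auto simp: \<sigma>_def)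
    then show "i = j" using w(2) nth_eq_iff_index_eq[of w "i - 1" "j - 1"] by simp
  qed
  have "\<sigma> ` {1..n} \<subseteq> {1..n}"
  proof (rule image_subsetI)
    fix i assume "i \<in> {1..n}"
    then have "\<sigma> i \<in> set w" using w(3) by (auto simp: \<sigma>_def intro!: nth_mem)
    then show "\<sigma> i \<in> {1..n}" using w(1) by simp
  qed
  then have "bij_betw \<sigma> {1..n} {1..n}"
    using inj endo_inj_surj[of "{1..n}" \<sigma>] by (simp add: bij_betw_def)
  then have "\<sigma> permutes {1..n}" by (rule bij_imp_permutes) (auto simp: \<sigma>_def)
  moreover have "map \<sigma> [1..<Suc n] = w"
    by (rule nth_equalityI) (simp_all add: w(3) \<sigma>_def)
  ultimately show ?thesis by blast
qed

definition rho_increments ::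
  "nat \<Rightarrow> (nat \<Rightarrow> real) \<Rightarrow> (nat \<Rightarrow> nat) \<Rightarrow> nat list \<times> nat list \<Rightarrow> nat \<Rightarrow> real" where
  "rho_increments n x p ch = (\<lambda>i\<in>{1..n}. concat (rearranged_blocks n x p ch) ! (i - 1))"

lemma rearranged_blocks_rearr:
  "rearranged_blocks n x p ch = rearr (split_blocks (cycle_lengths n p) (steps n x)) ch"
  unfolding rearranged_blocks_def rearr_def Let_def ..

lemma length_split_steps:
  "p permutes {1..n} \<Longrightarrow> map length (split_blocks (cycle_lengths n p) (steps n x)) = cycle_lengths n p"
  using compositions_sum[OF sum_list_cycle_lengths] by (simp add: map_length_split_blocks)

lemma admissible_choices_eq:
  "admissible_choices n x p =
    {ch \<in> choices (cycle_lengths n p). good (rearr (split_blocks (cycle_lengths n p) (steps n x)) ch)}"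
  unfolding admissible_choices_def rearranged_blocks_rearr good_def good_block_def ..

lemma card_admissible_choices:
  assumes "p permutes {1..n}"
  shows "card (admissible_choices n x p) = good_arrangements (split_blocks (cycle_lengths n p) (steps n x))"
    "0 < card (admissible_choices n x p)" "finite (admissible_choices n x p)"
proof -
  show c: "card (admissible_choices n x p) = good_arrangements (split_blocks (cycle_lengths n p) (steps n x))"
    using card_good_choices[of "split_blocks (cycle_lengths n p) (steps n x)"]
    unfolding length_split_steps[OF assms] admissible_choices_eq .
  have "[] \<notin> set (split_blocks (cycle_lengths n p) (steps n x))"
    by (rule split_blocks_nonempty[OF sum_list_cycle_lengths[OF assms]]) simp
  then show "0 < card (admissible_choices n x p)" unfolding c by (rule good_arrangements_pos)
  then show "finite (admissible_choices n x p)" by (rule card_ge_0_finite)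
qed

text \<open>
  The permutation is found by rearranging the indices, so it is the same for all increments \<open>x\<close>.
\<close>

lemma rearrangement_permutes:
  assumes p: "p permutes {1..n}" and ch: "ch \<in> choices (cycle_lengths n p)"
  shows "\<exists>\<sigma>. \<sigma> permutes {1..n} \<and>
    (\<forall>x. steps n (permute_incr n \<sigma> x) = concat (rearranged_blocks n x p ch) \<and>
      rho_increments n x p ch = permute_incr n \<sigma> x)"
proof -
  let ?l = "cycle_lengths n p"
  let ?Is = "split_blocks ?l [1..<Suc n]"
  have suml: "sum_list ?l = n" by (rule compositions_sum[OF sum_list_cycle_lengths[OF p]])
  have lenI: "map length ?Is = ?l" using suml by (simp add: map_length_split_blocks)
  have ch': "ch \<in> choices (map length ?Is)" using ch lenI by simp
  have "mset (concat (rearr ?Is ch)) = mset [1..<Suc n]"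
    using mset_concat_rearr[OF ch'] suml by (simp add: concat_split_blocks)
  then have "concat (rearr ?Is ch) \<in> permutations_of_set {1..n}"
    using mset_eq_setD[of "concat (rearr ?Is ch)" "[1..<Suc n]"] mset_eq_imp_distinct_iff[of "concat (rearr ?Is ch)" "[1..<Suc n]"]
    by (intro permutations_of_setI) (simp_all add: atLeastLessThanSuc_atLeastAtMost)
  then obtain \<sigma> where \<sigma>: "\<sigma> permutes {1..n}" "map \<sigma> [1..<Suc n] = concat (rearr ?Is ch)" using word_permutation by blast
  have st: "steps n (permute_incr n \<sigma> x) = concat (rearranged_blocks n x p ch)" for x
  proof -
    have sub: "set (fst ch) \<subseteq> {..<length ?Is}" using choicesD(2)[OF ch'] by simp
    have "rearranged_blocks n x p ch = map (map x) (rearr ?Is ch)"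
      unfolding rearranged_blocks_rearr split_blocks_map by (rule rearr_map[OF sub])
    then show ?thesis unfolding steps_permute_incr \<sigma>(2) by (simp add: map_concat)
  qed
  have "rho_increments n x p ch = permute_incr n \<sigma> x" for x
  proof
    fix i
    show "rho_increments n x p ch i = permute_incr n \<sigma> x i"
    proof (cases "i \<in> {1..n}")
      case True
      have "rho_increments n x p ch i = steps n (permute_incr n \<sigma> x) ! (i - 1)"
        unfolding st rho_increments_def using True by simp
      also have "\<dots> = permute_incr n \<sigma> x i" using True by (subst nth_map) auto
      finally show ?thesis .
    next
      case False
      then show ?thesis unfolding rho_increments_def permute_incr_def by (auto simp: restrict_def)
    qed
  qed
  then show ?thesis using \<sigma>(1) st by blast
qed

lemma rho_composition_eq:
  assumes p: "p permutes {1..n}" and ch: "ch \<in> choices (cycle_lengths n p)"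
  shows "rho_composition n x p ch = map ((!) (cycle_lengths n p)) (fst ch)"
  using map_length_rearr[of ch "split_blocks (cycle_lengths n p) (steps n x)"] ch
  unfolding rho_composition_def rearranged_blocks_rearr length_split_steps[OF p] by blast

lemma rho_composition_in:
  assumes p: "p permutes {1..n}" and ch: "ch \<in> choices (cycle_lengths n p)"
  shows "rho_composition n x p ch \<in> compositions n"
proof -
  have "mset (rho_composition n x p ch) = mset (cycle_lengths n p)"
    unfolding rho_composition_eq[OF assms] using choicesD[OF ch] by (intro mset_map_nth_perm)
  then have "set (rho_composition n x p ch) = set (cycle_lengths n p)"
    "sum_list (rho_composition n x p ch) = sum_list (cycle_lengths n p)"
    by (rule mset_eq_setD) (metis \<open>mset (rho_composition n x p ch) = mset (cycle_lengths n p)\<close> sum_mset_sum_list)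
  then show ?thesis using sum_list_cycle_lengths[OF p] by (simp add: compositions_def)
qed

lemma rho_walk_eq:
  assumes p: "p permutes {1..n}" and ch: "ch \<in> choices (cycle_lengths n p)"
  shows "rho_walk n x p ch = walk n (rho_increments n x p ch)"
proof -
  obtain \<sigma> where s: "steps n (permute_incr n \<sigma> x) = concat (rearranged_blocks n x p ch)"
    "rho_increments n x p ch = permute_incr n \<sigma> x" using rearrangement_permutes[OF assms] by blast
  show ?thesis
  proof
    fix j
    show "rho_walk n x p ch j = walk n (rho_increments n x p ch) j"
    proof (cases "j \<le> n")
      case True
      then show ?thesis unfolding walk_steps[OF True] s rho_walk_def by (simp add: s(1)[symmetric])
    next
      case False
      then show ?thesis by (simp add: rho_walk_def walk_def)
    qed
  qed
qed

text \<open>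
  The blocks that a choice produces have as many good arrangements as the blocks it starts from, so the
  probability of an admissible choice is the weight of the new composition at the rearranged increments.
\<close>

lemma nn_integral_admissible_choices:
  fixes h :: "(nat \<Rightarrow> real) \<Rightarrow> ennreal"
  assumes p: "p permutes {1..n}" and ns: "ns \<in> compositions n"
    and \<sigma>: "\<And>ch. ch \<in> choices (cycle_lengths n p) \<Longrightarrow> steps n (permute_incr n (\<sigma> ch) x) = concat (rearranged_blocks n x p ch)"
  shows "(\<integral>\<^sup>+ ch. (if ch \<in> choices (cycle_lengths n p) \<and> map ((!) (cycle_lengths n p)) (fst ch) = ns
              then h (permute_incr n (\<sigma> ch) x) else 0) \<partial>measure_pmf (pmf_of_set (admissible_choices n x p)))
    = (\<Sum>ch | ch \<in> choices (cycle_lengths n p) \<and> map ((!) (cycle_lengths n p)) (fst ch) = ns.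
        h (permute_incr n (\<sigma> ch) x) * ennreal (composition_weight ns (permute_incr n (\<sigma> ch) x)))"
proof -
  let ?l = "cycle_lengths n p"
  let ?A = "admissible_choices n x p"
  let ?C = "{ch. ch \<in> choices ?l \<and> map ((!) ?l) (fst ch) = ns}"
  let ?bs = "split_blocks ?l (steps n x)"
  note A = card_admissible_choices[OF p, of x]
  have ne: "?A \<noteq> {}" using A(2) by auto
  have finC: "finite ?C" by (rule finite_subset[OF _ card_choices(2)[of ?l]]) auto
  have bl: "blocks ns (permute_incr n (\<sigma> ch) x) = rearr ?bs ch" if "ch \<in> ?C" for ch
  proof -
    have ch: "ch \<in> choices (map length ?bs)" using that length_split_steps[OF p] by simp
    have "map length (rearr ?bs ch) = ns" using map_length_rearr[OF ch] that length_split_steps[OF p] by simp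
    then show ?thesis
      using split_blocks_concat[of "rearr ?bs ch"] \<sigma>[of ch] that
      unfolding compositions_sum[OF ns] rearranged_blocks_rearr by simp
  qed
  have wt: "composition_weight ns (permute_incr n (\<sigma> ch) x) = (if ch \<in> ?A then 1 / real (card ?A) else 0)" if "ch \<in> ?C" for ch
  proof -
    have ch: "ch \<in> choices (map length ?bs)" using that length_split_steps[OF p] by simp
    show ?thesis unfolding composition_weight_def bl[OF that] good_arrangements_rearr[OF ch] A(1)
      using that by (simp add: admissible_choices_eq)
  qed
  have "(\<integral>\<^sup>+ ch. (if ch \<in> ?C then h (permute_incr n (\<sigma> ch) x) else 0) \<partial>measure_pmf (pmf_of_set ?A))
      = (\<Sum>ch\<in>?A. if ch \<in> ?C then h (permute_incr n (\<sigma> ch) x) else 0) / card ?A"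
    by (rule nn_integral_pmf_of_set[OF ne A(3)])
  also have "\<dots> = (\<Sum>ch\<in>?A. (if ch \<in> ?C then h (permute_incr n (\<sigma> ch) x) else 0) * ennreal (1 / real (card ?A)))"
  proof -
    have "inverse (of_nat (card ?A)) = ennreal (1 / real (card ?A))"
      using A(2) by (simp add: ennreal_of_nat_eq_real_of_nat inverse_ennreal inverse_eq_divide)
    then show ?thesis unfolding divide_ennreal_def sum_distrib_right by (rule arg_cong)
  qed
  also have "\<dots> = (\<Sum>ch\<in>?A \<inter> ?C. h (permute_incr n (\<sigma> ch) x) * ennreal (1 / real (card ?A)))"
    unfolding sum.inter_restrict[OF A(3)] by (intro sum.cong refl) simp
  also have "\<dots> = (\<Sum>ch\<in>?C. h (permute_incr n (\<sigma> ch) x) * ennreal (composition_weight ns (permute_incr n (\<sigma> ch) x)))"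
  proof (rule sum.mono_neutral_cong_left[OF finC])
    show "\<forall>ch\<in>?C - ?A \<inter> ?C. h (permute_incr n (\<sigma> ch) x) * ennreal (composition_weight ns (permute_incr n (\<sigma> ch) x)) = 0"
    proof
      fix ch assume "ch \<in> ?C - ?A \<inter> ?C"
      then have "ch \<in> ?C" "ch \<notin> ?A" by blast+
      then show "h (permute_incr n (\<sigma> ch) x) * ennreal (composition_weight ns (permute_incr n (\<sigma> ch) x)) = 0"
        by (simp only: wt if_False ennreal_0 mult_zero_right)
    qed
    fix ch assume "ch \<in> ?A \<inter> ?C"
    then have "ch \<in> ?C" "ch \<in> ?A" by blast+
    then show "h (permute_incr n (\<sigma> ch) x) * ennreal (1 / real (card ?A)) =
        h (permute_incr n (\<sigma> ch) x) * ennreal (composition_weight ns (permute_incr n (\<sigma> ch) x))"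
      by (simp only: wt if_True)
  qed blast
  finally show ?thesis by (simp only: mem_Collect_eq)
qed

text \<open>
  By \<open>nn_integral_admissible_choices\<close> the left side is a sum over permutations and choices of integrals
  of one function at permuted increments. By exchangeability all terms are equal, and there are \<open>n!\<close> of
  them.
\<close>

theorem rho_law:
  fixes M :: "'a measure" and h :: "(nat \<Rightarrow> real) \<Rightarrow> ennreal"
  assumes "prob_space M"
    and X: "\<And>i. i \<in> {1..n} \<Longrightarrow> X i \<in> borel_measurable M"
    and ex: "exchangeable M n X" and rho: "rho_construction M n X P R"
    and ns: "ns \<in> compositions n" and h[measurable]: "h \<in> borel_measurable (incr_space n)"
  shows "(\<integral>\<^sup>+ \<omega>. (if rho_composition n (increments n X \<omega>) (P \<omega>) (R \<omega>) = ns
            then h (rho_increments n (increments n X \<omega>) (P \<omega>) (R \<omega>)) else 0) \<partial>M)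
    = (\<integral>\<^sup>+ x. h x * ennreal (composition_weight ns x) \<partial>distr M (incr_space n) (increments n X))"
proof -
  interpret prob_space M by fact
  let ?Perm = "{p. p permutes {1..n}}"
  let ?\<mu> = "distr M (incr_space n) (increments n X)"
  let ?U = "uniform_count_measure ?Perm"
  let ?W = "\<lambda>\<omega>. (increments n X \<omega>, P \<omega>)"
  let ?T = "incr_space n \<Otimes>\<^sub>M count_space ?Perm"
  let ?l = "cycle_lengths n"
  have finP: "finite ?Perm" by (simp add: finite_permutations)
  have iX[measurable]: "increments n X \<in> M \<rightarrow>\<^sub>M incr_space n" by (rule increments_measurable[OF X])
  have P[measurable]: "P \<in> M \<rightarrow>\<^sub>M count_space ?Perm"
    and lawP: "distr M (count_space ?Perm) P = ?U"
    and ind: "indep_set (sets (vimage_algebra (space M) (increments n X) (incr_space n)))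
       (sets (vimage_algebra (space M) P (count_space ?Perm)))"
    and adm: "\<And>\<omega>. \<omega> \<in> space M \<Longrightarrow> R \<omega> \<in> admissible_choices n (increments n X \<omega>) (P \<omega>)"
    and rcd: "regular_cond_distr M R (count_space UNIV) ?W ?T (space ?T)
       (\<lambda>(x, p). measure_pmf (pmf_of_set (admissible_choices n x p)))"
    using rho by (auto simp: rho_construction_def)
  interpret \<mu>: prob_space ?\<mu> by (rule prob_space_distr[OF iX])
  interpret U: prob_space ?U unfolding lawP[symmetric] by (rule prob_space_distr[OF P])
  have lawW: "?\<mu> \<Otimes>\<^sub>M ?U = distr M ?T ?W"
  proof (rule pair_measure_eqI)
    show "sigma_finite_measure ?\<mu>" "sigma_finite_measure ?U" by unfold_locales
    show "sets (?\<mu> \<Otimes>\<^sub>M ?U) = sets (distr M ?T ?W)"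
      unfolding sets_distr by (intro sets_pair_measure_cong sets_distr sets_uniform_count_measure_count_space)
    fix A B assume A: "A \<in> sets ?\<mu>" and B: "B \<in> sets ?U"
    have A': "A \<in> sets (incr_space n)" using A by (simp only: sets_distr)
    have B': "B \<in> sets (count_space ?Perm)" using B by (simp only: sets_uniform_count_measure_count_space)
    let ?a = "increments n X -` A \<inter> space M" and ?b = "P -` B \<inter> space M"
    have ab: "prob (?a \<inter> ?b) = prob ?a * prob ?b"
      using A' B' by (intro indep_setD[OF ind]) (auto intro!: in_vimage_algebra)
    have ev: "?a \<in> events" "?b \<in> events" by (rule measurable_sets[OF iX A'], rule measurable_sets[OF P B'])
    have "emeasure ?\<mu> A * emeasure ?U B = emeasure M ?a * emeasure M ?b"
      unfolding lawP[symmetric] emeasure_distr[OF iX A'] emeasure_distr[OF P B'] ..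
    also have "\<dots> = emeasure M (?a \<inter> ?b)"
      unfolding emeasure_eq_measure ab by (simp add: ennreal_mult)
    also have "?a \<inter> ?b = ?W -` (A \<times> B) \<inter> space M" by auto
    also have "emeasure M (?W -` (A \<times> B) \<inter> space M) = emeasure (distr M ?T ?W) (A \<times> B)"
      by (rule emeasure_distr[OF measurable_Pair[OF iX P] pair_measureI[OF A' B'], symmetric])
    finally show "emeasure ?\<mu> A * emeasure ?U B = emeasure (distr M ?T ?W) (A \<times> B)" .
  qed
  define \<sigma> where "\<sigma> p ch = (SOME s. s permutes {1..n} \<and>
    (\<forall>x. steps n (permute_incr n s x) = concat (rearranged_blocks n x p ch) \<and>
      rho_increments n x p ch = permute_incr n s x))" for p ch
  have \<sigma>: "\<sigma> p ch permutes {1..n} \<and>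
    (\<forall>x. steps n (permute_incr n (\<sigma> p ch) x) = concat (rearranged_blocks n x p ch) \<and>
      rho_increments n x p ch = permute_incr n (\<sigma> p ch) x)"
    if "p permutes {1..n}" "ch \<in> choices (?l p)" for p ch
    unfolding \<sigma>_def by (rule someI_ex[OF rearrangement_permutes[OF that]])
  let ?Q = "\<lambda>p ch. ch \<in> choices (?l p) \<and> map ((!) (?l p)) (fst ch) = ns"
  define F where "F = (\<lambda>((x, p), ch). if ?Q p ch then h (permute_incr n (\<sigma> p ch) x) else 0)"
  have F[measurable]: "F \<in> borel_measurable (?T \<Otimes>\<^sub>M count_space UNIV)"
  proof -
    have 1: "(\<lambda>z. if ?Q p ch then h (permute_incr n (\<sigma> p ch) (fst (fst z))) else 0) \<in> borel_measurable (?T \<Otimes>\<^sub>M count_space UNIV)" for p ch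
      by measurable
    have 2: "(\<lambda>z. (\<lambda>p z. if ?Q p ch then h (permute_incr n (\<sigma> p ch) (fst (fst z))) else 0) (snd (fst z)) z) \<in> borel_measurable (?T \<Otimes>\<^sub>M count_space UNIV)" for ch
      by (rule measurable_compose_countable'[OF 1 _ countable_finite[OF finP]]) measurable
    have "(\<lambda>z. (\<lambda>ch z. if ?Q (snd (fst z)) ch then h (permute_incr n (\<sigma> (snd (fst z)) ch) (fst (fst z))) else 0) (snd z) z) \<in> borel_measurable (?T \<Otimes>\<^sub>M count_space UNIV)"
      by (rule measurable_compose_countable'[OF 2, of _ UNIV]) auto
    moreover have "F = (\<lambda>z. (\<lambda>ch z. if ?Q (snd (fst z)) ch then h (permute_incr n (\<sigma> (snd (fst z)) ch) (fst (fst z))) else 0) (snd z) z)"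
      by (auto simp: F_def fun_eq_iff)
    ultimately show ?thesis by (simp only:)
  qed
  let ?g = "\<lambda>x p. \<Sum>ch | ?Q p ch. h (permute_incr n (\<sigma> p ch) x) * ennreal (composition_weight ns (permute_incr n (\<sigma> p ch) x))"
  have g1: "(\<lambda>z. ?g (fst z) p) \<in> borel_measurable (?\<mu> \<Otimes>\<^sub>M ?U)" for p
    by measurable
  have g[measurable]: "(\<lambda>z. ?g (fst z) (snd z)) \<in> borel_measurable (?\<mu> \<Otimes>\<^sub>M ?U)"
  proof -
    have s: "snd \<in> ?\<mu> \<Otimes>\<^sub>M ?U \<rightarrow>\<^sub>M count_space ?Perm"
      using measurable_snd[of ?\<mu> ?U] by (simp add: measurable_cong_sets[OF refl sets_uniform_count_measure_count_space])
    show ?thesis by (rule measurable_compose_countable'[OF g1 s countable_finite[OF finP]])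
  qed
  have "(\<integral>\<^sup>+ \<omega>. (if rho_composition n (increments n X \<omega>) (P \<omega>) (R \<omega>) = ns
            then h (rho_increments n (increments n X \<omega>) (P \<omega>) (R \<omega>)) else 0) \<partial>M)
      = (\<integral>\<^sup>+ \<omega>. F (?W \<omega>, R \<omega>) \<partial>M)"
  proof (rule nn_integral_cong)
    fix \<omega> assume \<omega>: "\<omega> \<in> space M"
    have p: "P \<omega> permutes {1..n}" using measurable_space[OF P \<omega>] by simp
    have c: "R \<omega> \<in> choices (?l (P \<omega>))" using adm[OF \<omega>] by (simp add: admissible_choices_eq)
    show "(if rho_composition n (increments n X \<omega>) (P \<omega>) (R \<omega>) = ns
            then h (rho_increments n (increments n X \<omega>) (P \<omega>) (R \<omega>)) else 0) = F (?W \<omega>, R \<omega>)"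
      using c \<sigma>[OF p c] by (simp add: F_def rho_composition_eq[OF p c])
  qed
  also have "\<dots> = (\<integral>\<^sup>+ w\<in>space ?T. (\<integral>\<^sup>+ ch. F (w, ch) \<partial>(case w of (x, p) \<Rightarrow> measure_pmf (pmf_of_set (admissible_choices n x p)))) \<partial>distr M ?T ?W)"
    by (rule regular_cond_distr_nn_integral[OF assms(1) rcd F])
  also have "\<dots> = (\<integral>\<^sup>+ w. ?g (fst w) (snd w) \<partial>distr M ?T ?W)"
  proof (rule nn_integral_cong)
    fix w assume "w \<in> space (distr M ?T ?W)"
    then obtain x p where w: "w = (x, p)" "p permutes {1..n}" by (cases w) (auto simp: space_pair_measure)
    have "(\<integral>\<^sup>+ ch. F ((x, p), ch) \<partial>measure_pmf (pmf_of_set (admissible_choices n x p))) = ?g x p"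
      unfolding F_def prod.case by (rule nn_integral_admissible_choices[OF w(2) ns]) (use \<sigma>[OF w(2)] in blast)
    then show "(\<integral>\<^sup>+ ch. F (w, ch) \<partial>(case w of (x, p) \<Rightarrow> measure_pmf (pmf_of_set (admissible_choices n x p)))) * indicator (space ?T) w = ?g (fst w) (snd w)"
      using \<open>w \<in> space (distr M ?T ?W)\<close> by (simp add: w(1))
  qed
  also have "\<dots> = (\<integral>\<^sup>+ x. \<integral>\<^sup>+ p. ?g x p \<partial>?U \<partial>?\<mu>)"
    unfolding lawW[symmetric] U.nn_integral_fst[OF g, symmetric] fst_conv snd_conv ..
  also have "\<dots> = (\<integral>\<^sup>+ x. (\<Sum>p\<in>?Perm. ?g x p * ennreal (1 / fact n)) \<partial>?\<mu>)"
    unfolding uniform_count_measure_def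
    by (subst nn_integral_point_measure_finite[OF finP]) (simp add: card_permutations mult.commute)
  also have "\<dots> = (\<Sum>p\<in>?Perm. \<Sum>ch | ?Q p ch. (\<integral>\<^sup>+ x. h (permute_incr n (\<sigma> p ch) x) * ennreal (composition_weight ns (permute_incr n (\<sigma> p ch) x)) \<partial>?\<mu>) * ennreal (1 / fact n))"
  proof -
    have km: "(\<lambda>x. h (permute_incr n (\<sigma> p ch) x) * ennreal (composition_weight ns (permute_incr n (\<sigma> p ch) x))) \<in> borel_measurable ?\<mu>" for p ch
      by measurable
    have sm: "(\<lambda>x. ?g x p) \<in> borel_measurable ?\<mu>" for p by measurable
    have "(\<integral>\<^sup>+ x. (\<Sum>p\<in>?Perm. ?g x p * ennreal (1 / fact n)) \<partial>?\<mu>) = (\<Sum>p\<in>?Perm. (\<integral>\<^sup>+ x. ?g x p * ennreal (1 / fact n) \<partial>?\<mu>))"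
      by (rule nn_integral_sum) (rule borel_measurable_times_ennreal[OF sm borel_measurable_const])
    also have "\<dots> = (\<Sum>p\<in>?Perm. (\<integral>\<^sup>+ x. ?g x p \<partial>?\<mu>) * ennreal (1 / fact n))"
      unfolding nn_integral_multc[OF sm] ..
    finally show ?thesis unfolding nn_integral_sum[OF km] sum_distrib_right .
  qed
  also have "\<dots> = (\<Sum>p\<in>?Perm. \<Sum>ch | ?Q p ch. (\<integral>\<^sup>+ x. h x * ennreal (composition_weight ns x) \<partial>?\<mu>) * ennreal (1 / fact n))"
  proof (intro sum.cong refl)
    fix p ch assume "p \<in> ?Perm" "ch \<in> {ch. ?Q p ch}"
    then have "\<sigma> p ch permutes {1..n}" using \<sigma> by blast
    then show "(\<integral>\<^sup>+ x. h (permute_incr n (\<sigma> p ch) x) * ennreal (composition_weight ns (permute_incr n (\<sigma> p ch) x)) \<partial>?\<mu>) * ennreal (1 / fact n)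
        = (\<integral>\<^sup>+ x. h x * ennreal (composition_weight ns x) \<partial>?\<mu>) * ennreal (1 / fact n)"
    proof -
      have m: "(\<lambda>x. h x * ennreal (composition_weight ns x)) \<in> borel_measurable (incr_space n)" by measurable
      show ?thesis
        using exchangeable_nn_integral[OF X ex \<open>\<sigma> p ch permutes {1..n}\<close> m] by (simp only:)
    qed
  qed
  also have "\<dots> = of_nat (\<Sum>p\<in>?Perm. card {ch. ?Q p ch}) * ((\<integral>\<^sup>+ x. h x * ennreal (composition_weight ns x) \<partial>?\<mu>) * ennreal (1 / fact n))"
    unfolding sum_constant of_nat_sum sum_distrib_right ..
  also have "(\<Sum>p\<in>?Perm. card {ch. ?Q p ch}) = fact n" by (rule count_choices_with_composition[OF ns])
  also have "of_nat (fact n) * ((\<integral>\<^sup>+ x. h x * ennreal (composition_weight ns x) \<partial>?\<mu>) * ennreal (1 / fact n)) = (\<integral>\<^sup>+ x. h x * ennreal (composition_weight ns x) \<partial>?\<mu>)"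
  proof -
    have "of_nat (fact n) * ennreal (1 / fact n) = 1"
      by (simp add: ennreal_of_nat_eq_real_of_nat ennreal_mult[symmetric])
    then show ?thesis by (subst mult.left_commute) (simp only: mult_1_right)
  qed
  finally show ?thesis .
qed

section \<open>Cyclic rearrangements within blocks\<close>

abbreviation rotate_blocks :: "nat list \<Rightarrow> 'b list list \<Rightarrow> 'b list list" where
  "rotate_blocks r bs \<equiv> map2 rotate r bs"

lemma rotate_blocks_props:
  assumes "length r = length bs"
  shows "map length (rotate_blocks r bs) = map length bs"
    and "map mset (rotate_blocks r bs) = map mset bs"
proof -
  show "map mset (rotate_blocks r bs) = map mset bs"
    using assms by (induction r bs rule: list_induct2) (simp_all add: mset_rotate)
  show "map length (rotate_blocks r bs) = map length bs"
    using assms by (induction r bs rule: list_induct2) simp_all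
qed

lemma rotate_blocks_real:
  fixes bs :: "real list list"
  assumes "length r = length bs"
  shows "map mean (rotate_blocks r bs) = map mean bs" "map shifts (rotate_blocks r bs) = map shifts bs"
    "levelled (rotate_blocks r bs) = levelled bs"
  using assms by (induction r bs rule: list_induct2) (simp_all add: levelled_def)

lemma mset_concat_eq: "map mset as = map mset bs \<Longrightarrow> mset (concat as) = mset (concat bs)"
  by (simp only: mset_concat)

context
  fixes n :: nat and ns :: "nat list"
  assumes ns: "ns \<in> compositions n"
begin

lemma sum_ns: "sum_list ns = n"
  by (rule compositions_sum[OF ns])

abbreviation index_blocks :: "nat list list" where
  "index_blocks \<equiv> split_blocks ns [1..<Suc n]"

lemma length_index_blocks: "map length index_blocks = ns"
  by (simp add: map_length_split_blocks sum_ns)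

lemma concat_index_blocks: "concat index_blocks = [1..<Suc n]"
  by (simp add: concat_split_blocks sum_ns)

lemma blocks_permute_incr:
  assumes "map \<sigma> [1..<Suc n] = concat (rotate_blocks r index_blocks)" "length r = length ns"
  shows "blocks ns (permute_incr n \<sigma> x) = rotate_blocks r (blocks ns x)"
proof -
  have l: "length r = length index_blocks" using assms(2) by simp
  have m: "rotate_blocks r (map (map x) bs) = map (map x) (rotate_blocks r bs)" if "length r = length bs" for bs :: "nat list list"
    using that by (induction r bs rule: list_induct2) (simp_all add: rotate_map)
  have bm: "blocks ns x = map (map x) index_blocks" using blocks_map[of ns x] unfolding sum_ns .
  have "steps n (permute_incr n \<sigma> x) = concat (map (map x) (rotate_blocks r index_blocks))"
    unfolding steps_permute_incr assms(1) map_concat ..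
  also have "\<dots> = concat (rotate_blocks r (blocks ns x))" unfolding bm m[OF l] ..
  finally have s: "steps n (permute_incr n \<sigma> x) = concat (rotate_blocks r (blocks ns x))" .
  have "length r = length (blocks ns x)" using assms(2) by simp
  from rotate_blocks_props(1)[OF this] have lens: "map length (rotate_blocks r (blocks ns x)) = ns" unfolding length_blocks .
  have "blocks ns (permute_incr n \<sigma> x) = split_blocks ns (concat (rotate_blocks r (blocks ns x)))"
    using s by (simp only: sum_ns)
  also have "\<dots> = rotate_blocks r (blocks ns x)"
    using split_blocks_concat[of "rotate_blocks r (blocks ns x)"] by (simp only: lens)
  finally show ?thesis .
qed

lemma cyclic_permutationE:
  assumes "\<sigma> \<in> cyclic_permutations n ns"
  obtains r where "length r = length ns" "\<And>x. blocks ns (permute_incr n \<sigma> x) = rotate_blocks r (blocks ns x)"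
  using assms blocks_permute_incr unfolding cyclic_permutations_def by blast

lemma cyclic_permutes: "\<sigma> \<in> cyclic_permutations n ns \<Longrightarrow> \<sigma> permutes {1..n}"
  by (simp add: cyclic_permutations_def)

lemma finite_cyclic_permutations: "finite (cyclic_permutations n ns)"
  by (rule finite_subset[OF _ finite_permutations[of "{1..n}"]]) (auto simp: cyclic_permutations_def)

text \<open>
  Shifts matter modulo the lengths of the blocks, and reduced shifts are determined by the permutation.
\<close>

lemma cyclic_permutations_bij:
  "\<exists>f. bij_betw f {r. length r = length ns \<and> (\<forall>i<length ns. r ! i < ns ! i)} (cyclic_permutations n ns) \<and>
    (\<forall>r x. length r = length ns \<longrightarrow> (\<forall>i<length ns. r ! i < ns ! i) \<longrightarrow>
      blocks ns (permute_incr n (f r) x) = rotate_blocks r (blocks ns x))"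
proof -
  let ?R = "{r. length r = length ns \<and> (\<forall>i<length ns. r ! i < ns ! i)}"
  let ?w = "\<lambda>r. concat (rotate_blocks r index_blocks)"
  have len: "length index_blocks = length ns" by simp
  have "\<exists>\<sigma>. \<sigma> permutes {1..n} \<and> map \<sigma> [1..<Suc n] = ?w r" if "length r = length ns" for r
  proof (rule word_permutation)
    have "mset (?w r) = mset [1..<Suc n]"
      using mset_concat_eq[OF rotate_blocks_props(2)[of r index_blocks]] that unfolding concat_index_blocks by simp
    then show "?w r \<in> permutations_of_set {1..n}"
      using mset_eq_setD[of "?w r" "[1..<Suc n]"] mset_eq_imp_distinct_iff[of "?w r" "[1..<Suc n]"]
      by (intro permutations_of_setI) (simp_all add: atLeastLessThanSuc_atLeastAtMost)
  qed
  then obtain f where f: "\<And>r. length r = length ns \<Longrightarrow> f r permutes {1..n} \<and> map (f r) [1..<Suc n] = ?w r" by metis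
  have dI: "distinct (index_blocks ! i)" "length (index_blocks ! i) = ns ! i" if "i < length ns" for i
  proof -
    have "distinct (concat index_blocks)" unfolding concat_index_blocks by simp
    then show "distinct (index_blocks ! i)" using that by (simp add: distinct_concat_iff)
    have "map length index_blocks ! i = ns ! i" unfolding length_index_blocks ..
    then show "length (index_blocks ! i) = ns ! i" using that by simp
  qed
  have "bij_betw f ?R (cyclic_permutations n ns)"
  proof (rule bij_betw_imageI)
    show "inj_on f ?R"
    proof (rule inj_onI)
      fix r s assume r: "r \<in> ?R" and s: "s \<in> ?R" and "f r = f s"
      then have w: "?w r = ?w s" using f[of r] f[of s] by simp
      have sp: "split_blocks ns (?w t) = rotate_blocks t index_blocks" if "length t = length ns" for t
      proof -
        have t: "length t = length index_blocks" using that len by (rule trans[OF _ sym])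
        show ?thesis
          using split_blocks_concat[of "rotate_blocks t index_blocks"]
          unfolding rotate_blocks_props(1)[OF t] length_index_blocks .
      qed
      have lrs: "length r = length ns" "length s = length ns" using r s by blast+
      have eq: "rotate_blocks r index_blocks = rotate_blocks s index_blocks"
        using arg_cong[OF w, of "split_blocks ns"] unfolding sp[OF lrs(1)] sp[OF lrs(2)] .
      show "r = s"
      proof (rule nth_equalityI)
        show "length r = length s" using r s by simp
        fix i assume "i < length r"
        then have i: "i < length ns" using r by simp
        have "rotate (r ! i) (index_blocks ! i) = rotate (s ! i) (index_blocks ! i)"
          using arg_cong[OF eq, of "\<lambda>l. l ! i"] i r s by simp
        then show "r ! i = s ! i"
          using rotate_inj[OF dI(1)[OF i]] r s i dI(2)[OF i] by simp
      qed
    qed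
    show "f ` ?R = cyclic_permutations n ns"
    proof (rule subset_antisym; rule subsetI)
      fix \<sigma> assume "\<sigma> \<in> f ` ?R"
      then show "\<sigma> \<in> cyclic_permutations n ns" using f by (auto simp: cyclic_permutations_def)
    next
      fix \<sigma> assume "\<sigma> \<in> cyclic_permutations n ns"
      then obtain r where \<sigma>: "\<sigma> permutes {1..n}" "length r = length ns" "map \<sigma> [1..<Suc n] = ?w r"
        by (auto simp: cyclic_permutations_def)
      define s where "s = map2 (\<lambda>k m. k mod m) r ns"
      have ls: "length s = length ns" using \<sigma>(2) by (simp add: s_def)
      have sR: "s \<in> ?R"
      proof (intro CollectI conjI allI impI ls)
        fix i assume i: "i < length ns"
        then have "0 < ns ! i" using ns by (simp add: compositions_def)
        then show "s ! i < ns ! i" using i \<sigma>(2) by (simp add: s_def)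
      qed
      have "rotate_blocks s index_blocks = rotate_blocks r index_blocks"
      proof (rule nth_equalityI)
        fix i assume "i < length (rotate_blocks s index_blocks)"
        then have i: "i < length ns" by simp
        have "s ! i = r ! i mod length (index_blocks ! i)" unfolding dI(2)[OF i] using i \<sigma>(2) by (simp add: s_def)
        then show "rotate_blocks s index_blocks ! i = rotate_blocks r index_blocks ! i"
          using i ls \<sigma>(2) by (simp add: rotate_conv_mod[symmetric])
      qed (simp add: ls \<sigma>(2))
      then have m: "map (f s) [1..<Suc n] = map \<sigma> [1..<Suc n]" using f[OF ls] \<sigma>(3) by simp
      have "f s = \<sigma>"
      proof
        fix i
        show "f s i = \<sigma> i"
        proof (cases "i \<in> {1..n}")
          case True
          then have "i \<in> set [1..<Suc n]" by auto
          then show ?thesis using m by (metis map_eq_conv)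
        next
          case False
          then show ?thesis
            using permutes_not_in[OF \<sigma>(1) False] permutes_not_in[OF conjunct1[OF f[OF ls]] False] by simp
        qed
      qed
      then show "\<sigma> \<in> f ` ?R" using sR by blast
    qed
  qed
  moreover have "blocks ns (permute_incr n (f r) x) = rotate_blocks r (blocks ns x)" if "length r = length ns" for r x
    using blocks_permute_incr[of "f r" r x] f[OF that] that by blast
  ultimately show ?thesis by (intro exI[of _ f] conjI allI impI)
qed

lemma cyclic_permutations_nonempty: "cyclic_permutations n ns \<noteq> {}"
proof -
  have "id \<in> cyclic_permutations n ns"
    unfolding cyclic_permutations_def
  proof (intro CollectI conjI exI[of _ "replicate (length ns) 0"])
    show "id permutes {1..n}" by (rule permutes_id)
    have "rotate_blocks (replicate (length bs) 0) bs = bs" for bs :: "nat list list" by (induction bs) simp_all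
    from this[of index_blocks] show "map id [1..<Suc n] = concat (rotate_blocks (replicate (length ns) 0) (split_blocks ns [1..<Suc n]))"
      using concat_index_blocks by simp
  qed simp
  then show ?thesis by blast
qed

lemma cyclic_invariants:
  assumes "\<sigma> \<in> cyclic_permutations n ns"
  shows "map mean (blocks ns (permute_incr n \<sigma> x)) = map mean (blocks ns x)"
    "good_arrangements (blocks ns (permute_incr n \<sigma> x)) = good_arrangements (blocks ns x)"
    "levelled (blocks ns (permute_incr n \<sigma> x)) = levelled (blocks ns x)"
    "block_ends ns (walk n (permute_incr n \<sigma> x)) = block_ends ns (walk n x)"
proof -
  obtain r where r: "length r = length ns" "blocks ns (permute_incr n \<sigma> x) = rotate_blocks r (blocks ns x)"
    using cyclic_permutationE[OF assms] by blast
  have l: "length r = length (blocks ns x)" using r(1) by simp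
  show m: "map mean (blocks ns (permute_incr n \<sigma> x)) = map mean (blocks ns x)"
    "levelled (blocks ns (permute_incr n \<sigma> x)) = levelled (blocks ns x)"
    unfolding r(2) by (rule rotate_blocks_real[OF l])+
  show "good_arrangements (blocks ns (permute_incr n \<sigma> x)) = good_arrangements (blocks ns x)"
    unfolding good_arrangements_def m(1) unfolding r(2) rotate_blocks_real(2)[OF l] ..
  have sums: "map sum_list bs = map sum_list cs" if "map mean bs = map mean cs" "map length bs = map length cs" for bs cs :: "real list list"
  proof (rule nth_equalityI)
    show "length (map sum_list bs) = length (map sum_list cs)" using that(2) by (metis length_map)
    fix i assume "i < length (map sum_list bs)"
    then have i: "i < length bs" "i < length cs" using that(2) by (simp, metis length_map)
    have "mean (bs ! i) = mean (cs ! i)" "length (bs ! i) = length (cs ! i)"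
      using arg_cong[OF that(1), of "\<lambda>l. l ! i"] arg_cong[OF that(2), of "\<lambda>l. l ! i"] i by simp_all
    then show "map sum_list bs ! i = map sum_list cs ! i"
      using i sum_list_block[of "bs ! i"] sum_list_block[of "cs ! i"] by simp
  qed
  have ms: "map sum_list (blocks ns (permute_incr n \<sigma> x)) = map sum_list (blocks ns x)"
    by (rule sums[OF m(1)]) (simp only: length_blocks)
  show "block_ends ns (walk n (permute_incr n \<sigma> x)) = block_ends ns (walk n x)"
  proof
    fix m
    show "block_ends ns (walk n (permute_incr n \<sigma> x)) m = block_ends ns (walk n x) m"
    proof (cases "m \<in> {1..length ns}")
      case True
      show ?thesis
        using block_ends_walk[OF True, of "permute_incr n \<sigma> x"] block_ends_walk[OF True, of x] ms
        unfolding sum_ns take_map[symmetric] by simp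
    next
      case False
      then show ?thesis unfolding block_ends_def by (simp only: restrict_apply if_False)
    qed
  qed
qed

lemma walk_permute_incr: "j \<in> {1..n} \<Longrightarrow> walk n (permute_incr n \<sigma> x) j = (\<Sum>l=1..j. x (\<sigma> l))"
proof -
  assume j: "j \<in> {1..n}"
  have "walk n (permute_incr n \<sigma> x) j = (\<Sum>l=1..j. permute_incr n \<sigma> x l)" using j by (simp add: walk_def)
  also have "\<dots> = (\<Sum>l=1..j. x (\<sigma> l))"
    using j by (intro sum.cong refl) (simp add: permute_incr_def)
  finally show ?thesis .
qed

text \<open>
  Rotations within blocks keep the polygon through the block ends, so staying below it is a condition on
  each block.
\<close>

lemma dominated_iff_good:
  assumes n: "n \<ge> 1" and sorted: "sorted_wrt (\<ge>) (map mean (blocks ns x))" and \<sigma>: "\<sigma> \<in> cyclic_permutations n ns"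
  shows "\<sigma> \<in> dominated_permutations n (polygon (levelled (blocks ns x))) ns x \<longleftrightarrow> good (blocks ns (permute_incr n \<sigma> x))"
proof -
  let ?bs = "blocks ns (permute_incr n \<sigma> x)"
  note inv = cyclic_invariants[OF \<sigma>, of x]
  have cb: "concat ?bs = steps n (permute_incr n \<sigma> x)" using concat_blocks[of ns "permute_incr n \<sigma> x"] unfolding sum_ns .
  have len: "length (concat ?bs) = n" unfolding cb by simp
  have sorted': "sorted_wrt (\<ge>) (map mean ?bs)" unfolding inv(1) by (rule sorted)
  have w: "walk n (permute_incr n \<sigma> x) j = sum_list (take j (concat ?bs))" if "j \<le> n" for j
    unfolding cb by (rule walk_steps[OF that])
  have p: "polygon (levelled (blocks ns x)) (real j) = sum_list (take j (levelled ?bs))" if "j \<le> n" for j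
    unfolding inv(3) by (rule polygon_levelled_nat[OF sorted]) (simp_all only: sum_ns n that)
  have "\<sigma> \<in> dominated_permutations n (polygon (levelled (blocks ns x))) ns x \<longleftrightarrow>
      (\<forall>j\<in>{1..n}. walk n (permute_incr n \<sigma> x) j \<le> polygon (levelled (blocks ns x)) (real j))"
  proof -
    have "\<sigma> \<in> dominated_permutations n (polygon (levelled (blocks ns x))) ns x \<longleftrightarrow>
        (\<forall>j\<in>{1..n}. (\<Sum>l=1..j. x (\<sigma> l)) \<le> polygon (levelled (blocks ns x)) (real j))"
      using \<sigma> unfolding dominated_permutations_def by blast
    also have "\<dots> \<longleftrightarrow> (\<forall>j\<in>{1..n}. walk n (permute_incr n \<sigma> x) j \<le> polygon (levelled (blocks ns x)) (real j))"
      by (rule ball_cong[OF refl]) (simp only: walk_permute_incr)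
    finally show ?thesis .
  qed
  also have "\<dots> \<longleftrightarrow> (\<forall>j\<in>{1..n}. sum_list (take j (concat ?bs)) \<le> sum_list (take j (levelled ?bs)))"
    by (rule ball_cong[OF refl]) (simp only: w p atLeastAtMost_iff)
  also have "\<dots> \<longleftrightarrow> (\<forall>j\<le>length (concat ?bs). sum_list (take j (concat ?bs)) \<le> sum_list (take j (levelled ?bs)))"
  proof (intro iffI allI impI ballI)
    fix j assume a: "\<forall>j\<in>{1..n}. sum_list (take j (concat ?bs)) \<le> sum_list (take j (levelled ?bs))" and "j \<le> length (concat ?bs)"
    then have "j = 0 \<or> j \<in> {1..n}" unfolding len by auto
    then show "sum_list (take j (concat ?bs)) \<le> sum_list (take j (levelled ?bs))" using a by auto
  next
    fix j assume a: "\<forall>j\<le>length (concat ?bs). sum_list (take j (concat ?bs)) \<le> sum_list (take j (levelled ?bs))" and "j \<in> {1..n}"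
    then have "j \<le> length (concat ?bs)" unfolding len by simp
    with a show "sum_list (take j (concat ?bs)) \<le> sum_list (take j (levelled ?bs))" by blast
  qed
  also have "\<dots> \<longleftrightarrow> (\<forall>b\<in>set ?bs. good_block b)" by (rule concat_below_levelled_iff)
  also have "\<dots> \<longleftrightarrow> good ?bs" unfolding good_def using sorted' by blast
  finally show ?thesis .
qed

lemma card_dominated:
  assumes n: "n \<ge> 1" and sorted: "sorted_wrt (\<ge>) (map mean (blocks ns x))"
  shows "card (dominated_permutations n (polygon (levelled (blocks ns x))) ns x) = prod_list (map shifts (blocks ns x))"
    "dominated_permutations n (polygon (levelled (blocks ns x))) ns x \<noteq> {}"
proof -
  let ?D = "dominated_permutations n (polygon (levelled (blocks ns x))) ns x"
  let ?bs = "blocks ns x"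
  let ?R = "{r. length r = length ns \<and> (\<forall>i<length ns. r ! i < ns ! i)}"
  obtain f where f: "bij_betw f ?R (cyclic_permutations n ns)"
    and fb: "\<And>r. r \<in> ?R \<Longrightarrow> blocks ns (permute_incr n (f r) x) = rotate_blocks r ?bs"
    using cyclic_permutations_bij by blast
  let ?A = "\<lambda>i. {r. r < length (?bs ! i) \<and> good_block (rotate r (?bs ! i))}"
  let ?G = "{r. length r = length ns \<and> (\<forall>i<length ns. r ! i \<in> ?A i)}"
  have lb: "length (?bs ! i) = ns ! i" if "i < length ns" for i
  proof -
    have "map length ?bs ! i = ns ! i" unfolding length_blocks ..
    then show ?thesis using that by simp
  qed
  have good: "good (rotate_blocks r ?bs) \<longleftrightarrow> (\<forall>i<length ns. good_block (rotate (r ! i) (?bs ! i)))" if "length r = length ns" for r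
  proof -
    have l: "length r = length ?bs" using that by simp
    have "(\<forall>b\<in>set (rotate_blocks r ?bs). good_block b) \<longleftrightarrow> (\<forall>i<length ns. good_block (rotate (r ! i) (?bs ! i)))"
      unfolding all_set_conv_all_nth using that by simp
    then show ?thesis unfolding good_def rotate_blocks_real(1)[OF l] using sorted by blast
  qed
  have "?D = f ` ?G"
  proof (rule subset_antisym; rule subsetI)
    fix \<sigma> assume \<sigma>: "\<sigma> \<in> ?D"
    then have c: "\<sigma> \<in> cyclic_permutations n ns" by (simp add: dominated_permutations_def)
    then obtain r where r: "r \<in> ?R" "\<sigma> = f r" using bij_betw_imp_surj_on[OF f] by blast
    have "good (rotate_blocks r ?bs)" using \<sigma> dominated_iff_good[OF n sorted c] fb[OF r(1)] r(2) by simp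
    then have "r \<in> ?G" using r(1) good[of r] lb by simp
    then show "\<sigma> \<in> f ` ?G" using r(2) by blast
  next
    fix \<sigma> assume "\<sigma> \<in> f ` ?G"
    then obtain r where r: "r \<in> ?G" "\<sigma> = f r" by blast
    have rR: "r \<in> ?R" using r(1) lb by simp
    have c: "\<sigma> \<in> cyclic_permutations n ns" using bij_betw_imp_surj_on[OF f] rR r(2) by blast
    have "good (rotate_blocks r ?bs)" using good[of r] r(1) by simp
    then show "\<sigma> \<in> ?D" using dominated_iff_good[OF n sorted c] fb[OF rR] r(2) by simp
  qed
  moreover have "inj_on f ?G"
    by (rule inj_on_subset[OF bij_betw_imp_inj_on[OF f]]) (use lb in auto)
  ultimately have "card ?D = card ?G" by (simp add: card_image)
  also have "\<dots> = (\<Prod>i<length ns. shifts (?bs ! i))"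
    using card_lists_nth[of "length ns" ?A] by (simp add: shifts_def)
  also have "\<dots> = (\<Prod>i<length ?bs. shifts (?bs ! i))" by simp
  also have "\<dots> = prod_list (map shifts ?bs)" by (rule prod_list_map_nth)
  finally show c: "card ?D = prod_list (map shifts ?bs)" .
  have "[] \<notin> set ?bs" unfolding sum_ns by (rule split_blocks_nonempty[OF ns]) simp
  then have "0 < good_arrangements ?bs" by (rule good_arrangements_pos)
  then have "card ?D \<noteq> 0" unfolding c good_arrangements_def by simp
  then show "?D \<noteq> {}" by auto
qed

end

section \<open>Measurability of the conditional construction\<close>

lemma pred_le_real:
  fixes f g :: "'x \<Rightarrow> real"
  assumes "f \<in> borel_measurable M" "g \<in> borel_measurable M"
  shows "Measurable.pred M (\<lambda>x. f x \<le> g x)"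
  unfolding not_less[symmetric] by (rule pred_intros_logic(2)[OF borel_measurable_pred_less[OF assms(2,1)]])

text \<open>
  The integral is one over the countable support, so Fubini applies although the type \<open>'s\<close> may be
  uncountable.
\<close>

lemma nn_integral_pmf_measurable:
  fixes p :: "'s pmf"
  assumes F: "\<And>s. (\<lambda>x. F s x) \<in> borel_measurable N"
  shows "(\<lambda>x. \<integral>\<^sup>+ s. F s x \<partial>measure_pmf p) \<in> borel_measurable N"
proof -
  have eq: "(\<integral>\<^sup>+ s. F s x \<partial>measure_pmf p) = (\<integral>\<^sup>+ s. ennreal (pmf p s) * F s x \<partial>count_space (set_pmf p))" for x
    unfolding nn_integral_measure_pmf by (rule nn_integral_count_space_eq) (simp_all add: pmf_eq_0_set_pmf)
  interpret sigma_finite_measure "count_space (set_pmf p)"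
    by (rule sigma_finite_measure_count_space_countable) simp
  have "(\<lambda>z. (\<lambda>s z. ennreal (pmf p s) * F s (fst z)) (snd z) z) \<in> borel_measurable (N \<Otimes>\<^sub>M count_space (set_pmf p))"
  proof (rule measurable_compose_countable'[OF _ measurable_snd countable_set_pmf])
    fix s
    show "(\<lambda>z. ennreal (pmf p s) * F s (fst z)) \<in> borel_measurable (N \<Otimes>\<^sub>M count_space (set_pmf p))"
      by (intro borel_measurable_times_ennreal borel_measurable_const measurable_compose[OF measurable_fst F])
  qed
  then show ?thesis unfolding eq by (intro borel_measurable_nn_integral) (simp add: case_prod_beta)
qed

text \<open>
  The mean of \<open>f\<close> over a uniform random dominated cyclic permutation of \<open>y\<close>.
\<close>

definition choice_average ::
  "nat \<Rightarrow> nat list \<Rightarrow> ((nat \<Rightarrow> real) \<Rightarrow> ennreal) \<Rightarrow> (real \<Rightarrow> real) \<Rightarrow> (nat \<Rightarrow> real) \<Rightarrow> ennreal" where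
  "choice_average n ns f c y =
    (\<integral>\<^sup>+ \<sigma>. f (permute_incr n \<sigma> y) \<partial>measure_pmf (pmf_of_set (dominated_permutations n c ns y)))"

text \<open>
  What is left of \<open>composition_weight\<close> after the average over cyclic permutations. It is a function of the
  block ends, since these determine the means of the blocks.
\<close>

definition end_weight :: "nat \<Rightarrow> nat list \<Rightarrow> (nat \<Rightarrow> real) \<Rightarrow> real" where
  "end_weight n ns e =
    (if sorted_wrt (\<ge>) (end_slopes ns e)
     then 1 / (real (card (cyclic_permutations n ns)) * real (orders (mset (end_slopes ns e)))) else 0)"

lemma dominated_eq_measurable:
  assumes ns: "ns \<in> compositions n" and B: "B \<subseteq> cyclic_permutations n ns"
  shows "Measurable.pred (concave_space n \<Otimes>\<^sub>M incr_space n) (\<lambda>z. dominated_permutations n (fst z) ns (snd z) = B)"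
proof -
  have iff: "dominated_permutations n c ns y = B \<longleftrightarrow>
      (\<forall>\<sigma>\<in>cyclic_permutations n ns. (\<forall>j\<in>{1..n}. (\<Sum>l=1..j. y (\<sigma> l)) \<le> c (real j)) = (\<sigma> \<in> B))" for c y
    using B unfolding dominated_permutations_def by blast
  have le: "Measurable.pred (concave_space n \<Otimes>\<^sub>M incr_space n) (\<lambda>z. (\<Sum>l=1..j. snd z (\<sigma> l)) \<le> fst z (real j))" for \<sigma> j
  proof (rule pred_le_real)
    show "(\<lambda>z. \<Sum>l=1..j. snd z (\<sigma> l)) \<in> borel_measurable (concave_space n \<Otimes>\<^sub>M incr_space n)"
      by (rule borel_measurable_sum, rule measurable_compose[OF measurable_snd incr_component])
    show "(\<lambda>z. fst z (real j)) \<in> borel_measurable (concave_space n \<Otimes>\<^sub>M incr_space n)"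
      by (rule measurable_compose[OF measurable_fst concave_space_eval])
  qed
  have dom: "Measurable.pred (concave_space n \<Otimes>\<^sub>M incr_space n) (\<lambda>z. \<forall>j\<in>{1..n}. (\<Sum>l=1..j. snd z (\<sigma> l)) \<le> fst z (real j))" for \<sigma>
    by (rule pred_intros_finite(3)[OF finite_atLeastAtMost le])
  show ?thesis unfolding iff
  proof (rule pred_intros_finite(3)[OF finite_cyclic_permutations[OF ns]])
    fix \<sigma>
    show "Measurable.pred (concave_space n \<Otimes>\<^sub>M incr_space n)
        (\<lambda>z. (\<forall>j\<in>{1..n}. (\<Sum>l=1..j. snd z (\<sigma> l)) \<le> fst z (real j)) = (\<sigma> \<in> B))"
      using dom[of \<sigma>] pred_intros_logic(2)[OF dom[of \<sigma>]] by (cases "\<sigma> \<in> B") (simp_all only: simp_thms)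
  qed
qed

lemma choice_average_measurable:
  assumes ns: "ns \<in> compositions n" and f: "f \<in> borel_measurable (incr_space n)"
  shows "(\<lambda>z. choice_average n ns f (fst z) (snd z)) \<in> borel_measurable (concave_space n \<Otimes>\<^sub>M incr_space n)"
proof -
  let ?N = "concave_space n \<Otimes>\<^sub>M incr_space n"
  let ?I = "\<lambda>B z. (\<integral>\<^sup>+ \<sigma>. f (permute_incr n \<sigma> (snd z)) \<partial>measure_pmf (pmf_of_set B))"
  have fin: "finite (Pow (cyclic_permutations n ns))" using finite_cyclic_permutations[OF ns] by simp
  have eq: "choice_average n ns f (fst z) (snd z) =
      (\<Sum>B\<in>Pow (cyclic_permutations n ns). if dominated_permutations n (fst z) ns (snd z) = B then ?I B z else 0)" for z
  proof -
    have "dominated_permutations n (fst z) ns (snd z) \<in> Pow (cyclic_permutations n ns)"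
      by (auto simp: dominated_permutations_def)
    then show ?thesis unfolding choice_average_def using fin by simp
  qed
  show ?thesis unfolding eq
  proof (rule borel_measurable_sum)
    fix B assume "B \<in> Pow (cyclic_permutations n ns)"
    then have B: "B \<subseteq> cyclic_permutations n ns" by simp
    have "?I B \<in> borel_measurable ?N"
      by (rule nn_integral_pmf_measurable, rule measurable_compose[OF measurable_compose[OF measurable_snd permute_incr_measurable] f])
    then show "(\<lambda>z. if dominated_permutations n (fst z) ns (snd z) = B then ?I B z else 0) \<in> borel_measurable ?N"
      by (rule measurable_If) (simp, rule predE[OF dominated_eq_measurable[OF ns B]])
  qed
qed

lemma ends_component: "m \<in> {1..length ns} \<Longrightarrow> (\<lambda>e. e m) \<in> borel_measurable (ends_space ns)"
  by (rule measurable_component_singleton)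

abbreviation end_slope :: "nat list \<Rightarrow> nat \<Rightarrow> (nat \<Rightarrow> real) \<Rightarrow> real" where
  "end_slope ns i e \<equiv> (e (Suc i) - (if i = 0 then 0 else e i)) / real (ns ! i)"

lemma end_slope_measurable: "i < length ns \<Longrightarrow> end_slope ns i \<in> borel_measurable (ends_space ns)"
proof -
  assume i: "i < length ns"
  have 1: "(\<lambda>e. e (Suc i)) \<in> borel_measurable (ends_space ns)" by (rule ends_component) (use i in simp)
  have 2: "(\<lambda>e. if i = 0 then 0 else e i) \<in> borel_measurable (ends_space ns)"
  proof (cases "i = 0")
    case False
    then show ?thesis using ends_component[of i ns] i by simp
  qed simp
  show ?thesis by (intro borel_measurable_divide borel_measurable_diff 1 2 borel_measurable_const)
qed

lemma replicate_blocks_measurable: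
  assumes "\<And>i. i \<in> set is \<Longrightarrow> s i \<in> borel_measurable M"
  shows "(\<lambda>e. concat (map2 replicate ms (map (\<lambda>i. s i e) is)) ! k :: real) \<in> borel_measurable M"
  using assms
proof (induction ms arbitrary: "is" k)
  case (Cons m ms)
  show ?case
  proof (cases "is")
    case (Cons i js)
    have i: "s i \<in> borel_measurable M" using Cons.prems Cons by simp
    have IH: "(\<lambda>e. concat (map2 replicate ms (map (\<lambda>i. s i e) js)) ! (k - m)) \<in> borel_measurable M"
      using Cons.prems Cons by (intro Cons.IH) simp
    have "concat (map2 replicate (m # ms) (map (\<lambda>i. s i e) is)) ! k =
      (if k < m then s i e else concat (map2 replicate ms (map (\<lambda>i. s i e) js)) ! (k - m))" for e
      by (simp add: Cons nth_append)
    then show ?thesis using i IH by simp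
  qed simp
qed simp

lemma end_majorant_measurable:
  assumes ns: "ns \<in> compositions n" and n: "n \<ge> 1"
  shows "end_majorant ns \<in> ends_space ns \<rightarrow>\<^sub>M concave_space n"
proof -
  have s: "sum_list ns = n" by (rule compositions_sum[OF ns])
  have "(\<lambda>e. levelled_steps ns e ! k) \<in> borel_measurable (ends_space ns)" for k
    unfolding levelled_steps_def end_slopes_def
    by (rule replicate_blocks_measurable) (rule end_slope_measurable, simp)
  then have "(\<lambda>e. \<lambda>i\<in>{1..n}. levelled_steps ns e ! (i - 1)) \<in> ends_space ns \<rightarrow>\<^sub>M incr_space n"
    by (intro measurable_restrict)
  then show ?thesis
    unfolding end_majorant_def[abs_def] s by (rule measurable_compose[OF _ concave_majorant_walk_measurable[OF n]])
qed

lemma sorted_slopes_measurable: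
  assumes "\<And>i. i \<in> set is \<Longrightarrow> s i \<in> borel_measurable M"
  shows "Measurable.pred M (\<lambda>e. sorted_wrt (\<ge>) (map (\<lambda>i. s i e :: real) is))"
proof -
  have iff: "sorted_wrt (\<ge>) (map (\<lambda>i. s i e) is) \<longleftrightarrow> (\<forall>j\<in>{..<length is}. \<forall>i\<in>{..<j}. s (is ! j) e \<le> s (is ! i) e)" for e
    by (auto simp: sorted_wrt_iff_nth_less)
  show ?thesis unfolding iff
  proof (intro pred_intros_finite(3) finite_lessThan pred_le_real)
    fix i j assume "j \<in> {..<length is}" "i \<in> {..<j}"
    then show "s (is ! j) \<in> borel_measurable M" "s (is ! i) \<in> borel_measurable M"
      by (auto intro!: assms)
  qed
qed

lemma end_weight_measurable: "end_weight n ns \<in> borel_measurable (ends_space ns)"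
proof -
  let ?k = "length ns"
  have so: "Measurable.pred (ends_space ns) (\<lambda>e. sorted_wrt (\<ge>) (map (\<lambda>i. end_slope ns i e) is))" if "set is \<subseteq> {..<?k}" for "is"
    using that by (intro sorted_slopes_measurable end_slope_measurable) auto
  have ord: "real (orders (mset (end_slopes ns e))) =
      (\<Sum>\<tau>\<in>permutations_of_set {..<?k}. if sorted_wrt (\<ge>) (map (\<lambda>i. end_slope ns i e) \<tau>) then 1 else 0)" for e
  proof -
    have l: "length (end_slopes ns e) = ?k" by (simp add: end_slopes_def)
    have "orders (mset (end_slopes ns e)) =
        card {\<tau> \<in> permutations_of_set {..<?k}. sorted_wrt (\<ge>) (map ((!) (end_slopes ns e)) \<tau>)}"
      unfolding orders_mset l by (rule card_sorted_orders[OF finite_lessThan, symmetric])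
    also have "\<dots> = card {\<tau> \<in> permutations_of_set {..<?k}. sorted_wrt (\<ge>) (map (\<lambda>i. end_slope ns i e) \<tau>)}"
    proof -
      have "map ((!) (end_slopes ns e)) \<tau> = map (\<lambda>i. end_slope ns i e) \<tau>" if "\<tau> \<in> permutations_of_set {..<?k}" for \<tau>
        using permutations_of_setD(1)[OF that] by (intro map_cong refl) (simp add: end_slopes_def)
      then show ?thesis by (intro arg_cong[of _ _ card] Collect_cong conj_cong refl) (simp only:)
    qed
    finally show ?thesis using sum.inter_filter[OF finite_permutations_of_set[of "{..<?k}"], of "\<lambda>_. 1 :: real"] by simp
  qed
  have om: "(\<lambda>e. real (orders (mset (end_slopes ns e)))) \<in> borel_measurable (ends_space ns)"
    unfolding ord
  proof (rule borel_measurable_sum)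
    fix \<tau> assume "\<tau> \<in> permutations_of_set {..<?k}"
    then have "set \<tau> \<subseteq> {..<?k}" by (simp add: permutations_of_setD)
    then show "(\<lambda>e. if sorted_wrt (\<ge>) (map (\<lambda>i. end_slope ns i e) \<tau>) then 1 else 0 :: real) \<in> borel_measurable (ends_space ns)"
      by (intro measurable_If borel_measurable_const predE so)
  qed
  show ?thesis
    unfolding end_weight_def[abs_def]
  proof (rule measurable_If)
    show "(\<lambda>e. 1 / (real (card (cyclic_permutations n ns)) * real (orders (mset (end_slopes ns e))))) \<in> borel_measurable (ends_space ns)"
      by (intro borel_measurable_divide borel_measurable_times borel_measurable_const om)
    show "{e \<in> space (ends_space ns). sorted_wrt (\<ge>) (end_slopes ns e)} \<in> sets (ends_space ns)"
      unfolding end_slopes_def by (rule predE[OF so]) auto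
  qed simp
qed

lemma block_ends_walk_measurable:
  assumes ns: "ns \<in> compositions n"
  shows "(\<lambda>x. block_ends ns (walk n x)) \<in> incr_space n \<rightarrow>\<^sub>M ends_space ns"
  unfolding block_ends_def
proof (rule measurable_restrict)
  fix m
  have "sum_list (take m ns) + sum_list (drop m ns) = sum_list (take m ns @ drop m ns)" by (rule sum_list_append[symmetric])
  then have le: "sum_list (take m ns) \<le> n" using compositions_sum[OF ns] by simp
  show "(\<lambda>x. walk n x (sum_list (take m ns))) \<in> borel_measurable (incr_space n)"
    by (rule measurable_compose[OF walk_measurable], rule measurable_component_singleton) (use le in simp)
qed

lemma block_ends_concave_measurable: "(\<lambda>c. block_ends ns (\<lambda>j. c (real j))) \<in> concave_space n \<rightarrow>\<^sub>M ends_space ns"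
  unfolding block_ends_def by (rule measurable_restrict, rule concave_space_eval)

section \<open>Averaging over cyclic rearrangements\<close>

text \<open>
  Among the cyclic rearrangements of \<open>x\<close>, those below the majorant are the good ones. They all have the
  same weight, whose inverse is the number of orders of the blocks times the number of these rearrangements.
\<close>

lemma sum_cyclic_weights:
  fixes f :: "(nat \<Rightarrow> real) \<Rightarrow> ennreal"
  assumes ns: "ns \<in> compositions n" and n: "n \<ge> 1"
  defines "e \<equiv> \<lambda>x. block_ends ns (walk n x)"
  shows "(\<Sum>\<sigma>\<in>cyclic_permutations n ns. f (permute_incr n \<sigma> x) * ennreal (composition_weight ns (permute_incr n \<sigma> x)))
      * ennreal (1 / real (card (cyclic_permutations n ns)))
    = ennreal (end_weight n ns (e x)) * choice_average n ns f (end_majorant ns (e x)) x"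
proof -
  let ?cyc = "cyclic_permutations n ns"
  let ?N = "real (card ?cyc)"
  have s: "sum_list ns = n" by (rule compositions_sum[OF ns])
  have fin: "finite ?cyc" by (rule finite_cyclic_permutations[OF ns])
  have es: "end_slopes ns (e x) = map mean (blocks ns x)" using end_slopes_walk[of ns x] unfolding s e_def .
  show ?thesis
  proof (cases "sorted_wrt (\<ge>) (map mean (blocks ns x))")
    case False
    have "composition_weight ns (permute_incr n \<sigma> x) = 0" if "\<sigma> \<in> ?cyc" for \<sigma>
      using False cyclic_invariants(1)[OF ns that, of x] unfolding composition_weight_def good_def by (simp only: simp_thms if_False)
    then have "(\<Sum>\<sigma>\<in>?cyc. f (permute_incr n \<sigma> x) * ennreal (composition_weight ns (permute_incr n \<sigma> x))) = 0"
      by (intro sum.neutral ballI) simp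
    moreover have "end_weight n ns (e x) = 0" unfolding end_weight_def es using False by simp
    ultimately show ?thesis by simp
  next
    case True
    let ?c = "polygon (levelled (blocks ns x))"
    let ?D = "dominated_permutations n ?c ns x"
    let ?O = "real (orders (mset (map mean (blocks ns x))))"
    have maj: "end_majorant ns (e x) = ?c" using end_majorant_walk[OF True] n unfolding s e_def by blast
    have D: "card ?D = prod_list (map shifts (blocks ns x))" "?D \<noteq> {}" by (rule card_dominated[OF ns n True])+
    have finD: "finite ?D" by (rule finite_subset[OF _ fin]) (auto simp: dominated_permutations_def)
    have g: "real (good_arrangements (blocks ns x)) = ?O * real (card ?D)"
      unfolding good_arrangements_def D(1) by simp
    have pos: "0 < ?O" "0 < real (card ?D)" "0 < ?N"
      using orders_pos finD D(2) fin cyclic_permutations_nonempty[OF ns] by (simp_all add: card_gt_0_iff)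
    have w: "composition_weight ns (permute_incr n \<sigma> x) = (if \<sigma> \<in> ?D then 1 / (?O * real (card ?D)) else 0)" if "\<sigma> \<in> ?cyc" for \<sigma>
      unfolding composition_weight_def dominated_iff_good[OF ns n True that] cyclic_invariants(2)[OF ns that] g ..
    have "(\<Sum>\<sigma>\<in>?cyc. f (permute_incr n \<sigma> x) * ennreal (composition_weight ns (permute_incr n \<sigma> x)))
        = (\<Sum>\<sigma>\<in>?D. f (permute_incr n \<sigma> x) * ennreal (1 / (?O * real (card ?D))))"
    proof (rule sum.mono_neutral_cong_right[OF fin])
      show "?D \<subseteq> ?cyc" by (auto simp: dominated_permutations_def)
      show "\<forall>\<sigma>\<in>?cyc - ?D. f (permute_incr n \<sigma> x) * ennreal (composition_weight ns (permute_incr n \<sigma> x)) = 0"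
      proof
        fix \<sigma> assume "\<sigma> \<in> ?cyc - ?D"
        then have "\<sigma> \<in> ?cyc" "\<sigma> \<notin> ?D" by blast+
        then show "f (permute_incr n \<sigma> x) * ennreal (composition_weight ns (permute_incr n \<sigma> x)) = 0"
          by (simp only: w if_False ennreal_0 mult_zero_right)
      qed
      fix \<sigma> assume d: "\<sigma> \<in> ?D"
      then have "\<sigma> \<in> ?cyc" by (simp add: dominated_permutations_def)
      then show "f (permute_incr n \<sigma> x) * ennreal (composition_weight ns (permute_incr n \<sigma> x)) = f (permute_incr n \<sigma> x) * ennreal (1 / (?O * real (card ?D)))"
        using d by (simp only: w if_True)
    qed
    also have "\<dots> = (\<Sum>\<sigma>\<in>?D. f (permute_incr n \<sigma> x)) * ennreal (1 / (?O * real (card ?D)))"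
      by (rule sum_distrib_right[symmetric])
    finally have lhs: "(\<Sum>\<sigma>\<in>?cyc. f (permute_incr n \<sigma> x) * ennreal (composition_weight ns (permute_incr n \<sigma> x))) * ennreal (1 / ?N)
        = (\<Sum>\<sigma>\<in>?D. f (permute_incr n \<sigma> x)) * (ennreal (1 / (?O * real (card ?D))) * ennreal (1 / ?N))"
      by (simp only: mult.assoc)
    have "choice_average n ns f ?c x = (\<Sum>\<sigma>\<in>?D. f (permute_incr n \<sigma> x)) / card ?D"
      unfolding choice_average_def by (rule nn_integral_pmf_of_set[OF D(2) finD])
    also have "\<dots> = (\<Sum>\<sigma>\<in>?D. f (permute_incr n \<sigma> x)) * ennreal (1 / real (card ?D))"
    proof -
      have "inverse (of_nat (card ?D)) = ennreal (1 / real (card ?D))"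
        using pos(2) by (simp add: ennreal_of_nat_eq_real_of_nat inverse_ennreal inverse_eq_divide)
      then show ?thesis unfolding divide_ennreal_def by (rule arg_cong)
    qed
    finally have ca: "choice_average n ns f ?c x = (\<Sum>\<sigma>\<in>?D. f (permute_incr n \<sigma> x)) * ennreal (1 / real (card ?D))" .
    have ew: "end_weight n ns (e x) = 1 / (?N * ?O)" unfolding end_weight_def es using True by simp
    have "ennreal (1 / (?O * real (card ?D))) * ennreal (1 / ?N) = ennreal (1 / (?O * real (card ?D)) * (1 / ?N))"
      using pos by (intro ennreal_mult[symmetric]) simp_all
    also have "1 / (?O * real (card ?D)) * (1 / ?N) = 1 / (?N * ?O) * (1 / real (card ?D))" using pos by simp
    also have "ennreal (1 / (?N * ?O) * (1 / real (card ?D))) = ennreal (1 / (?N * ?O)) * ennreal (1 / real (card ?D))"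
      using pos by (intro ennreal_mult) simp_all
    finally have "ennreal (1 / (?O * real (card ?D))) * ennreal (1 / ?N) = ennreal (1 / (?N * ?O)) * ennreal (1 / real (card ?D))" .
    then show ?thesis unfolding lhs maj ca ew by (simp only: mult.left_commute mult.commute)
  qed
qed

text \<open>
  By exchangeability the left side does not change if \<open>x\<close> is replaced by a cyclic rearrangement in
  \<open>f\<close> and in the weight; \<open>e\<close> is invariant. Now take the mean over all cyclic rearrangements.
\<close>

lemma composition_weight_average:
  fixes f G :: "(nat \<Rightarrow> real) \<Rightarrow> ennreal"
  assumes X: "\<And>i. i \<in> {1..n} \<Longrightarrow> X i \<in> borel_measurable M" and ex: "exchangeable M n X"
    and ns: "ns \<in> compositions n" and n: "n \<ge> 1"
    and f: "f \<in> borel_measurable (incr_space n)" and G: "G \<in> borel_measurable (ends_space ns)"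
  defines "e \<equiv> \<lambda>x. block_ends ns (walk n x)"
  shows "(\<integral>\<^sup>+ x. f x * G (e x) * ennreal (composition_weight ns x) \<partial>distr M (incr_space n) (increments n X))
    = (\<integral>\<^sup>+ x. G (e x) * (ennreal (end_weight n ns (e x)) * choice_average n ns f (end_majorant ns (e x)) x)
        \<partial>distr M (incr_space n) (increments n X))"
proof -
  let ?\<mu> = "distr M (incr_space n) (increments n X)"
  let ?cyc = "cyclic_permutations n ns"
  let ?\<phi> = "\<lambda>x. f x * G (e x) * ennreal (composition_weight ns x)"
  let ?J = "\<integral>\<^sup>+ x. ?\<phi> x \<partial>?\<mu>"
  have em: "e \<in> incr_space n \<rightarrow>\<^sub>M ends_space ns" unfolding e_def by (rule block_ends_walk_measurable[OF ns])
  have \<phi>: "?\<phi> \<in> borel_measurable (incr_space n)"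
    by (intro borel_measurable_times_ennreal f measurable_compose[OF em G] measurable_compose[OF composition_weight_measurable measurable_ennreal])
  have \<phi>\<mu>: "(\<lambda>x. ?\<phi> (permute_incr n \<sigma> x)) \<in> borel_measurable ?\<mu>" for \<sigma>
    unfolding measurable_distr_eq1 by (rule measurable_compose[OF permute_incr_measurable \<phi>])
  have N: "0 < real (card ?cyc)"
    using finite_cyclic_permutations[OF ns] cyclic_permutations_nonempty[OF ns] by (simp add: card_gt_0_iff)
  have einv: "e (permute_incr n \<sigma> x) = e x" if "\<sigma> \<in> ?cyc" for \<sigma> x
    unfolding e_def by (rule cyclic_invariants(4)[OF ns that])
  have "?J = of_nat (card ?cyc) * (?J * ennreal (1 / real (card ?cyc)))"
  proof -
    have "of_nat (card ?cyc) * ennreal (1 / real (card ?cyc)) = 1"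
      using N by (simp add: ennreal_of_nat_eq_real_of_nat ennreal_mult[symmetric])
    then show ?thesis by (subst mult.left_commute) (simp only: mult_1_right)
  qed
  also have "\<dots> = (\<Sum>\<sigma>\<in>?cyc. (\<integral>\<^sup>+ x. ?\<phi> (permute_incr n \<sigma> x) \<partial>?\<mu>)) * ennreal (1 / real (card ?cyc))"
  proof -
    have "(\<Sum>\<sigma>\<in>?cyc. (\<integral>\<^sup>+ x. ?\<phi> (permute_incr n \<sigma> x) \<partial>?\<mu>)) = (\<Sum>\<sigma>\<in>?cyc. ?J)"
      by (intro sum.cong refl exchangeable_nn_integral[OF X ex cyclic_permutes[OF ns] \<phi>])
    then show ?thesis unfolding sum_constant by (simp only: mult.assoc)
  qed
  also have "\<dots> = (\<integral>\<^sup>+ x. (\<Sum>\<sigma>\<in>?cyc. ?\<phi> (permute_incr n \<sigma> x)) * ennreal (1 / real (card ?cyc)) \<partial>?\<mu>)"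
    unfolding nn_integral_sum[OF \<phi>\<mu>, symmetric]
    by (rule nn_integral_multc[symmetric], rule borel_measurable_sum, rule \<phi>\<mu>)
  also have "\<dots> = (\<integral>\<^sup>+ x. G (e x) * (ennreal (end_weight n ns (e x)) * choice_average n ns f (end_majorant ns (e x)) x) \<partial>?\<mu>)"
  proof (rule nn_integral_cong)
    fix x
    have "(\<Sum>\<sigma>\<in>?cyc. ?\<phi> (permute_incr n \<sigma> x)) =
        G (e x) * (\<Sum>\<sigma>\<in>?cyc. f (permute_incr n \<sigma> x) * ennreal (composition_weight ns (permute_incr n \<sigma> x)))"
      unfolding sum_distrib_left by (rule sum.cong[OF refl]) (simp only: einv mult.assoc mult.left_commute)
    then show "(\<Sum>\<sigma>\<in>?cyc. ?\<phi> (permute_incr n \<sigma> x)) * ennreal (1 / real (card ?cyc)) =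
        G (e x) * (ennreal (end_weight n ns (e x)) * choice_average n ns f (end_majorant ns (e x)) x)"
      using sum_cyclic_weights[OF ns n, of f x] unfolding e_def by (simp only: mult.assoc)
  qed
  finally show ?thesis .
qed

section \<open>The conditional law\<close>

lemma kernel_space_measurable:
  assumes "\<kappa> \<in> restrict_space T (space T) \<rightarrow>\<^sub>M N"
  shows "\<kappa> \<in> T \<rightarrow>\<^sub>M N"
proof -
  have eq: "sets (restrict_space T (space T)) = sets T"
  proof -
    have "(\<inter>) (space T) ` sets T = (\<lambda>A. A) ` sets T"
      by (rule image_cong[OF refl]) (rule sets.Int_space_eq1)
    then show ?thesis by (simp add: sets_restrict_space)
  qed
  from assms show ?thesis unfolding measurable_cong_sets[OF eq refl] .
qed

lemma choice_average_1: "choice_average n ns (\<lambda>_. 1) c y = 1"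
  unfolding choice_average_def by (simp add: measure_pmf.emeasure_space_1)

context
  fixes M :: "'a measure" and n :: nat and X :: "nat \<Rightarrow> 'a \<Rightarrow> real"
    and P :: "'a \<Rightarrow> nat \<Rightarrow> nat" and R :: "'a \<Rightarrow> nat list \<times> nat list"
  assumes M: "prob_space M" and n: "n \<ge> 1"
    and X_all: "\<forall>i\<in>{1..n}. X i \<in> borel_measurable M"
    and ex: "exchangeable M n X" and rho: "rho_construction M n X P R"
begin

lemma X_borel: "i \<in> {1..n} \<Longrightarrow> X i \<in> borel_measurable M"
  using X_all by blast

abbreviation incr_law :: "(nat \<Rightarrow> real) measure" where
  "incr_law \<equiv> distr M (incr_space n) (increments n X)"

abbreviation rho_incr :: "'a \<Rightarrow> nat \<Rightarrow> real" where
  "rho_incr \<omega> \<equiv> rho_increments n (increments n X \<omega>) (P \<omega>) (R \<omega>)"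

abbreviation rho_comp :: "'a \<Rightarrow> nat list" where
  "rho_comp \<omega> \<equiv> rho_composition n (increments n X \<omega>) (P \<omega>) (R \<omega>)"

abbreviation majorant :: "(nat \<Rightarrow> real) \<Rightarrow> real \<Rightarrow> real" where
  "majorant x \<equiv> concave_majorant n (walk n x)"

lemma increments_X: "increments n X \<in> M \<rightarrow>\<^sub>M incr_space n"
  by (rule increments_measurable[OF X_borel])

lemma rho_choice:
  assumes "\<omega> \<in> space M"
  shows "P \<omega> permutes {1..n}" "R \<omega> \<in> choices (cycle_lengths n (P \<omega>))"
proof -
  have "P \<in> M \<rightarrow>\<^sub>M count_space {p. p permutes {1..n}}" using rho unfolding rho_construction_def by blast
  from measurable_space[OF this assms] show "P \<omega> permutes {1..n}" by simp
  have "R \<omega> \<in> admissible_choices n (increments n X \<omega>) (P \<omega>)" using rho assms unfolding rho_construction_def by blast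
  then show "R \<omega> \<in> choices (cycle_lengths n (P \<omega>))" by (simp add: admissible_choices_eq)
qed

lemma rho_comp_in: "\<omega> \<in> space M \<Longrightarrow> rho_comp \<omega> \<in> compositions n"
  by (rule rho_composition_in[OF rho_choice])

text \<open>
  On the event that the composition is \<open>ns\<close>, the majorant is a function of the block ends.
\<close>

lemma rho_comp_law:
  assumes ns: "ns \<in> compositions n"
    and f: "f \<in> borel_measurable (incr_space n)" and H: "H \<in> borel_measurable (concave_space n)"
  shows "(\<integral>\<^sup>+ \<omega>. (if rho_comp \<omega> = ns then f (rho_incr \<omega>) * H (majorant (rho_incr \<omega>)) else 0) \<partial>M)
    = (\<integral>\<^sup>+ x. H (end_majorant ns (block_ends ns (walk n x))) *
        (ennreal (end_weight n ns (block_ends ns (walk n x))) *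
         choice_average n ns f (end_majorant ns (block_ends ns (walk n x))) x) \<partial>incr_law)"
proof -
  have s: "sum_list ns = n" by (rule compositions_sum[OF ns])
  have h: "(\<lambda>x. f x * H (majorant x)) \<in> borel_measurable (incr_space n)"
    by (intro borel_measurable_times_ennreal f measurable_compose[OF concave_majorant_walk_measurable[OF n] H])
  have "(\<integral>\<^sup>+ \<omega>. (if rho_comp \<omega> = ns then f (rho_incr \<omega>) * H (majorant (rho_incr \<omega>)) else 0) \<partial>M)
      = (\<integral>\<^sup>+ x. f x * H (majorant x) * ennreal (composition_weight ns x) \<partial>incr_law)"
    by (rule rho_law[OF M X_borel ex rho ns h])
  also have "\<dots> = (\<integral>\<^sup>+ x. f x * H (end_majorant ns (block_ends ns (walk n x))) * ennreal (composition_weight ns x) \<partial>incr_law)"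
  proof (rule nn_integral_cong)
    fix x
    show "f x * H (majorant x) * ennreal (composition_weight ns x) =
        f x * H (end_majorant ns (block_ends ns (walk n x))) * ennreal (composition_weight ns x)"
    proof (cases "good (blocks ns x)")
      case True
      then have "sorted_wrt (\<ge>) (map mean (blocks ns x))" by (simp only: good_def)
      then have "end_majorant ns (block_ends ns (walk n x)) = majorant x"
        using concave_majorant_walk[OF True] end_majorant_walk[of ns x] n unfolding s by (simp only:)
      then show ?thesis by (simp only:)
    qed (simp add: composition_weight_def)
  qed
  also have "\<dots> = (\<integral>\<^sup>+ x. H (end_majorant ns (block_ends ns (walk n x))) *
        (ennreal (end_weight n ns (block_ends ns (walk n x))) *
         choice_average n ns f (end_majorant ns (block_ends ns (walk n x))) x) \<partial>incr_law)"
    by (rule composition_weight_average[OF X_borel ex ns n f measurable_compose[OF end_majorant_measurable[OF ns n] H]])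
  finally show ?thesis .
qed

text \<open>
  Apply \<open>rho_comp_law\<close> to a function of the majorant alone, and then use that \<open>\<nu>\<close> is the conditional law of
  the increments given the block ends. The block ends are the values of the majorant there.
\<close>

lemma rho_comp_kernel_law:
  assumes ns: "ns \<in> compositions n"
    and \<nu>: "regular_cond_distr M (increments n X) (incr_space n)
              (\<lambda>\<omega>. block_ends ns (walk n (increments n X \<omega>))) (ends_space ns) (space (ends_space ns)) \<nu>"
    and \<psi>: "\<psi> \<in> borel_measurable (concave_space n \<Otimes>\<^sub>M incr_space n)"
  defines "\<Psi> \<equiv> \<lambda>c. \<integral>\<^sup>+ y. \<psi> (c, y) \<partial>\<nu> (block_ends ns (\<lambda>j. c (real j)))"
  shows "\<Psi> \<in> borel_measurable (concave_space n)"
    and "(\<integral>\<^sup>+ \<omega>. (if rho_comp \<omega> = ns then \<Psi> (majorant (rho_incr \<omega>)) else 0) \<partial>M)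
    = (\<integral>\<^sup>+ x. ennreal (end_weight n ns (block_ends ns (walk n x))) *
         \<psi> (end_majorant ns (block_ends ns (walk n x)), x) \<partial>incr_law)"
proof -
  let ?e = "\<lambda>x. block_ends ns (walk n x)"
  let ?L = "end_majorant ns"
  let ?g = "\<lambda>e. ennreal (end_weight n ns e)"
  have s: "sum_list ns = n" by (rule compositions_sum[OF ns])
  have em: "?e \<in> incr_space n \<rightarrow>\<^sub>M ends_space ns" by (rule block_ends_walk_measurable[OF ns])
  have Lm: "?L \<in> ends_space ns \<rightarrow>\<^sub>M concave_space n" by (rule end_majorant_measurable[OF ns n])
  have gm: "?g \<in> borel_measurable (ends_space ns)" by (rule measurable_compose[OF end_weight_measurable measurable_ennreal])
  have k: "\<nu> \<in> ends_space ns \<rightarrow>\<^sub>M prob_algebra (incr_space n)"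
    by (rule kernel_space_measurable[OF regular_cond_distrD(4)[OF \<nu>]])
  have kc: "(\<lambda>c. \<nu> (block_ends ns (\<lambda>j. c (real j)))) \<in> concave_space n \<rightarrow>\<^sub>M subprob_algebra (incr_space n)"
    by (rule measurable_compose[OF block_ends_concave_measurable measurable_prob_algebraD[OF k]])
  show \<Psi>: "\<Psi> \<in> borel_measurable (concave_space n)"
    unfolding \<Psi>_def by (rule nn_integral_measurable_subprob_algebra2[OF _ kc]) (simp only: case_prod_eta \<psi>)
  define F where "F = (\<lambda>z. ?g (fst z) * \<psi> (?L (fst z), snd z))"
  have pairm: "(\<lambda>z. (?L (fst z), snd z)) \<in> ends_space ns \<Otimes>\<^sub>M incr_space n \<rightarrow>\<^sub>M concave_space n \<Otimes>\<^sub>M incr_space n"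
    by (rule measurable_Pair[OF measurable_compose[OF measurable_fst Lm] measurable_snd])
  have F: "F \<in> borel_measurable (ends_space ns \<Otimes>\<^sub>M incr_space n)"
    unfolding F_def by (intro borel_measurable_times_ennreal measurable_compose[OF measurable_fst gm] measurable_compose[OF pairm \<psi>])
  have eX: "(\<lambda>\<omega>. ?e (increments n X \<omega>)) \<in> M \<rightarrow>\<^sub>M ends_space ns" by (rule measurable_compose[OF increments_X em])
  have inner: "?g e * (\<integral>\<^sup>+ y. \<psi> (?L e, y) \<partial>\<nu> e) = (\<integral>\<^sup>+ y. F (e, y) \<partial>\<nu> e)" if e: "e \<in> space (ends_space ns)" for e
  proof -
    have sk: "sets (\<nu> e) = sets (incr_space n)" using measurable_space[OF k e] by (simp add: space_prob_algebra)
    have "(\<lambda>y. \<psi> (?L e, y)) \<in> borel_measurable (\<nu> e)" unfolding measurable_cong_sets[OF sk refl]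
      by (rule measurable_compose[OF measurable_Pair1'[OF measurable_space[OF Lm e]] \<psi>])
    then show ?thesis unfolding F_def fst_conv snd_conv by (rule nn_integral_cmult[symmetric])
  qed
  have F1: "F (?e x, x) = ?g (?e x) * \<psi> (?L (?e x), x)" for x unfolding F_def fst_conv snd_conv ..
  have F1m: "(\<lambda>x. F (?e x, x)) \<in> borel_measurable incr_law"
  proof -
    have "(\<lambda>x. (?e x, x)) \<in> incr_space n \<rightarrow>\<^sub>M ends_space ns \<Otimes>\<^sub>M incr_space n"
      by (rule measurable_Pair[OF em measurable_ident[unfolded id_def]])
    then show ?thesis unfolding measurable_distr_eq1 by (rule measurable_compose[OF _ F])
  qed
  have Km: "(\<lambda>e. ?g e * (\<integral>\<^sup>+ y. \<psi> (?L e, y) \<partial>\<nu> e)) \<in> borel_measurable (ends_space ns)"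
  proof (rule borel_measurable_times_ennreal[OF gm])
    have h: "(\<lambda>(e, y). \<psi> (?L e, y)) \<in> borel_measurable (ends_space ns \<Otimes>\<^sub>M incr_space n)"
      unfolding case_prod_beta by (rule measurable_compose[OF pairm \<psi>])
    show "(\<lambda>e. \<integral>\<^sup>+ y. \<psi> (?L e, y) \<partial>\<nu> e) \<in> borel_measurable (ends_space ns)"
      by (rule nn_integral_measurable_subprob_algebra2[OF h measurable_prob_algebraD[OF k]])
  qed
  have "(\<integral>\<^sup>+ \<omega>. (if rho_comp \<omega> = ns then \<Psi> (majorant (rho_incr \<omega>)) else 0) \<partial>M)
      = (\<integral>\<^sup>+ x. \<Psi> (?L (?e x)) * ?g (?e x) \<partial>incr_law)"
    using rho_comp_law[OF ns borel_measurable_const[of 1] \<Psi>] unfolding choice_average_1 mult_1_left mult_1_right .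
  also have "\<dots> = (\<integral>\<^sup>+ x. ?g (?e x) * (\<integral>\<^sup>+ y. \<psi> (?L (?e x), y) \<partial>\<nu> (?e x)) \<partial>incr_law)"
  proof (rule nn_integral_cong)
    fix x
    show "\<Psi> (?L (?e x)) * ?g (?e x) = ?g (?e x) * (\<integral>\<^sup>+ y. \<psi> (?L (?e x), y) \<partial>\<nu> (?e x))"
    proof (cases "sorted_wrt (\<ge>) (map mean (blocks ns x))")
      case True
      have L: "?L (?e x) = polygon (levelled (blocks ns x))" using end_majorant_walk[OF True] n unfolding s by blast
      have "block_ends ns (\<lambda>j. ?L (?e x) (real j)) = ?e x"
        using block_ends_polygon[OF True] n unfolding s L by blast
      then show ?thesis unfolding \<Psi>_def by (simp only: mult.commute)
    next
      case False
      have "end_slopes ns (?e x) = map mean (blocks ns x)" using end_slopes_walk[of ns x] unfolding s .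
      then have "end_weight n ns (?e x) = 0" using False unfolding end_weight_def by (simp only: if_False)
      then show ?thesis by simp
    qed
  qed
  also have "\<dots> = (\<integral>\<^sup>+ \<omega>. ?g (?e (increments n X \<omega>)) * (\<integral>\<^sup>+ y. \<psi> (?L (?e (increments n X \<omega>)), y) \<partial>\<nu> (?e (increments n X \<omega>))) \<partial>M)"
    by (rule nn_integral_distr[OF increments_X]) (unfold measurable_distr_eq1, rule measurable_compose[OF em Km])
  also have "\<dots> = (\<integral>\<^sup>+ e. ?g e * (\<integral>\<^sup>+ y. \<psi> (?L e, y) \<partial>\<nu> e) \<partial>distr M (ends_space ns) (\<lambda>\<omega>. ?e (increments n X \<omega>)))"
    by (rule nn_integral_distr[OF eX, symmetric]) (unfold measurable_distr_eq1, rule Km)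
  also have "\<dots> = (\<integral>\<^sup>+ e\<in>space (ends_space ns). (\<integral>\<^sup>+ y. F (e, y) \<partial>\<nu> e) \<partial>distr M (ends_space ns) (\<lambda>\<omega>. ?e (increments n X \<omega>)))"
    by (rule nn_integral_cong) (simp add: inner)
  also have "\<dots> = (\<integral>\<^sup>+ \<omega>. F (?e (increments n X \<omega>), increments n X \<omega>) \<partial>M)"
    by (rule regular_cond_distr_nn_integral[OF M \<nu> F, symmetric])
  also have "\<dots> = (\<integral>\<^sup>+ x. F (?e x, x) \<partial>incr_law)"
    by (rule nn_integral_distr[OF increments_X F1m, symmetric])
  finally show "(\<integral>\<^sup>+ \<omega>. (if rho_comp \<omega> = ns then \<Psi> (majorant (rho_incr \<omega>)) else 0) \<partial>M)
    = (\<integral>\<^sup>+ x. ?g (?e x) * \<psi> (?L (?e x), x) \<partial>incr_law)" unfolding F1 .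
qed

lemma nn_integral_sum_rho_comp:
  assumes F: "\<And>ns. ns \<in> compositions n \<Longrightarrow> (\<lambda>\<omega>. if rho_comp \<omega> = ns then F ns \<omega> else 0) \<in> borel_measurable M"
  shows "(\<integral>\<^sup>+ \<omega>. F (rho_comp \<omega>) \<omega> \<partial>M) = (\<Sum>ns\<in>compositions n. \<integral>\<^sup>+ \<omega>. (if rho_comp \<omega> = ns then F ns \<omega> else 0) \<partial>M)"
proof -
  have "(\<integral>\<^sup>+ \<omega>. F (rho_comp \<omega>) \<omega> \<partial>M) = (\<integral>\<^sup>+ \<omega>. (\<Sum>ns\<in>compositions n. if rho_comp \<omega> = ns then F ns \<omega> else 0) \<partial>M)"
    by (rule nn_integral_cong) (simp add: finite_compositions rho_comp_in)
  also have "\<dots> = (\<Sum>ns\<in>compositions n. \<integral>\<^sup>+ \<omega>. (if rho_comp \<omega> = ns then F ns \<omega> else 0) \<partial>M)"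
    by (rule nn_integral_sum[OF F])
  finally show ?thesis .
qed

text \<open>
  For each of the countably many values of the permutation and the choice, the rearrangement is a fixed
  permutation of the coordinates.
\<close>

lemma rho_incr_measurable: "rho_incr \<in> M \<rightarrow>\<^sub>M incr_space n"
proof -
  let ?Perm = "{p. p permutes {1..n}}"
  have P: "P \<in> M \<rightarrow>\<^sub>M count_space ?Perm" using rho unfolding rho_construction_def by blast
  have Rm: "R \<in> M \<rightarrow>\<^sub>M count_space UNIV" 
  proof -
    have "regular_cond_distr M R (count_space UNIV)
       (\<lambda>\<omega>. (increments n X \<omega>, P \<omega>)) (incr_space n \<Otimes>\<^sub>M count_space ?Perm) (space (incr_space n \<Otimes>\<^sub>M count_space ?Perm))
       (\<lambda>(x, p). measure_pmf (pmf_of_set (admissible_choices n x p)))"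
      using rho unfolding rho_construction_def by (elim conjE)
    then show ?thesis by (rule regular_cond_distrD(1))
  qed
  have finP: "countable ?Perm" by (rule countable_finite[OF finite_permutations]) simp
  define \<sigma> where "\<sigma> p ch = (SOME s. \<forall>x. rho_increments n x p ch = permute_incr n s x)" for p ch
  have \<sigma>: "rho_increments n x p ch = permute_incr n (\<sigma> p ch) x" if "p permutes {1..n}" "ch \<in> choices (cycle_lengths n p)" for x p ch
  proof -
    have "\<exists>s. \<forall>x. rho_increments n x p ch = permute_incr n s x" using rearrangement_permutes[OF that] by blast
    from someI_ex[OF this] show ?thesis unfolding \<sigma>_def by blast
  qed
  have "(\<lambda>\<omega>. permute_incr n (\<sigma> (P \<omega>) (R \<omega>)) (increments n X \<omega>)) \<in> M \<rightarrow>\<^sub>M incr_space n"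
  proof -
    have "(\<lambda>\<omega>. (\<lambda>p \<omega>. permute_incr n (\<sigma> p ch) (increments n X \<omega>)) (P \<omega>) \<omega>) \<in> M \<rightarrow>\<^sub>M incr_space n" for ch
      by (rule measurable_compose_countable'[OF measurable_compose[OF increments_X permute_incr_measurable] P finP])
    then have "(\<lambda>\<omega>. (\<lambda>ch \<omega>. permute_incr n (\<sigma> (P \<omega>) ch) (increments n X \<omega>)) (R \<omega>) \<omega>) \<in> M \<rightarrow>\<^sub>M incr_space n"
      by (rule measurable_compose_countable'[OF _ Rm]) auto
    then show ?thesis .
  qed
  then show ?thesis
    by (rule measurable_cong[THEN iffD2, rotated]) (rule \<sigma>[OF rho_choice])
qed

text \<open>
  Sum \<open>rho_law\<close> over all compositions: the weights add up to \<open>1\<close>.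
\<close>

theorem rho_incr_law:
  assumes \<Xi>: "rho_comp \<in> M \<rightarrow>\<^sub>M count_space (compositions n)"
    and h: "h \<in> borel_measurable (incr_space n)"
  shows "(\<integral>\<^sup>+ \<omega>. h (rho_incr \<omega>) \<partial>M) = (\<integral>\<^sup>+ x. h x \<partial>incr_law)"
proof -
  have ind: "Measurable.pred M (\<lambda>\<omega>. rho_comp \<omega> = ns)" for ns
    by (rule measurable_compose[OF \<Xi>]) simp
  have m: "(\<lambda>\<omega>. if rho_comp \<omega> = ns then h (rho_incr \<omega>) else 0) \<in> borel_measurable M" for ns
    by (rule measurable_If[OF measurable_compose[OF rho_incr_measurable h] borel_measurable_const predE[OF ind]])
  have w: "(\<lambda>x. h x * ennreal (composition_weight ns x)) \<in> borel_measurable incr_law" for ns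
    unfolding measurable_distr_eq1
    by (intro borel_measurable_times_ennreal h measurable_compose[OF composition_weight_measurable measurable_ennreal])
  have "(\<integral>\<^sup>+ \<omega>. h (rho_incr \<omega>) \<partial>M) = (\<Sum>ns\<in>compositions n. \<integral>\<^sup>+ \<omega>. (if rho_comp \<omega> = ns then h (rho_incr \<omega>) else 0) \<partial>M)"
    by (rule nn_integral_sum_rho_comp[of "\<lambda>_ \<omega>. h (rho_incr \<omega>)", OF m])
  also have "\<dots> = (\<Sum>ns\<in>compositions n. \<integral>\<^sup>+ x. h x * ennreal (composition_weight ns x) \<partial>incr_law)"
    by (intro sum.cong refl rho_law[OF M X_borel ex rho _ h])
  also have "\<dots> = (\<integral>\<^sup>+ x. (\<Sum>ns\<in>compositions n. h x * ennreal (composition_weight ns x)) \<partial>incr_law)"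
    by (rule nn_integral_sum[OF w, symmetric])
  also have "\<dots> = (\<integral>\<^sup>+ x. h x \<partial>incr_law)"
  proof (rule nn_integral_cong)
    fix x
    have "(\<Sum>ns\<in>compositions n. ennreal (composition_weight ns x)) = ennreal (\<Sum>ns\<in>compositions n. composition_weight ns x)"
      by (rule sum_ennreal) (rule composition_weight_nonneg)
    then show "(\<Sum>ns\<in>compositions n. h x * ennreal (composition_weight ns x)) = h x"
      unfolding sum_distrib_left[symmetric] sum_composition_weight by simp
  qed
  finally show ?thesis .
qed

text \<open>
  Given composition and majorant, the rearranged increments are a uniform dominated cyclic permutation of
  a sample from \<open>\<nu>\<close>: both sides are the same integral over the law of the original increments.
\<close>

lemma conditional_average:
  assumes ns: "ns \<in> compositions n"
    and \<nu>: "regular_cond_distr M (increments n X) (incr_space n)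
              (\<lambda>\<omega>. block_ends ns (walk n (increments n X \<omega>))) (ends_space ns) (space (ends_space ns)) \<nu>"
    and f: "f \<in> borel_measurable (incr_space n)" and H: "H \<in> borel_measurable (concave_space n)"
  shows "(\<integral>\<^sup>+ \<omega>. (if rho_comp \<omega> = ns then f (rho_incr \<omega>) * H (majorant (rho_incr \<omega>)) else 0) \<partial>M)
    = (\<integral>\<^sup>+ \<omega>. (if rho_comp \<omega> = ns then (\<lambda>c. \<integral>\<^sup>+ y. H c * choice_average n ns f c y
          \<partial>\<nu> (block_ends ns (\<lambda>j. c (real j)))) (majorant (rho_incr \<omega>)) else 0) \<partial>M)"
proof -
  have \<psi>: "(\<lambda>z. H (fst z) * choice_average n ns f (fst z) (snd z)) \<in> borel_measurable (concave_space n \<Otimes>\<^sub>M incr_space n)"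
    by (intro borel_measurable_times_ennreal measurable_compose[OF measurable_fst H] choice_average_measurable[OF ns f])
  show ?thesis
    unfolding rho_comp_law[OF ns f H] using rho_comp_kernel_law(2)[OF ns \<nu> \<psi>]
    unfolding fst_conv snd_conv by (simp only: mult.left_commute)
qed

text \<open>
  Where \<open>end_weight\<close> does not vanish, the slopes are non-increasing, and then each block has a rotation
  below its chord.
\<close>

lemma dominated_nonempty:
  assumes ns: "ns \<in> compositions n"
    and \<nu>: "regular_cond_distr M (increments n X) (incr_space n)
              (\<lambda>\<omega>. block_ends ns (walk n (increments n X \<omega>))) (ends_space ns) (space (ends_space ns)) \<nu>"
  shows "(\<integral>\<^sup>+ \<omega>. (if rho_comp \<omega> = ns then (\<lambda>c. \<integral>\<^sup>+ y. indicator {y. dominated_permutations n c ns y = {}} y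
          \<partial>\<nu> (block_ends ns (\<lambda>j. c (real j)))) (majorant (rho_incr \<omega>)) else 0) \<partial>M) = 0"
    and "(\<lambda>c. \<integral>\<^sup>+ y. indicator {y. dominated_permutations n c ns y = {}} y \<partial>\<nu> (block_ends ns (\<lambda>j. c (real j))))
      \<in> borel_measurable (concave_space n)"
proof -
  let ?\<psi> = "\<lambda>z. (if dominated_permutations n (fst z) ns (snd z) = {} then 1 else 0 :: ennreal)"
  have s: "sum_list ns = n" by (rule compositions_sum[OF ns])
  have \<psi>: "?\<psi> \<in> borel_measurable (concave_space n \<Otimes>\<^sub>M incr_space n)"
    by (rule measurable_If[OF borel_measurable_const borel_measurable_const predE[OF dominated_eq_measurable[OF ns empty_subsetI]]])
  have ind: "(indicator {y. dominated_permutations n c ns y = {}} y :: ennreal) = ?\<psi> (c, y)" for c y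
    unfolding fst_conv snd_conv indicator_def by simp
  show "(\<lambda>c. \<integral>\<^sup>+ y. indicator {y. dominated_permutations n c ns y = {}} y \<partial>\<nu> (block_ends ns (\<lambda>j. c (real j))))
      \<in> borel_measurable (concave_space n)"
    unfolding ind by (rule rho_comp_kernel_law(1)[OF ns \<nu> \<psi>])
  have z: "ennreal (end_weight n ns (block_ends ns (walk n x))) * ?\<psi> (end_majorant ns (block_ends ns (walk n x)), x) = 0" for x
  proof (cases "sorted_wrt (\<ge>) (map mean (blocks ns x))")
    case True
    have "end_majorant ns (block_ends ns (walk n x)) = polygon (levelled (blocks ns x))"
      using end_majorant_walk[OF True] n unfolding s by blast
    then show ?thesis using card_dominated(2)[OF ns n True] by simp
  next
    case False
    have "end_slopes ns (block_ends ns (walk n x)) = map mean (blocks ns x)" using end_slopes_walk[of ns x] unfolding s .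
    then have "end_weight n ns (block_ends ns (walk n x)) = 0" using False unfolding end_weight_def by (simp only: if_False)
    then show ?thesis by simp
  qed
  show "(\<integral>\<^sup>+ \<omega>. (if rho_comp \<omega> = ns then (\<lambda>c. \<integral>\<^sup>+ y. indicator {y. dominated_permutations n c ns y = {}} y
          \<partial>\<nu> (block_ends ns (\<lambda>j. c (real j)))) (majorant (rho_incr \<omega>)) else 0) \<partial>M) = 0"
    unfolding ind rho_comp_kernel_law(2)[OF ns \<nu> \<psi>] z by simp
qed

end

lemma walk_permute: "walk n (y \<circ> \<sigma>) = walk n (permute_incr n \<sigma> y)"
  unfolding walk_def by (intro restrict_ext sum.cong refl) (simp add: permute_incr_def)

lemma rho_hat_kernel_measurable:
  assumes ns: "ns \<in> compositions n"
  defines "K \<equiv> \<lambda>z. distr (measure_pmf (pmf_of_set (dominated_permutations n (fst z) ns (snd z)))) (walk_space n) (\<lambda>\<sigma>. walk n (snd z \<circ> \<sigma>))"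
  shows "K \<in> concave_space n \<Otimes>\<^sub>M incr_space n \<rightarrow>\<^sub>M prob_algebra (walk_space n)"
    and "A \<in> sets (walk_space n) \<Longrightarrow> emeasure (K z) A = choice_average n ns (\<lambda>x. indicator A (walk n x)) (fst z) (snd z)"
proof -
  have w: "(\<lambda>\<sigma>. walk n (y \<circ> \<sigma>)) \<in> measure_pmf p \<rightarrow>\<^sub>M walk_space n" for y :: "nat \<Rightarrow> real" and p :: "(nat \<Rightarrow> nat) pmf"
    by (auto simp: walk_def space_PiM)
  have ps: "prob_space (K z)" for z unfolding K_def by (rule measure_pmf.prob_space_distr[OF w])
  show em: "emeasure (K z) A = choice_average n ns (\<lambda>x. indicator A (walk n x)) (fst z) (snd z)" if A: "A \<in> sets (walk_space n)" for z A
  proof -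
    let ?p = "measure_pmf (pmf_of_set (dominated_permutations n (fst z) ns (snd z)))"
    have "emeasure (K z) A = (\<integral>\<^sup>+ w. indicator A w \<partial>K z)" using A by (simp add: K_def)
    also have "\<dots> = (\<integral>\<^sup>+ \<sigma>. indicator A (walk n (snd z \<circ> \<sigma>)) \<partial>?p)"
      unfolding K_def by (rule nn_integral_distr[OF w]) (use A in simp)
    finally show ?thesis unfolding walk_permute choice_average_def .
  qed
  show "K \<in> concave_space n \<Otimes>\<^sub>M incr_space n \<rightarrow>\<^sub>M prob_algebra (walk_space n)"
  proof (intro measurable_prob_algebraI measurable_subprob_algebra ps prob_space_imp_subprob_space)
    show "sets (K z) = sets (walk_space n)" for z by (simp add: K_def)
    fix A assume A: "A \<in> sets (walk_space n)"
    have "(\<lambda>x. indicator A (walk n x)) \<in> borel_measurable (incr_space n)"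
      by (rule measurable_compose[OF walk_measurable borel_measurable_indicator[OF A]])
    then show "(\<lambda>z. emeasure (K z) A) \<in> borel_measurable (concave_space n \<Otimes>\<^sub>M incr_space n)"
      unfolding em[OF A] by (rule choice_average_measurable[OF ns])
  qed
qed

theorem theorem23:
  fixes M :: "'a measure"
    and n :: nat
    and X :: "nat \<Rightarrow> 'a \<Rightarrow> real"
    and P :: "'a \<Rightarrow> nat \<Rightarrow> nat"
    and R :: "'a \<Rightarrow> nat list \<times> nat list"
    and S :: "'a \<Rightarrow> nat \<Rightarrow> real"
    and C C\<^sub>\<rho> :: "'a \<Rightarrow> real \<Rightarrow> real"
    and \<Xi> :: "'a \<Rightarrow> nat list"
    and q :: "(real \<Rightarrow> real) \<Rightarrow> nat list measure"
    and \<nu> :: "nat list \<Rightarrow> (nat \<Rightarrow> real) \<Rightarrow> (nat \<Rightarrow> real) measure"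
  assumes "prob_space M"
    and "n \<ge> 1"
    and "\<And>i. i \<in> {1..n} \<Longrightarrow> X i \<in> borel_measurable M"
    and "exchangeable M n X"
    and "rho_construction M n X P R"
    and S: "\<And>\<omega>. S \<omega> = walk n (increments n X \<omega>)"
    and C: "\<And>\<omega>. C \<omega> = concave_majorant n (S \<omega>)"
    and C\<^sub>\<rho>: "\<And>\<omega>. C\<^sub>\<rho> \<omega> = concave_majorant n (rho_walk n (increments n X \<omega>) (P \<omega>) (R \<omega>))"
    and \<Xi>: "\<And>\<omega>. \<Xi> \<omega> = rho_composition n (increments n X \<omega>) (P \<omega>) (R \<omega>)"
    and q: "regular_cond_distr M \<Xi> (count_space (compositions n)) C\<^sub>\<rho> (concave_space n)
              (Supp n (distr M (concave_space n) C)) q"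
    and \<nu>: "\<And>ns. ns \<in> compositions n \<Longrightarrow>
              regular_cond_distr M (increments n X) (incr_space n)
                (\<lambda>\<omega>. block_ends ns (S \<omega>)) (ends_space ns) (space (ends_space ns)) (\<nu> ns)"
  shows "(AE c in distr M (concave_space n) C. AE ns in q c.
            AE y in \<nu> ns (block_ends ns (\<lambda>j. c (real j))). dominated_permutations n c ns y \<noteq> {}) \<and>
         regular_cond_distr M S (walk_space n) C (concave_space n)
           (Supp n (distr M (concave_space n) C)) (rho_hat_law n q \<nu>)"
proof -
  interpret prob_space M by fact
  have X_all: "\<forall>i\<in>{1..n}. X i \<in> borel_measurable M" using assms(3) by blast
  note hyps = assms(1,2) X_all assms(4,5)
  let ?D = "Supp n (distr M (concave_space n) C)"
  let ?\<mu> = "incr_law M n X"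
  let ?I = "rho_incr n X P R"
  let ?cm = "\<lambda>x. concave_majorant n (walk n x)"
  have C': "C = (\<lambda>\<omega>. ?cm (increments n X \<omega>))" using C S by (intro ext) simp
  have S': "S = (\<lambda>\<omega>. walk n (increments n X \<omega>))" using S by (intro ext) simp
  have \<Xi>': "\<Xi> = rho_comp n X P R" using \<Xi> by (intro ext) simp
  have C\<rho>': "C\<^sub>\<rho> \<omega> = ?cm (?I \<omega>)" if "\<omega> \<in> space M" for \<omega>
    unfolding C\<^sub>\<rho> by (simp only: rho_walk_eq[OF rho_choice[OF hyps that]])
  have iX: "increments n X \<in> M \<rightarrow>\<^sub>M incr_space n" by (rule increments_measurable[OF assms(3)])
  have cm: "?cm \<in> incr_space n \<rightarrow>\<^sub>M concave_space n" by (rule concave_majorant_walk_measurable[OF assms(2)])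
  have Sm: "S \<in> M \<rightarrow>\<^sub>M walk_space n" unfolding S' by (rule measurable_compose[OF iX walk_measurable])
  have Cm: "C \<in> M \<rightarrow>\<^sub>M concave_space n" unfolding C' by (rule measurable_compose[OF iX cm])
  have \<Xi>m: "\<Xi> \<in> M \<rightarrow>\<^sub>M count_space (compositions n)" and C\<rho>m: "C\<^sub>\<rho> \<in> M \<rightarrow>\<^sub>M concave_space n"
    and Dm: "?D \<in> sets (concave_space n)" and qm: "q \<in> restrict_space (concave_space n) ?D \<rightarrow>\<^sub>M prob_algebra (count_space (compositions n))"
    by (rule regular_cond_distrD[OF q])+
  have rm: "rho_comp n X P R \<in> M \<rightarrow>\<^sub>M count_space (compositions n)" using \<Xi>m unfolding \<Xi>' .
  have Im: "?I \<in> M \<rightarrow>\<^sub>M incr_space n" by (rule rho_incr_measurable[OF hyps])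
  have \<nu>': "regular_cond_distr M (increments n X) (incr_space n)
      (\<lambda>\<omega>. block_ends ns (walk n (increments n X \<omega>))) (ends_space ns) (space (ends_space ns)) (\<nu> ns)"
    if "ns \<in> compositions n" for ns using \<nu>[OF that] unfolding S .
  have \<nu>m: "\<nu> ns \<in> ends_space ns \<rightarrow>\<^sub>M prob_algebra (incr_space n)" if "ns \<in> compositions n" for ns
    by (rule kernel_space_measurable[OF regular_cond_distrD(4)[OF \<nu>[OF that]]])
  have lawC: "distr M (concave_space n) C\<^sub>\<rho> = distr M (concave_space n) C"
  proof (rule measure_eqI)
    fix B assume "B \<in> sets (distr M (concave_space n) C\<^sub>\<rho>)"
    then have B: "B \<in> sets (concave_space n)" by simp
    have h: "(\<lambda>x. indicator B (?cm x) :: ennreal) \<in> borel_measurable (incr_space n)"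
      by (rule measurable_compose[OF cm borel_measurable_indicator[OF B]])
    have "emeasure (distr M (concave_space n) C\<^sub>\<rho>) B = (\<integral>\<^sup>+ c. indicator B c \<partial>distr M (concave_space n) C\<^sub>\<rho>)" using B by simp
    also have "\<dots> = (\<integral>\<^sup>+ \<omega>. indicator B (C\<^sub>\<rho> \<omega>) \<partial>M)" by (rule nn_integral_distr[OF C\<rho>m]) (use B in simp)
    also have "\<dots> = (\<integral>\<^sup>+ \<omega>. indicator B (?cm (?I \<omega>)) \<partial>M)" by (rule nn_integral_cong) (simp only: C\<rho>')
    also have "\<dots> = (\<integral>\<^sup>+ x. indicator B (?cm x) \<partial>?\<mu>)" by (rule rho_incr_law[OF hyps rm h])
    also have "\<dots> = (\<integral>\<^sup>+ \<omega>. indicator B (C \<omega>) \<partial>M)"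
      unfolding C' by (rule nn_integral_distr[OF iX]) (use h in simp)
    also have "\<dots> = (\<integral>\<^sup>+ c. indicator B c \<partial>distr M (concave_space n) C)" by (rule nn_integral_distr[OF Cm, symmetric]) (use B in simp)
    also have "\<dots> = emeasure (distr M (concave_space n) C) B" using B by simp
    finally show "emeasure (distr M (concave_space n) C\<^sub>\<rho>) B = emeasure (distr M (concave_space n) C) B" .
  qed simp
  have AED: "AE c in distr M (concave_space n) C. c \<in> ?D"
    using regular_cond_distr_AE[OF assms(1) q] unfolding lawC .
  \<comment> \<open>Functions of the pair \<open>(C\<^sub>\<rho>, \<Xi>)\<close> integrate against \<open>q\<close>.\<close>
  have disint: "(\<Sum>ns\<in>compositions n. \<integral>\<^sup>+ \<omega>. (if rho_comp n X P R \<omega> = ns then \<Phi> ns (?cm (?I \<omega>)) else 0) \<partial>M)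
      = (\<integral>\<^sup>+ c\<in>?D. (\<integral>\<^sup>+ ns. \<Phi> ns c \<partial>q c) \<partial>distr M (concave_space n) C)"
    if \<Phi>: "\<And>ns. ns \<in> compositions n \<Longrightarrow> \<Phi> ns \<in> borel_measurable (concave_space n)" for \<Phi> :: "nat list \<Rightarrow> (real \<Rightarrow> real) \<Rightarrow> ennreal"
  proof -
    have m: "(\<lambda>\<omega>. if rho_comp n X P R \<omega> = ns then \<Phi> ns (?cm (?I \<omega>)) else 0) \<in> borel_measurable M" if "ns \<in> compositions n" for ns
    proof -
      have "Measurable.pred M (\<lambda>\<omega>. rho_comp n X P R \<omega> = ns)" by (rule measurable_compose[OF rm]) simp
      then show ?thesis
        by (intro measurable_If measurable_compose[OF measurable_compose[OF Im cm] \<Phi>[OF that]] borel_measurable_const predE)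
    qed
    have F: "(\<lambda>z. (\<lambda>ns z. \<Phi> ns (fst z)) (snd z) z) \<in> borel_measurable (concave_space n \<Otimes>\<^sub>M count_space (compositions n))"
      by (rule measurable_compose_countable'[OF measurable_compose[OF measurable_fst \<Phi>] measurable_snd countable_finite[OF finite_compositions]])
    have "(\<Sum>ns\<in>compositions n. \<integral>\<^sup>+ \<omega>. (if rho_comp n X P R \<omega> = ns then \<Phi> ns (?cm (?I \<omega>)) else 0) \<partial>M)
        = (\<integral>\<^sup>+ \<omega>. \<Phi> (rho_comp n X P R \<omega>) (?cm (?I \<omega>)) \<partial>M)"
      by (rule nn_integral_sum_rho_comp[OF hyps, of "\<lambda>ns \<omega>. \<Phi> ns (?cm (?I \<omega>))", OF m, symmetric])
    also have "\<dots> = (\<integral>\<^sup>+ \<omega>. (\<lambda>z. \<Phi> (snd z) (fst z)) (C\<^sub>\<rho> \<omega>, \<Xi> \<omega>) \<partial>M)"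
      by (rule nn_integral_cong) (simp only: C\<rho>' \<Xi>' fst_conv snd_conv)
    also have "\<dots> = (\<integral>\<^sup>+ c\<in>?D. (\<integral>\<^sup>+ ns. (\<lambda>z. \<Phi> (snd z) (fst z)) (c, ns) \<partial>q c) \<partial>distr M (concave_space n) C\<^sub>\<rho>)"
      by (rule regular_cond_distr_nn_integral[OF assms(1) q F])
    finally show ?thesis unfolding lawC fst_conv snd_conv .
  qed
  let ?bc = "\<lambda>ns c. block_ends ns (\<lambda>j. c (real j))"
  have qD: "q c \<in> space (prob_algebra (count_space (compositions n)))" if "c \<in> ?D" for c
  proof -
    have "c \<in> space (restrict_space (concave_space n) ?D)" using that sets.sets_into_space[OF Dm] by (auto simp: space_restrict_space)
    then show ?thesis by (rule measurable_space[OF qm])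
  qed
  have setsq: "sets (q c) = sets (count_space (compositions n))" if "c \<in> ?D" for c
    using qD[OF that] by (simp add: space_prob_algebra)
  have nonempty: "AE c in distr M (concave_space n) C. AE ns in q c. AE y in \<nu> ns (?bc ns c). dominated_permutations n c ns y \<noteq> {}"
  proof -
    let ?\<Phi> = "\<lambda>ns c. \<integral>\<^sup>+ y. indicator {y. dominated_permutations n c ns y = {}} y \<partial>\<nu> ns (?bc ns c) :: ennreal"
    have \<Phi>: "?\<Phi> ns \<in> borel_measurable (concave_space n)" if "ns \<in> compositions n" for ns
      by (rule dominated_nonempty(2)[OF hyps that \<nu>'[OF that]])
    have "(\<integral>\<^sup>+ c\<in>?D. (\<integral>\<^sup>+ ns. ?\<Phi> ns c \<partial>q c) \<partial>distr M (concave_space n) C) = 0"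
      by (rule trans[OF disint[of ?\<Phi>, symmetric]], rule \<Phi>, assumption)
        (intro sum.neutral ballI dominated_nonempty(1)[OF hyps _ \<nu>'])
    moreover have "(\<lambda>c. (\<integral>\<^sup>+ ns. ?\<Phi> ns c \<partial>q c) * indicator ?D c) \<in> borel_measurable (distr M (concave_space n) C)"
    proof -
      have F: "(\<lambda>(c, ns). ?\<Phi> ns c) \<in> borel_measurable (restrict_space (concave_space n) ?D \<Otimes>\<^sub>M count_space (compositions n))"
        unfolding case_prod_beta
        by (rule measurable_compose_countable'[where f = "\<lambda>ns z. ?\<Phi> ns (fst z)", OF measurable_compose[OF measurable_fst measurable_restrict_space1[OF \<Phi>]] measurable_snd countable_finite[OF finite_compositions]])
      have "(\<lambda>c. \<integral>\<^sup>+ ns. ?\<Phi> ns c \<partial>q c) \<in> borel_measurable (restrict_space (concave_space n) ?D)"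
        by (rule nn_integral_measurable_subprob_algebra2[OF F measurable_prob_algebraD[OF qm]])
      then show ?thesis
        unfolding measurable_distr_eq1 using Dm by (subst borel_measurable_restrict_space_iff_ennreal[symmetric]) simp_all
    qed
    ultimately have "AE c in distr M (concave_space n) C. (\<integral>\<^sup>+ ns. ?\<Phi> ns c \<partial>q c) * indicator ?D c = 0"
      by (simp add: nn_integral_0_iff_AE)
    then show ?thesis using AED AE_space
    proof eventually_elim
      case (elim c)
      then have c: "c \<in> ?D" "c \<in> space (concave_space n)" "(\<integral>\<^sup>+ ns. ?\<Phi> ns c \<partial>q c) = 0" by simp_all
      have "?\<Phi> ns c = 0 \<Longrightarrow> AE y in \<nu> ns (?bc ns c). dominated_permutations n c ns y \<noteq> {}" if ns: "ns \<in> compositions n" for ns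
      proof -
        assume z: "?\<Phi> ns c = 0"
        have "?bc ns c \<in> space (ends_space ns)" by (rule measurable_space[OF block_ends_concave_measurable c(2)])
        then have sk: "sets (\<nu> ns (?bc ns c)) = sets (incr_space n)"
          using measurable_space[OF \<nu>m[OF ns]] by (simp add: space_prob_algebra)
        have "(\<lambda>y. if dominated_permutations n c ns y = {} then 1 else 0 :: ennreal) \<in> borel_measurable (incr_space n)"
        proof (intro measurable_If borel_measurable_const)
          have "Measurable.pred (incr_space n) (\<lambda>y. dominated_permutations n (fst (c, y)) ns (snd (c, y)) = {})"
            by (rule measurable_compose[OF measurable_Pair1'[OF c(2)] dominated_eq_measurable[OF ns empty_subsetI]])
          from predE[OF this] show "{y \<in> space (incr_space n). dominated_permutations n c ns y = {}} \<in> sets (incr_space n)"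
            unfolding fst_conv snd_conv .
        qed
        then have "(indicator {y. dominated_permutations n c ns y = {}} :: _ \<Rightarrow> ennreal) \<in> borel_measurable (\<nu> ns (?bc ns c))"
          unfolding measurable_cong_sets[OF sk refl] by (simp add: indicator_def[abs_def] of_bool_def)
        from nn_integral_0_iff_AE[OF this] z
        have "AE y in \<nu> ns (?bc ns c). (indicator {y. dominated_permutations n c ns y = {}} y :: ennreal) = 0" by simp
        then show ?thesis by eventually_elim (simp add: indicator_def)
      qed
      moreover have "AE ns in q c. ?\<Phi> ns c = 0"
      proof -
        have "(\<lambda>ns. ?\<Phi> ns c) \<in> borel_measurable (q c)" unfolding measurable_cong_sets[OF setsq[OF c(1)] refl] by simp
        from nn_integral_0_iff_AE[OF this] c(3) show ?thesis by simp
      qed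
      moreover have "AE ns in q c. ns \<in> compositions n"
        using sets_eq_imp_space_eq[OF setsq[OF c(1)]] by (intro AE_I2) simp
      ultimately show ?case by (elim AE_mp) (rule AE_I2, blast)
    qed
  qed
  have kernel: "(\<lambda>z. \<nu> (snd z) (?bc (snd z) (fst z)) \<bind> (\<lambda>y. distr (measure_pmf (pmf_of_set (dominated_permutations n (fst z) (snd z) y))) (walk_space n) (\<lambda>\<sigma>. walk n (y \<circ> \<sigma>))))
      \<in> restrict_space (concave_space n) ?D \<Otimes>\<^sub>M count_space (compositions n) \<rightarrow>\<^sub>M prob_algebra (walk_space n)"
    (is "(\<lambda>z. ?K (snd z) (fst z)) \<in> _")
  proof (rule measurable_compose_countable'[where f = "\<lambda>ns z. ?K ns (fst z)", OF _ measurable_snd countable_finite[OF finite_compositions]])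
    fix ns assume ns: "ns \<in> compositions n"
    have "?K ns \<in> concave_space n \<rightarrow>\<^sub>M prob_algebra (walk_space n)"
      by (rule measurable_bind_prob_space2[OF measurable_compose[OF block_ends_concave_measurable \<nu>m[OF ns]]])
        (use rho_hat_kernel_measurable(1)[OF ns] in \<open>simp only: case_prod_beta'\<close>)
    then show "(\<lambda>z. ?K ns (fst z)) \<in> restrict_space (concave_space n) ?D \<Otimes>\<^sub>M count_space (compositions n) \<rightarrow>\<^sub>M prob_algebra (walk_space n)"
      by (rule measurable_compose[OF measurable_fst measurable_restrict_space1])
  qed
  have lawm: "rho_hat_law n q \<nu> \<in> restrict_space (concave_space n) ?D \<rightarrow>\<^sub>M prob_algebra (walk_space n)"
    unfolding rho_hat_law_def
    by (rule measurable_bind_prob_space2[OF qm]) (use kernel in \<open>simp only: case_prod_beta'\<close>)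
  have law: "emeasure (rho_hat_law n q \<nu> c) A =
      (\<integral>\<^sup>+ ns. (\<integral>\<^sup>+ y. choice_average n ns (\<lambda>x. indicator A (walk n x)) c y \<partial>\<nu> ns (?bc ns c)) \<partial>q c)"
    if c: "c \<in> ?D" and A: "A \<in> sets (walk_space n)" for c A
  proof -
    have cD: "c \<in> space (restrict_space (concave_space n) ?D)" "c \<in> space (concave_space n)"
      using c sets.sets_into_space[OF Dm] by (auto simp: space_restrict_space)
    have Kc: "(\<lambda>ns. ?K ns c) \<in> count_space (compositions n) \<rightarrow>\<^sub>M prob_algebra (walk_space n)"
      using measurable_compose[OF measurable_Pair1'[OF cD(1)] kernel] by (simp only: fst_conv snd_conv)
    have "emeasure (rho_hat_law n q \<nu> c) A = (\<integral>\<^sup>+ ns. emeasure (?K ns c) A \<partial>q c)"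
      unfolding rho_hat_law_def by (rule emeasure_bind_prob_algebra[OF qD[OF c] Kc A])
    also have "\<dots> = (\<integral>\<^sup>+ ns. (\<integral>\<^sup>+ y. choice_average n ns (\<lambda>x. indicator A (walk n x)) c y \<partial>\<nu> ns (?bc ns c)) \<partial>q c)"
    proof (rule nn_integral_cong)
      fix ns assume "ns \<in> space (q c)"
      then have ns: "ns \<in> compositions n" using sets_eq_imp_space_eq[OF setsq[OF c]] by simp
      have "?bc ns c \<in> space (ends_space ns)" by (rule measurable_space[OF block_ends_concave_measurable cD(2)])
      then have vs: "\<nu> ns (?bc ns c) \<in> space (prob_algebra (incr_space n))" by (rule measurable_space[OF \<nu>m[OF ns]])
      have km: "(\<lambda>y. distr (measure_pmf (pmf_of_set (dominated_permutations n c ns y))) (walk_space n) (\<lambda>\<sigma>. walk n (y \<circ> \<sigma>)))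
          \<in> incr_space n \<rightarrow>\<^sub>M prob_algebra (walk_space n)"
        using measurable_compose[OF measurable_Pair1'[OF cD(2)] rho_hat_kernel_measurable(1)[OF ns]] by (simp only: fst_conv snd_conv)
      show "emeasure (?K ns c) A = (\<integral>\<^sup>+ y. choice_average n ns (\<lambda>x. indicator A (walk n x)) c y \<partial>\<nu> ns (?bc ns c))"
        unfolding emeasure_bind_prob_algebra[OF vs km A]
        using rho_hat_kernel_measurable(2)[OF ns A, of "(c, _)"] by (simp only: fst_conv snd_conv)
    qed
    finally show ?thesis .
  qed
  have "emeasure M {\<omega>\<in>space M. S \<omega> \<in> A \<and> C \<omega> \<in> B} = (\<integral>\<^sup>+ c\<in>B \<inter> ?D. emeasure (rho_hat_law n q \<nu> c) A \<partial>distr M (concave_space n) C)"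
    if A: "A \<in> sets (walk_space n)" and B: "B \<in> sets (concave_space n)" for A B
  proof -
    let ?f = "\<lambda>x. indicator A (walk n x) :: ennreal"
    let ?H = "indicator B :: _ \<Rightarrow> ennreal"
    have f: "?f \<in> borel_measurable (incr_space n)"
      by (rule measurable_compose[OF walk_measurable borel_measurable_indicator[OF A]])
    have H: "?H \<in> borel_measurable (concave_space n)" by (rule borel_measurable_indicator[OF B])
    have fH: "(\<lambda>x. ?f x * ?H (?cm x)) \<in> borel_measurable (incr_space n)"
      by (intro borel_measurable_times_ennreal f measurable_compose[OF cm H])
    let ?\<Phi> = "\<lambda>ns c. \<integral>\<^sup>+ y. ?H c * choice_average n ns ?f c y \<partial>\<nu> ns (?bc ns c)"
    have \<psi>: "(\<lambda>z. ?H (fst z) * choice_average n ns ?f (fst z) (snd z)) \<in> borel_measurable (concave_space n \<Otimes>\<^sub>M incr_space n)"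
      if "ns \<in> compositions n" for ns
      by (intro borel_measurable_times_ennreal measurable_compose[OF measurable_fst H] choice_average_measurable[OF that f])
    have \<Phi>: "?\<Phi> ns \<in> borel_measurable (concave_space n)" if "ns \<in> compositions n" for ns
      using rho_comp_kernel_law(1)[OF hyps that \<nu>'[OF that] \<psi>[OF that]] by (simp only: fst_conv snd_conv)
    have ev: "{\<omega>\<in>space M. S \<omega> \<in> A \<and> C \<omega> \<in> B} \<in> events"
      using measurable_sets[OF Sm A] measurable_sets[OF Cm B]
      by (auto simp: vimage_def Int_def conj_commute intro: sets.sets_Collect_conj)
    have "emeasure M {\<omega>\<in>space M. S \<omega> \<in> A \<and> C \<omega> \<in> B} = (\<integral>\<^sup>+ \<omega>. indicator {\<omega>\<in>space M. S \<omega> \<in> A \<and> C \<omega> \<in> B} \<omega> \<partial>M)"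
      by (rule nn_integral_indicator[OF ev, symmetric])
    also have "\<dots> = (\<integral>\<^sup>+ \<omega>. ?f (increments n X \<omega>) * ?H (?cm (increments n X \<omega>)) \<partial>M)"
      by (rule nn_integral_cong) (simp add: S' C' split: split_indicator)
    also have "\<dots> = (\<integral>\<^sup>+ x. ?f x * ?H (?cm x) \<partial>?\<mu>)"
      by (rule nn_integral_distr[OF iX, symmetric]) (use fH in simp)
    also have "\<dots> = (\<integral>\<^sup>+ \<omega>. ?f (?I \<omega>) * ?H (?cm (?I \<omega>)) \<partial>M)"
      by (rule rho_incr_law[OF hyps rm fH, symmetric])
    also have "\<dots> = (\<Sum>ns\<in>compositions n. \<integral>\<^sup>+ \<omega>. (if rho_comp n X P R \<omega> = ns then ?f (?I \<omega>) * ?H (?cm (?I \<omega>)) else 0) \<partial>M)"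
    proof (rule nn_integral_sum_rho_comp[OF hyps, of "\<lambda>ns \<omega>. ?f (?I \<omega>) * ?H (?cm (?I \<omega>))"])
      fix ns
      have "Measurable.pred M (\<lambda>\<omega>. rho_comp n X P R \<omega> = ns)" by (rule measurable_compose[OF rm]) simp
      then show "(\<lambda>\<omega>. if rho_comp n X P R \<omega> = ns then ?f (?I \<omega>) * ?H (?cm (?I \<omega>)) else 0) \<in> borel_measurable M"
        by (intro measurable_If measurable_compose[OF Im fH] borel_measurable_const predE)
    qed
    also have "\<dots> = (\<Sum>ns\<in>compositions n. \<integral>\<^sup>+ \<omega>. (if rho_comp n X P R \<omega> = ns then ?\<Phi> ns (?cm (?I \<omega>)) else 0) \<partial>M)"
      by (intro sum.cong refl conditional_average[OF hyps _ \<nu>' f H])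
    also have "\<dots> = (\<integral>\<^sup>+ c\<in>?D. (\<integral>\<^sup>+ ns. ?\<Phi> ns c \<partial>q c) \<partial>distr M (concave_space n) C)"
      by (rule disint[OF \<Phi>])
    also have "\<dots> = (\<integral>\<^sup>+ c\<in>B \<inter> ?D. emeasure (rho_hat_law n q \<nu> c) A \<partial>distr M (concave_space n) C)"
    proof (rule nn_integral_cong)
      fix c
      show "(\<integral>\<^sup>+ ns. ?\<Phi> ns c \<partial>q c) * indicator ?D c = emeasure (rho_hat_law n q \<nu> c) A * indicator (B \<inter> ?D) c"
      proof (cases "c \<in> ?D")
        case True
        then show ?thesis using law[OF True A] by (cases "c \<in> B") simp_all
      qed simp
    qed
    finally show ?thesis .
  qed
  then show ?thesis
    unfolding regular_cond_distr_def using nonempty Sm Cm Dm lawm by blast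
qed

end
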